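(* Let $S=\{S_t;t\ge 0\}$ be a driftless subordinator with $S_0=0$ such that $S_t$ has a bounded density $\bar p(t,\cdot)$ for each $t>0$ and whose Lévy measure $\nu$ is infinite; put $w(x)=\nu(x,\infty)$ for $x>0$ and $E_t=\inf\{s>0:S_s>t\}$. Let $E$ be a locally compact separable metric space and $\mu$ a $\sigma$-finite Radon measure on $E$ with full support. Let $(\mathcal L,\mathcal D(\mathcal L))$ be the infinitesimal generator of a (symmetric) Dirichlet form on $L^2(E;\mu)$, with associated transition semigroup $\{P^0_t;t\ge0\}$ in $L^2(E;\mu)$, and let $\langle\cdot,\cdot\rangle$ be the inner product of $L^2(E;\mu)$. Let $T_0\in(0,\infty)$, $g\in L^2(E;\mu)$, and let $f(t,x)$ be a function on $(0,T_0]\times E$ with $\|f(t,\cdot)\|_{L^2(E;\mu)}\le K<\infty$ for a.e. $t\in(0,T_0]$. Then $$u(t,x):=\mathbb E\left[P^0_{E_t}g(x)\right]+\int_{s=0}^t\int_{r=0}^\infty P^0_rf(s,\cdot)(x)\,\bar p(r,t-s)\,dr\,ds$$ is the unique weak solution of $\partial^w_tu(t,x)=\mathcal Lu(t,x)+f(t,x)$ on $(0,T_0]\times E$ with $u(0,x)=g(x)$ in the following sense (that is, $u$ satisfies (i)--(ii), and any function satisfying (i)--(ii) coincides with $u(t,\cdot)$ in $L^2(E;\mu)$ for every $t\in(0,T_0]$): (i) $u(t,\cdot)$ is well defined as an element of $L^2(E;\mu)$ for every $t\in(0,T_0]$, $t\mapsto u(t,\cdot)$ is continuous in $L^2(E;\mu)$,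 $\sup_{t\in(0,T_0]}\|u(t,\cdot)\|_{L^2(E;\mu)}<\infty$, and $u(t,\cdot)\to g$ in $L^2(E;\mu)$ as $t\to0$. (ii) For every $T\in(0,T_0]$, $\int_0^Tw(T-t)(u(t,\cdot)-g(\cdot))\,dt$ is absolutely convergent in $L^2(E;\mu)$, and $$\left\langle\int_0^Tw(T-s)\left(u(s,\cdot)-g(\cdot)\right)ds,\varphi\right\rangle=\int_0^T\langle f(s,\cdot),\varphi\rangle\,ds+\int_0^T\langle u(s,\cdot),\mathcal L\varphi\rangle\,ds$$ for every $\varphi\in\mathcal D(\mathcal L)$. Furthermore, if $\sup_{t\in(0,T_0]}\|\mathcal Lf(t,\cdot)\|_{L^2(E;\mu)}<\infty$ (in particular $f(t,\cdot)\in\mathcal D(\mathcal L)$), then $t\mapsto\mathcal Lu(t,\cdot)$ is also continuous in $L^2(E;\mu)$.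
   Context: A driftless subordinator $S$ is a nondecreasing Lévy process with $\mathbb E[e^{-\lambda S_t}]=e^{-t\phi(\lambda)}$, $\phi(\lambda)=\int_0^\infty(1-e^{-\lambda x})\,\nu(dx)$, where the Lévy measure $\nu$ on $(0,\infty)$ satisfies $\int_0^\infty\min\{1,x\}\,\nu(dx)<\infty$. $\nu$ infinite means $\nu(0,\infty)=\infty$; equivalently $w$ is unbounded. $\bar p(r,\cdot)$ is the density of $S_r$, jointly measurable in $(r,t)$. $E_t$ is the inverse subordinator. The generalized time fractional derivative with weight $w$ is formally $\partial^w_tf(t)=\frac{d}{dt}\int_0^tw(t-s)(f(s)-f(0))\,ds$; the precise meaning of the equation is given by (i)--(ii). Integrals of $L^2(E;\mu)$-valued functions are Bochner integrals, and $t\mapsto f(t,\cdot)$ (and likewise any candidate solution) is understood to be strongly measurable. *)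

theory Defs
  imports "HOL-Probability.Probability"
begin

section \<open>The space \<open>L\<^sup>2(E; \<mu>)\<close>\<close>

definition radon_measure :: "'e::topological_space measure \<Rightarrow> bool" where
  "radon_measure \<mu> \<longleftrightarrow>
     sets \<mu> = sets borel \<and>
     (\<forall>K. compact K \<longrightarrow> emeasure \<mu> K < \<infinity>) \<and>
     (\<forall>B \<in> sets borel. emeasure \<mu> B = (SUP K \<in> {K. compact K \<and> K \<subseteq> B}. emeasure \<mu> K))"

definition full_support :: "'e::topological_space measure \<Rightarrow> bool" where
  "full_support \<mu> \<longleftrightarrow> (\<forall>U. open U \<and> U \<noteq> {} \<longrightarrow> emeasure \<mu> U > 0)"

definition square_integrable :: "'e measure \<Rightarrow> ('e \<Rightarrow> real) \<Rightarrow> bool" where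
  "square_integrable \<mu> f \<longleftrightarrow> f \<in> borel_measurable \<mu> \<and> integrable \<mu> (\<lambda>x. (f x)\<^sup>2)"

text \<open>
  A type cannot depend on the measure \<open>\<mu>\<close>, so \<open>L\<^sup>2(E; \<mu>)\<close> is presented as a Hilbert space type
  together with the quotient map \<open>cls\<close>, which sends a square integrable function to its class
  modulo \<open>\<mu>\<close>-a.e. equality (see \<open>l2_space_eq_iff\<close> below). The values of \<open>cls\<close> at functions that
  are not square integrable are unspecified.

  The sort of \<open>'h\<close> is what the Bochner integral of the library requires. It is no restriction:
  the quotient is complete by the Riesz--Fischer theorem, and it is separable when \<open>\<mu>\<close> is a
  \<open>\<sigma>\<close>-finite Borel measure on a separable metric space.
\<close>

definition l2_space ::
  "'e measure \<Rightarrow> (('e \<Rightarrow> real) \<Rightarrow> 'h::{real_inner, banach, second_countable_topology}) \<Rightarrow> bool" where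
  "l2_space \<mu> cls \<longleftrightarrow>
     (\<forall>f g. square_integrable \<mu> f \<longrightarrow> square_integrable \<mu> g \<longrightarrow>
        cls (\<lambda>x. f x + g x) = cls f + cls g) \<and>
     (\<forall>c f. square_integrable \<mu> f \<longrightarrow> cls (\<lambda>x. c * f x) = c *\<^sub>R cls f) \<and>
     (\<forall>f g. square_integrable \<mu> f \<longrightarrow> square_integrable \<mu> g \<longrightarrow>
        cls f \<bullet> cls g = (\<integral>x. f x * g x \<partial>\<mu>)) \<and>
     (\<forall>h. \<exists>f. square_integrable \<mu> f \<and> cls f = h)"

lemma l2_space_eq_iff:
  assumes "l2_space \<mu> cls" "square_integrable \<mu> f" "square_integrable \<mu> g"
  shows "cls f = cls g \<longleftrightarrow> (AE x in \<mu>. f x = g x)"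
proof -
  have m: "square_integrable \<mu> (\<lambda>x. (-1) * g x)"
    using assms(3) by (simp add: square_integrable_def)
  have prod: "integrable \<mu> (\<lambda>x. f x * g x)"
  proof (rule Bochner_Integration.integrable_bound[where f="\<lambda>x. (f x)\<^sup>2 + (g x)\<^sup>2"])
    show "AE x in \<mu>. norm (f x * g x) \<le> norm ((f x)\<^sup>2 + (g x)\<^sup>2)"
    proof (rule AE_I2)
      fix x
      have "2 * \<bar>f x * g x\<bar> \<le> (f x)\<^sup>2 + (g x)\<^sup>2"
        using sum_squares_bound[of "\<bar>f x\<bar>" "\<bar>g x\<bar>"] by (simp add: abs_mult mult.assoc)
      then have "\<bar>f x * g x\<bar> \<le> (f x)\<^sup>2 + (g x)\<^sup>2"
        using abs_ge_zero[of "f x * g x"] by (rule_tac order_trans[rotated]) (assumption, simp)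
      then show "norm (f x * g x) \<le> norm ((f x)\<^sup>2 + (g x)\<^sup>2)"
        by simp
    qed
  qed (use assms in \<open>auto simp: square_integrable_def\<close>)
  have d: "square_integrable \<mu> (\<lambda>x. f x + (-1) * g x)"
  proof -
    have "integrable \<mu> (\<lambda>x. (f x)\<^sup>2 + (g x)\<^sup>2 - 2 * (f x * g x))"
      using assms prod by (auto simp: square_integrable_def)
    moreover have "(\<lambda>x. (f x + (-1) * g x)\<^sup>2) = (\<lambda>x. (f x)\<^sup>2 + (g x)\<^sup>2 - 2 * (f x * g x))"
      by (simp add: fun_eq_iff power2_diff)
    moreover have "(\<lambda>x. f x + (-1) * g x) \<in> borel_measurable \<mu>"
      using assms(2,3) m by (intro borel_measurable_add) (auto simp: square_integrable_def)
    ultimately show ?thesis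
      by (simp add: square_integrable_def)
  qed
  have "cls (\<lambda>x. f x + (-1) * g x) = cls f + cls (\<lambda>x. (-1) * g x)"
    using assms(1,2) m unfolding l2_space_def by blast
  also have "cls (\<lambda>x. (-1) * g x) = (-1) *\<^sub>R cls g"
    using assms(1,3) unfolding l2_space_def by blast
  finally have c: "cls (\<lambda>x. f x + (-1) * g x) = cls f - cls g"
    by simp
  have "cls (\<lambda>x. f x + (-1) * g x) \<bullet> cls (\<lambda>x. f x + (-1) * g x) =
      (\<integral>x. (f x + (-1) * g x) * (f x + (-1) * g x) \<partial>\<mu>)"
    using assms(1) d unfolding l2_space_def by blast
  then have "(cls f - cls g) \<bullet> (cls f - cls g) =
      (\<integral>x. (f x + (-1) * g x) * (f x + (-1) * g x) \<partial>\<mu>)"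
    by (simp only: c)
  then have "cls f = cls g \<longleftrightarrow> (\<integral>x. (f x + (-1) * g x)\<^sup>2 \<partial>\<mu>) = 0"
    unfolding power2_eq_square by (metis eq_iff_diff_eq_0 inner_eq_zero_iff)
  also have "\<dots> \<longleftrightarrow> (AE x in \<mu>. f x = g x)"
    using d by (subst integral_nonneg_eq_0_iff_AE) (auto simp: square_integrable_def)
  finally show ?thesis .
qed

section \<open>Dirichlet forms, generators and semigroups\<close>

definition dirichlet_form ::
  "'e measure \<Rightarrow> (('e \<Rightarrow> real) \<Rightarrow> 'h::real_inner) \<Rightarrow> 'h set \<Rightarrow> ('h \<Rightarrow> 'h \<Rightarrow> real) \<Rightarrow> bool" where
  "dirichlet_form \<mu> cls F \<E> \<longleftrightarrow>
     subspace F \<and> closure F = UNIV \<and>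
     (\<forall>u\<in>F. \<forall>v\<in>F. \<forall>z\<in>F. \<E> (u + v) z = \<E> u z + \<E> v z) \<and>
     (\<forall>c. \<forall>u\<in>F. \<forall>v\<in>F. \<E> (c *\<^sub>R u) v = c * \<E> u v) \<and>
     (\<forall>u\<in>F. \<forall>v\<in>F. \<E> u v = \<E> v u) \<and>
     (\<forall>u\<in>F. 0 \<le> \<E> u u) \<and>
     \<comment> \<open>closedness: completeness for the norm of \<open>\<E>(u, v) + \<langle>u, v\<rangle>\<close>\<close>
     (\<forall>u :: nat \<Rightarrow> 'h. (\<forall>n. u n \<in> F) \<and>
        (\<forall>e>0. \<exists>N. \<forall>m\<ge>N. \<forall>n\<ge>N.
           \<E> (u m - u n) (u m - u n) + (u m - u n) \<bullet> (u m - u n) < e) \<longrightarrow>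
        (\<exists>v\<in>F. (\<lambda>n. \<E> (u n - v) (u n - v) + (u n - v) \<bullet> (u n - v)) \<longlonglongrightarrow> 0)) \<and>
     \<comment> \<open>Markov property: the unit contraction operates on \<open>\<E>\<close>\<close>
     (\<forall>f. square_integrable \<mu> f \<and> cls f \<in> F \<longrightarrow>
        cls (\<lambda>x. min 1 (max 0 (f x))) \<in> F \<and>
        \<E> (cls (\<lambda>x. min 1 (max 0 (f x)))) (cls (\<lambda>x. min 1 (max 0 (f x)))) \<le> \<E> (cls f) (cls f))"

definition form_generator_dom :: "'h::real_inner set \<Rightarrow> ('h \<Rightarrow> 'h \<Rightarrow> real) \<Rightarrow> 'h set" where
  "form_generator_dom F \<E> = {u \<in> F. \<exists>h. \<forall>v\<in>F. \<E> u v = - (h \<bullet> v)}"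

text \<open>The vector below is unique because \<open>F\<close> is dense.\<close>

definition form_generator :: "'h::real_inner set \<Rightarrow> ('h \<Rightarrow> 'h \<Rightarrow> real) \<Rightarrow> 'h \<Rightarrow> 'h" where
  "form_generator F \<E> u = (THE h. \<forall>v\<in>F. \<E> u v = - (h \<bullet> v))"

definition contraction_semigroup :: "(real \<Rightarrow> 'h::real_normed_vector \<Rightarrow> 'h) \<Rightarrow> bool" where
  "contraction_semigroup P \<longleftrightarrow>
     (\<forall>t\<ge>0. linear (P t)) \<and>
     (\<forall>t\<ge>0. \<forall>h. norm (P t h) \<le> norm h) \<and>
     (\<forall>h. P 0 h = h) \<and>
     (\<forall>s\<ge>0. \<forall>t\<ge>0. \<forall>h. P (s + t) h = P s (P t h)) \<and>
     (\<forall>h. ((\<lambda>t. P t h) \<longlongrightarrow> h) (at_right 0))"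

text \<open>\<open>P\<close> is the strongly continuous contraction semigroup whose infinitesimal generator, with its
  exact domain, is the generator of the form.\<close>

definition associated_semigroup ::
  "'h::real_inner set \<Rightarrow> ('h \<Rightarrow> 'h \<Rightarrow> real) \<Rightarrow> (real \<Rightarrow> 'h \<Rightarrow> 'h) \<Rightarrow> bool" where
  "associated_semigroup F \<E> P \<longleftrightarrow>
     contraction_semigroup P \<and>
     (\<forall>u h. ((\<lambda>t. (P t u - u) /\<^sub>R t) \<longlongrightarrow> h) (at_right 0) \<longleftrightarrow>
        u \<in> form_generator_dom F \<E> \<and> h = form_generator F \<E> u)"

section \<open>Subordinators\<close>

text \<open>Only the values of \<open>S\<close> at nonnegative times matter. The path properties hold for every
  outcome, as usual for a Levy process; left limits exist by monotonicity.\<close>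

definition subordinator :: "'w measure \<Rightarrow> (real \<Rightarrow> 'w \<Rightarrow> real) \<Rightarrow> bool" where
  "subordinator M S \<longleftrightarrow>
     prob_space M \<and>
     (\<forall>t\<ge>0. S t \<in> borel_measurable M) \<and>
     (\<forall>\<omega>\<in>space M. S 0 \<omega> = 0 \<and> mono_on {0..} (\<lambda>t. S t \<omega>) \<and>
        (\<forall>t\<ge>0. continuous (at_right t) (\<lambda>t. S t \<omega>))) \<and>
     (\<forall>(n::nat) t :: nat \<Rightarrow> real. 0 \<le> t 0 \<and> (\<forall>i<n. t i \<le> t (Suc i)) \<longrightarrow>
        prob_space.indep_vars M (\<lambda>_. borel) (\<lambda>i \<omega>. S (t (Suc i)) \<omega> - S (t i) \<omega>) {..<n}) \<and>
     (\<forall>s\<ge>0. \<forall>t\<ge>0. distr M borel (\<lambda>\<omega>. S (s + t) \<omega> - S s \<omega>) = distr M borel (S t))"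

definition levy_measure_subordinator :: "real measure \<Rightarrow> bool" where
  "levy_measure_subordinator \<nu> \<longleftrightarrow>
     sets \<nu> = sets borel \<and> emeasure \<nu> {..0} = 0 \<and> (\<integral>\<^sup>+x. ennreal (min 1 x) \<partial>\<nu>) < \<infinity>"

definition driftless_subordinator ::
  "'w measure \<Rightarrow> (real \<Rightarrow> 'w \<Rightarrow> real) \<Rightarrow> real measure \<Rightarrow> bool" where
  "driftless_subordinator M S \<nu> \<longleftrightarrow>
     subordinator M S \<and> levy_measure_subordinator \<nu> \<and>
     (\<forall>t\<ge>0. \<forall>c\<ge>0. (\<integral>\<omega>. exp (- c * S t \<omega>) \<partial>M) = exp (- t * (\<integral>x. 1 - exp (- c * x) \<partial>\<nu>)))"

definition bounded_densities ::
  "'w measure \<Rightarrow> (real \<Rightarrow> 'w \<Rightarrow> real) \<Rightarrow> (real \<Rightarrow> real \<Rightarrow> real) \<Rightarrow> bool" where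
  "bounded_densities M S p \<longleftrightarrow>
     (\<lambda>(r, x). p r x) \<in> borel_measurable (restrict_space borel {0<..} \<Otimes>\<^sub>M borel) \<and>
     (\<forall>r>0. (\<forall>x. 0 \<le> p r x) \<and> (\<exists>C. \<forall>x. p r x \<le> C) \<and>
        distributed M lborel (S r) (\<lambda>x. ennreal (p r x)))"

definition levy_tail :: "real measure \<Rightarrow> real \<Rightarrow> real" where
  "levy_tail \<nu> x = measure \<nu> {x<..}"

text \<open>If \<open>\<nu> \<noteq> 0\<close>, then \<open>S\<close> tends to infinity a.s., so the set below is a.s. nonempty; where it is
  empty, \<open>Inf {}\<close> is some fixed real number.\<close>

definition inverse_subordinator :: "(real \<Rightarrow> 'w \<Rightarrow> real) \<Rightarrow> real \<Rightarrow> 'w \<Rightarrow> real" where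
  "inverse_subordinator S t \<omega> = Inf {s. 0 < s \<and> t < S s \<omega>}"

section \<open>The time fractional equation\<close>

text \<open>Time integrals are taken with respect to \<open>lebesgue\<close> rather than \<open>lborel\<close>, because a strongly
  measurable \<open>f\<close> need only be Lebesgue measurable in \<open>t\<close>.\<close>

definition candidate_solution ::
  "'w measure \<Rightarrow> (real \<Rightarrow> 'w \<Rightarrow> real) \<Rightarrow> (real \<Rightarrow> real \<Rightarrow> real) \<Rightarrow>
   (real \<Rightarrow> 'h \<Rightarrow> 'h) \<Rightarrow> (real \<Rightarrow> 'h) \<Rightarrow> 'h \<Rightarrow> real \<Rightarrow>
   'h::{real_inner, banach, second_countable_topology}" where
  "candidate_solution M S p P f g t =
     (\<integral>\<omega>. P (inverse_subordinator S t \<omega>) g \<partial>M) +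
     (LINT s:{0<..t}|lebesgue. (LINT r:{0<..}|lebesgue. p r (t - s) *\<^sub>R P r (f s)))"

text \<open>Integrals of non-integrable functions are \<open>0\<close> in the library, so the convergence of the
  integrals above has to be stated separately.\<close>

definition candidate_well_defined ::
  "'w measure \<Rightarrow> (real \<Rightarrow> 'w \<Rightarrow> real) \<Rightarrow> (real \<Rightarrow> real \<Rightarrow> real) \<Rightarrow>
   (real \<Rightarrow> 'h \<Rightarrow> 'h) \<Rightarrow> (real \<Rightarrow> 'h) \<Rightarrow>
   'h::{real_inner, banach, second_countable_topology} \<Rightarrow> real \<Rightarrow> bool" where
  "candidate_well_defined M S p P f g t \<longleftrightarrow>
     integrable M (\<lambda>\<omega>. P (inverse_subordinator S t \<omega>) g) \<and>
     (AE s in lebesgue_on {0<..t}.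
        set_integrable lebesgue {0<..} (\<lambda>r. p r (t - s) *\<^sub>R P r (f s))) \<and>
     set_integrable lebesgue {0<..t}
       (\<lambda>s. LINT r:{0<..}|lebesgue. p r (t - s) *\<^sub>R P r (f s))"

definition weak_solution ::
  "(real \<Rightarrow> real) \<Rightarrow> 'h set \<Rightarrow> ('h \<Rightarrow> 'h) \<Rightarrow> (real \<Rightarrow> 'h) \<Rightarrow> 'h \<Rightarrow> real \<Rightarrow>
   (real \<Rightarrow> 'h::{real_inner, banach, second_countable_topology}) \<Rightarrow> bool" where
  "weak_solution w D L f g T0 u \<longleftrightarrow>
     continuous_on {0<..T0} u \<and>
     bdd_above ((\<lambda>t. norm (u t)) ` {0<..T0}) \<and>
     (u \<longlongrightarrow> g) (at_right 0) \<and>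
     (\<forall>T\<in>{0<..T0}.
        set_integrable lebesgue {0<..<T} (\<lambda>t. w (T - t) *\<^sub>R (u t - g)) \<and>
        (\<forall>\<phi>\<in>D.
           (LINT s:{0<..<T}|lebesgue. w (T - s) *\<^sub>R (u s - g)) \<bullet> \<phi> =
           (LINT s:{0<..T}|lebesgue. f s \<bullet> \<phi>) + (LINT s:{0<..T}|lebesgue. u s \<bullet> L \<phi>)))"

end

theory Submission
  imports Defs
begin

text \<open>
  Write \<open>w * p\<^sub>r\<close> for the convolution of \<open>w\<close> with the density of \<open>S\<^sub>r\<close>. Comparing Laplace transforms
  shows that, for almost every \<open>\<tau>\<close>, the law of \<open>E\<^sub>\<tau>\<close> has the density \<open>r \<mapsto> (w * p\<^sub>r)(\<tau>)\<close>. If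
  \<open>G(\<tau>) = \<integral> p\<^sub>r(\<tau>) P\<^sub>r dr\<close> and \<open>Q(\<tau>)\<close> is the mean of the operator \<open>P\<close> at time \<open>E\<^sub>\<tau>\<close>, this says
  \<open>w * G = Q\<close>, while Dynkin's formula for \<open>r \<mapsto> P\<^sub>r\<close> says \<open>Q = id + 1 * (G L)\<close> on the domain. Since
  \<open>u = Q g + G * f\<close>, the weak equation follows from these two identities and Fubini's theorem.

  Uniqueness is a maximum principle. If \<open>y\<close> is the primitive of the difference of two solutions,
  then \<open>L (y T) = \<integral> (y T - y (max 0 (T - z))) \<nu>(dz)\<close>. Testing with \<open>y T\<close> at the first maximizer \<open>T\<close> of
  the norm of \<open>y\<close> makes the right-hand side positive and the left-hand side nonpositive.

  The regularity of \<open>L u\<close> needs a bound \<open>norm (L (Q(t) g)) \<le> C * norm g\<close>. By self-adjointness it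
  suffices to bound the quadratic form of \<open>- L Q(t)\<close>, which is the mean of a decreasing integrable
  function at \<open>E\<^sub>t\<close>; and the probability that \<open>E\<^sub>t \<le> R\<close> is at most \<open>C * R\<close>, by Markov's inequality.
\<close>

section \<open>Symmetric contraction semigroups\<close>

text \<open>No spectral theorem is used. That \<open>Q t h\<close>, \<open>U f t\<close> and the
  primitive of a difference of two weak solutions lie in the domain of the unbounded
  \<open>L\<close> is shown by testing: \<open>y \<bullet> L x = h \<bullet> x\<close> for all
  \<open>x\<close> in \<open>D\<close> forces \<open>y \<in> D\<close> and \<open>L y = h\<close>.
  So \<open>L\<close> never has to be exchanged with a Bochner integral. The law of the inverse
  process comes from inverting a Laplace transform, hence is known to have the density in question
  only at almost every time. It is therefore used only under a time integral. Statements at a single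
  time (continuity, Dynkin's formula, the bound on \<open>L (Q t h)\<close>) rest on a pathwise
  comparison of \<open>S\<close> with its inverse and on the absence of atoms. The initial value is
  treated as a source: \<open>Q t g - g\<close> tested with \<open>x\<close> is the response
  \<open>U\<close> to the constant source \<open>g\<close>, tested with \<open>L x\<close>. One
  convolution lemma, with the kernels \<open>w\<close> and 1, then serves both terms of the solution
  formula. Uniqueness argues with a primitive because the difference itself need not lie in
  \<open>D\<close>.\<close>

lemma has_vector_derivative_iff_quotient:
  "(f has_vector_derivative d) (at r within S) \<longleftrightarrow>
   ((\<lambda>s. (f s - f r) /\<^sub>R (s - r)) \<longlongrightarrow> d) (at r within S)"
proof -
  have "norm ((f s - f r) /\<^sub>R (s - r) - d) = norm (f s - f r - (s - r) *\<^sub>R d) / norm (s - r)"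
    if "s \<noteq> r" for s
  proof -
    have "(f s - f r) /\<^sub>R (s - r) - d = (f s - f r - (s - r) *\<^sub>R d) /\<^sub>R (s - r)"
      using that by (simp add: scaleR_diff_right)
    then show ?thesis by (simp add: divide_inverse mult.commute)
  qed
  then have "((\<lambda>s. norm ((f s - f r) /\<^sub>R (s - r) - d)) \<longlongrightarrow> 0) (at r within S) \<longleftrightarrow>
      ((\<lambda>s. norm (f s - f r - (s - r) *\<^sub>R d) / norm (s - r)) \<longlongrightarrow> 0) (at r within S)"
    by (intro filterlim_cong) (simp_all add: eventually_at_filter)
  then show ?thesis
    unfolding has_vector_derivative_def has_derivative_iff_norm
    by (simp add: bounded_linear_scaleR_left tendsto_norm_zero_iff LIM_zero_iff)
qed

text \<open>Layer-cake: every superlevel set of \<open>k\<close> is an initial segment of \<open>[0, \<infinity>)\<close>.\<close>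

lemma nn_integral_antimono_le:
  fixes k :: "real \<Rightarrow> real" and X :: "'w \<Rightarrow> real"
  assumes M: "sigma_finite_measure M" and [measurable]: "X \<in> borel_measurable M" and X: "\<And>\<omega>. \<omega> \<in> space M \<Longrightarrow> 0 \<le> X \<omega>"
    and bound: "\<And>R. 0 \<le> R \<Longrightarrow> emeasure M {\<omega>\<in>space M. X \<omega> \<le> R} \<le> ennreal C * ennreal R"
    and C: "0 < C"
    and anti: "\<And>s t. 0 \<le> s \<Longrightarrow> s \<le> t \<Longrightarrow> k t \<le> k s" and nonneg: "\<And>t. 0 \<le> t \<Longrightarrow> 0 \<le> k t"
    and cont: "continuous_on {0..} k"
  shows "(\<integral>\<^sup>+\<omega>. ennreal (k (X \<omega>)) \<partial>M) \<le> ennreal C * (\<integral>\<^sup>+r. ennreal (k r) * indicator {0..} r \<partial>lborel)"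
proof -
  interpret M: sigma_finite_measure M by fact
  interpret pair_sigma_finite M lborel ..
  define k' where "k' r = (if 0 \<le> r then k r else 0)" for r
  have [measurable]: "k' \<in> borel_measurable borel"
  proof -
    have "k' = (\<lambda>r. indicator {0..} r *\<^sub>R k r)" by (auto simp: k'_def)
    then show ?thesis using borel_measurable_continuous_on_indicator[OF _ cont] by simp
  qed
  have layer: "ennreal (k' r) = (\<integral>\<^sup>+y. indicator {0..<k' r} y \<partial>lborel)" for r
    by (simp add: k'_def nonneg)
  have "(\<integral>\<^sup>+\<omega>. ennreal (k (X \<omega>)) \<partial>M) = (\<integral>\<^sup>+\<omega>. \<integral>\<^sup>+y. indicator {0..<k' (X \<omega>)} y \<partial>lborel \<partial>M)"
    by (intro nn_integral_cong) (simp add: X k'_def nonneg)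
  also have "\<dots> = (\<integral>\<^sup>+y. \<integral>\<^sup>+\<omega>. indicator {0..<k' (X \<omega>)} y \<partial>M \<partial>lborel)"
    by (intro Fubini'[symmetric]) (simp add: indicator_def)
  also have "\<dots> \<le> (\<integral>\<^sup>+y. ennreal C * (\<integral>\<^sup>+r. indicator {0..<k' r} y * indicator {0..} r \<partial>lborel) \<partial>lborel)"
  proof (intro nn_integral_mono)
    fix y :: real
    define A where "A = {r. 0 \<le> r \<and> y < k' r}"
    have [measurable]: "A \<in> sets borel" unfolding A_def by measurable
    have "(\<integral>\<^sup>+\<omega>. indicator {0..<k' (X \<omega>)} y \<partial>M) \<le> ennreal C * emeasure lborel A" if "0 \<le> y"
    proof (cases "emeasure lborel A")
      case (real R)
      \<comment> \<open>With \<open>r\<close> the set \<open>A\<close> contains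
        \<open>{0..r}\<close>, so \<open>r\<close> is at most the length \<open>R\<close> of
        \<open>A\<close>. Hence \<open>X \<omega> \<in> A\<close> implies
        \<open>X \<omega> \<le> R\<close>, and the assumed bound applies with this
        \<open>R\<close>.\<close>
      have "r \<le> R" if "r \<in> A" for r
      proof -
        have "{0..r} \<subseteq> A"
          using that anti[of _ r] by (fastforce simp: A_def k'_def)
        then have "emeasure lborel {0..r} \<le> emeasure lborel A"
          by (intro emeasure_mono) auto
        then show ?thesis using that real by (simp add: A_def)
      qed
      then have "(\<integral>\<^sup>+\<omega>. indicator {0..<k' (X \<omega>)} y \<partial>M) \<le> (\<integral>\<^sup>+\<omega>. indicator {\<omega>\<in>space M. X \<omega> \<le> R} \<omega> \<partial>M)"
        using X by (intro nn_integral_mono) (auto split: split_indicator simp: A_def)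
      also have "\<dots> = emeasure M {\<omega>\<in>space M. X \<omega> \<le> R}" by simp
      also have "\<dots> \<le> ennreal C * emeasure lborel A"
        using bound[of R] real by simp
      finally show ?thesis .
    next
      case top
      then show ?thesis using C by (simp add: ennreal_mult_top)
    qed
    moreover have "(\<integral>\<^sup>+r. indicator {0..<k' r} y * indicator {0..} r \<partial>lborel) = (emeasure lborel A :: ennreal)" if "0 \<le> y"
    proof -
      have "(\<integral>\<^sup>+r. indicator {0..<k' r} y * indicator {0..} r \<partial>lborel) = (\<integral>\<^sup>+r. indicator A r \<partial>lborel)"
        using that by (intro nn_integral_cong) (auto simp: A_def split: split_indicator)
      then show ?thesis by simp
    qed
    ultimately show "(\<integral>\<^sup>+\<omega>. indicator {0..<k' (X \<omega>)} y \<partial>M) \<le>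
        ennreal C * (\<integral>\<^sup>+r. indicator {0..<k' r} y * indicator {0..} r \<partial>lborel)"
      by (cases "0 \<le> y") simp_all
  qed
  also have "\<dots> = ennreal C * (\<integral>\<^sup>+y. \<integral>\<^sup>+r. indicator {0..<k' r} y * indicator {0..} r \<partial>lborel \<partial>lborel)"
    by (intro nn_integral_cmult) (simp add: indicator_def)
  also have "(\<integral>\<^sup>+y. \<integral>\<^sup>+r. indicator {0..<k' r} y * indicator {0..} r \<partial>lborel \<partial>lborel) =
      (\<integral>\<^sup>+r. \<integral>\<^sup>+y. indicator {0..<k' r} y * indicator {0..} r \<partial>lborel \<partial>lborel)"
    by (intro lborel_pair.Fubini') (simp add: indicator_def)
  also have "\<dots> = (\<integral>\<^sup>+r. ennreal (k r) * indicator {0..} r \<partial>lborel)"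
    by (intro nn_integral_cong) (auto simp: nn_integral_multc k'_def nonneg split: split_indicator)
  finally show ?thesis .
qed

text \<open>The equivalence in \<open>generator_iff\<close> fixes the generator together with its
  exact domain; this is what lets a weak identity imply membership in \<open>D\<close>. Symmetry is
  assumed of \<open>L\<close> only, that of \<open>P\<close> is derived.\<close>

locale symmetric_contraction_semigroup =
  fixes P :: "real \<Rightarrow> 'h::{real_inner, banach, second_countable_topology} \<Rightarrow> 'h" and D :: "'h set" and L :: "'h \<Rightarrow> 'h"
  assumes contraction_semigroup: "contraction_semigroup P"
    and generator_iff: "\<And>u h. ((\<lambda>t. (P t u - u) /\<^sub>R t) \<longlongrightarrow> h) (at_right 0) \<longleftrightarrow> u \<in> D \<and> h = L u"
    and L_symmetric: "\<And>u v. u \<in> D \<Longrightarrow> v \<in> D \<Longrightarrow> L u \<bullet> v = u \<bullet> L v"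
begin

lemma linear_P: "0 \<le> t \<Longrightarrow> linear (P t)"
  and norm_P_le: "0 \<le> t \<Longrightarrow> norm (P t h) \<le> norm h"
  and P_0 [simp]: "P 0 h = h"
  and P_add: "0 \<le> s \<Longrightarrow> 0 \<le> t \<Longrightarrow> P (s + t) h = P s (P t h)"
  and P_tendsto_0: "((\<lambda>t. P t h) \<longlongrightarrow> h) (at_right 0)"
  using contraction_semigroup by (auto simp: contraction_semigroup_def)

lemma P_diff: "0 \<le> t \<Longrightarrow> P t (x - y) = P t x - P t y"
  and P_plus: "0 \<le> t \<Longrightarrow> P t (x + y) = P t x + P t y"
  and P_scaleR: "0 \<le> t \<Longrightarrow> P t (c *\<^sub>R x) = c *\<^sub>R P t x"
  and P_zero [simp]: "0 \<le> t \<Longrightarrow> P t 0 = 0"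
  using linear_P[of t] by (auto simp: linear_diff linear_add linear_scale linear_0)

lemma P_commute: "0 \<le> s \<Longrightarrow> 0 \<le> t \<Longrightarrow> P s (P t h) = P t (P s h)"
  by (metis P_add add.commute)

lemma bounded_linear_P: "0 \<le> t \<Longrightarrow> bounded_linear (P t)"
  using linear_P[of t] norm_P_le[of t]
  by (auto intro!: bounded_linear_intro[where K=1] simp: linear_add linear_scale)

lemma norm_P_diff_le:
  assumes "0 \<le> s" "0 \<le> t"
  shows "norm (P s h - P t h) \<le> norm (P \<bar>s - t\<bar> h - h)"
proof -
  have "norm (P s h - P t h) \<le> norm (P (s - t) h - h)" if "0 \<le> t" "t \<le> s" for s t
    using that norm_P_le[of t "P (s - t) h - h"] P_add[of t "s - t" h] by (simp add: P_diff)
  from this[of t s] this[of s t] assms show ?thesis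
    by (cases "t \<le> s") (auto simp: norm_minus_commute)
qed

lemma P_tendsto_0': "((\<lambda>t. P t h) \<longlongrightarrow> h) (at 0 within {0..})"
proof -
  have "at 0 within {0::real..} = at_right 0"
    by (metis at_within_Ici_at_right)
  then show ?thesis using P_tendsto_0 by simp
qed

lemma P_tendsto_abs:
  assumes "(a \<longlongrightarrow> 0) G"
  shows "((\<lambda>x. P \<bar>a x\<bar> h) \<longlongrightarrow> h) G"
proof -
  have "continuous (at 0 within {0..}) (\<lambda>t. P t h)"
    using P_tendsto_0' by (simp add: continuous_within)
  moreover have "((\<lambda>x. \<bar>a x\<bar>) \<longlongrightarrow> 0) G"
    using assms tendsto_rabs_zero by blast
  ultimately have "((\<lambda>x. P \<bar>a x\<bar> h) \<longlongrightarrow> P 0 h) G"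
    using continuous_within_tendsto_compose'[where S="{0..}" and f="\<lambda>t. P t h" and a=0 and x="\<lambda>x. \<bar>a x\<bar>"]
    by auto
  then show ?thesis by simp
qed

text \<open>Joint continuity in time and vector: contractivity absorbs the error in the vector, and
  the semigroup law moves the error in time to time 0.\<close>

lemma tendsto_P:
  assumes a: "(a \<longlongrightarrow> r) G" and b: "(b \<longlongrightarrow> h) G" and nn: "eventually (\<lambda>x. 0 \<le> a x) G" "0 \<le> r"
  shows "((\<lambda>x. P (a x) (b x)) \<longlongrightarrow> P r h) G"
proof -
  have "((\<lambda>x. norm (b x - h) + norm (P \<bar>a x - r\<bar> h - h)) \<longlongrightarrow> 0 + 0) G"
    using b a P_tendsto_abs[of "\<lambda>x. a x - r" G h]
    by (intro tendsto_add) (auto simp: LIM_zero tendsto_norm_zero)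
  then have "((\<lambda>x. norm (b x - h) + norm (P \<bar>a x - r\<bar> h - h)) \<longlongrightarrow> 0) G" by simp
  moreover have "eventually (\<lambda>x. norm (P (a x) (b x) - P r h) \<le>
      norm (b x - h) + norm (P \<bar>a x - r\<bar> h - h)) G"
    using nn(1)
  proof eventually_elim
    case (elim x)
    have "P (a x) (b x) - P r h = P (a x) (b x - h) + (P (a x) h - P r h)"
      using elim by (simp add: P_diff)
    then have "norm (P (a x) (b x) - P r h) \<le> norm (P (a x) (b x - h)) + norm (P (a x) h - P r h)"
      by (metis norm_triangle_ineq)
    also have "\<dots> \<le> norm (b x - h) + norm (P \<bar>a x - r\<bar> h - h)"
      using elim nn(2) by (intro add_mono norm_P_le norm_P_diff_le)
    finally show ?case .
  qed
  ultimately have "((\<lambda>x. P (a x) (b x) - P r h) \<longlongrightarrow> 0) G"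
    by (rule Lim_null_comparison[rotated])
  then show ?thesis by (rule LIM_zero_cancel)
qed

lemma continuous_on_P:
  assumes "continuous_on A a" "continuous_on A b" "\<And>x. x \<in> A \<Longrightarrow> 0 \<le> a x"
  shows "continuous_on A (\<lambda>x. P (a x) (b x))"
  using assms unfolding continuous_on_def
  by (auto intro!: tendsto_P eventually_at_topological[THEN iffD2] exI[of _ UNIV])

lemma P_in_D: "u \<in> D \<Longrightarrow> 0 \<le> r \<Longrightarrow> P r u \<in> D"
  and L_P: "u \<in> D \<Longrightarrow> 0 \<le> r \<Longrightarrow> L (P r u) = P r (L u)"
proof -
  assume u: "u \<in> D" and r: "0 \<le> r"
  have "((\<lambda>t. P r ((P t u - u) /\<^sub>R t)) \<longlongrightarrow> P r (L u)) (at_right 0)"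
    using u generator_iff r by (intro tendsto_P) auto
  also have "?this \<longleftrightarrow> ((\<lambda>t. (P t (P r u) - P r u) /\<^sub>R t) \<longlongrightarrow> P r (L u)) (at_right 0)"
    by (rule tendsto_cong, rule eventually_at_right_less[THEN eventually_mono])
       (use r in \<open>simp add: P_scaleR P_diff P_commute\<close>)
  finally show "P r u \<in> D" "L (P r u) = P r (L u)"
    by (simp_all add: generator_iff)
qed

text \<open>Left and right difference quotients are treated at once: factoring out
  \<open>P (min s r)\<close> turns both into the quotient at time 0 with step
  \<open>\<bar>s - r\<bar>\<close>. Extended by \<open>L u\<close> at step 0 this quotient is
  continuous, and \<open>tendsto_P\<close> takes the limit.\<close>

lemma P_has_vector_derivative:
  assumes u: "u \<in> D" and r: "0 \<le> r"
  shows "((\<lambda>s. P s u) has_vector_derivative P r (L u)) (at r within {0..})"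
proof -
  have c: "continuous (at 0 within {0..}) (\<lambda>t. if t = 0 then L u else (P t u - u) /\<^sub>R t)"
  proof -
    have "((\<lambda>t. (P t u - u) /\<^sub>R t) \<longlongrightarrow> L u) (at 0 within {0..})"
      using u generator_iff by (metis at_within_Ici_at_right)
    then show ?thesis
      unfolding continuous_within if_P[OF refl]
      by (rule Lim_transform_eventually) (auto simp: eventually_at_filter)
  qed
  have "((\<lambda>s. (\<lambda>t. if t = 0 then L u else (P t u - u) /\<^sub>R t) \<bar>s - r\<bar>) \<longlongrightarrow>
     (\<lambda>t. if t = 0 then L u else (P t u - u) /\<^sub>R t) 0) (at r within {0..})"
    using r by (intro continuous_within_tendsto_compose'[OF c])
      (auto intro!: tendsto_eq_intros)
  then have "((\<lambda>s. P (min s r) ((\<lambda>t. if t = 0 then L u else (P t u - u) /\<^sub>R t) \<bar>s - r\<bar>)) \<longlongrightarrow> P r (L u))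
      (at r within {0..})"
    using r by (intro tendsto_P) (auto intro!: tendsto_eq_intros simp: eventually_at_filter)
  then have "((\<lambda>s. (P s u - P r u) /\<^sub>R (s - r)) \<longlongrightarrow> P r (L u)) (at r within {0..})"
  proof (rule tendsto_cong[THEN iffD1, rotated])
    have "P (min s r) ((P \<bar>s - r\<bar> u - u) /\<^sub>R \<bar>s - r\<bar>) = (P s u - P r u) /\<^sub>R (s - r)"
      if "0 \<le> s" "s \<noteq> r" for s
    proof (cases "s < r")
      case True
      have "P s (P (r - s) u) = P r u" using True that P_add[of s "r - s" u] by simp
      then show ?thesis using True that
        by (simp add: P_scaleR P_diff scaleR_left.minus[symmetric] min_def)
          (metis minus_diff_eq inverse_minus_eq scaleR_minus_left scaleR_minus_right)
    next
      case False
      have "P r (P (s - r) u) = P s u" using False r P_add[of r "s - r" u] by simp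
      then show ?thesis using False that r
        by (simp add: P_scaleR P_diff min_def)
    qed
    then show "eventually (\<lambda>s. P (min s r) (if \<bar>s - r\<bar> = 0 then L u else (P \<bar>s - r\<bar> u - u) /\<^sub>R \<bar>s - r\<bar>)
        = (P s u - P r u) /\<^sub>R (s - r)) (at r within {0..})"
      by (auto simp: eventually_at_filter)
  qed
  then show ?thesis
    by (simp add: has_vector_derivative_iff_quotient)
qed

lemma P_has_vector_derivative_at:
  assumes "u \<in> D" "0 < r"
  shows "((\<lambda>s. P s u) has_vector_derivative P r (L u)) (at r)"
  using P_has_vector_derivative[of u r] assms by (simp add: at_within_interior[of r "{0..}"])

text \<open>Averages of the orbit over \<open>{0..e}\<close> lie in \<open>D\<close>, because
  \<open>P h\<close> merely shifts the window of integration and the quotient converges to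
  \<open>(P e u - u) /\<^sub>R e\<close>. As \<open>e\<close> tends to 0 the averages tend to
  \<open>u\<close>.\<close>

lemma D_dense: "closure D = UNIV"
proof -
  have "u \<in> closure D" for u
  proof -
    define I where "I e = integral {0..e} (\<lambda>s. P s u)" for e :: real
    have cont: "continuous_on {0..b} (\<lambda>s. P s u)" for b
      by (intro continuous_on_P continuous_intros) auto
    have I_deriv: "(I has_vector_derivative P r u) (at r within {0..b})" if "0 \<le> r" "r \<le> b" for r b
      unfolding I_def using integral_has_vector_derivative[OF cont, of r b] that by simp
    have I_quot: "((\<lambda>h. (I (r + h) - I r) /\<^sub>R h) \<longlongrightarrow> P r u) (at_right 0)" if "0 \<le> r" for r
    proof -
      have "(I has_vector_derivative P r u) (at r within {r..r+1})"
        using that by (intro has_vector_derivative_within_subset[OF I_deriv[of r "r + 1"]]) auto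
      then show ?thesis
        by (simp add: has_vector_derivative_iff_quotient at_within_Icc_at_right
            filterlim_at_right_to_0[of _ _ r] add.commute)
    qed
    have "I e /\<^sub>R e \<in> D" if "0 < e" for e
    proof -
      have "((\<lambda>h. (I (e + h) - I e) /\<^sub>R h /\<^sub>R e - (I (0 + h) - I 0) /\<^sub>R h /\<^sub>R e) \<longlongrightarrow> P e u /\<^sub>R e - P 0 u /\<^sub>R e) (at_right 0)"
        using that by (intro tendsto_intros I_quot) auto
      moreover have "(P h (I e /\<^sub>R e) - I e /\<^sub>R e) /\<^sub>R h = (I (e + h) - I e) /\<^sub>R h /\<^sub>R e - (I (0 + h) - I 0) /\<^sub>R h /\<^sub>R e"
        if "0 < h" for h
      proof -
        have "P h (I e) = integral {0..e} (\<lambda>s. P h (P s u))"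
          unfolding I_def using that cont
          by (subst integral_linear[OF _ bounded_linear_P, symmetric]) (auto simp: o_def integrable_continuous_real)
        also have "\<dots> = integral {0..e} (\<lambda>s. P (s + h) u)"
          using that by (intro integral_cong) (auto simp: P_add P_commute)
        also have "\<dots> = integral {h..e+h} (\<lambda>s. P s u)"
          using integral_shift_Icc_real[of 0 e "\<lambda>s. P s u" h] by (simp add: o_def add.commute)
        also have "\<dots> = I (e + h) - I h"
          unfolding I_def using that \<open>0 < e\<close> Henstock_Kurzweil_Integration.integral_combine[where a=0 and b="e + h" and c=h and f="\<lambda>s. P s u"] cont
          by (simp add: integrable_continuous_real algebra_simps)
        finally have "P h (I e) = I (e + h) - I h" .
        then show ?thesis using that
          by (simp add: P_scaleR I_def[of 0] scaleR_diff_right mult.commute[of "inverse h"] diff_right_commute)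
      qed
      ultimately have "((\<lambda>h. (P h (I e /\<^sub>R e) - I e /\<^sub>R e) /\<^sub>R h) \<longlongrightarrow> P e u /\<^sub>R e - P 0 u /\<^sub>R e) (at_right 0)"
        by (rule_tac Lim_transform_eventually) (auto simp: eventually_at_right_less[THEN eventually_mono])
      then show ?thesis by (simp add: generator_iff)
    qed
    moreover have "((\<lambda>e. I e /\<^sub>R e) \<longlongrightarrow> u) (at_right 0)"
      using I_quot[of 0] by (simp add: I_def[of 0])
    ultimately show ?thesis
      by (intro Lim_in_closed_set[of "closure D" "\<lambda>e. I e /\<^sub>R e" "at_right 0"])
        (auto intro!: eventually_at_right_less[THEN eventually_mono] closure_subset[THEN subsetD])
  qed
  then show ?thesis by auto
qed

text \<open>The product \<open>P s x \<bullet> P (t - s) y\<close> does not depend on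
  \<open>s\<close>, since symmetry of \<open>L\<close> makes its derivative vanish; its values at
  the two ends are the two sides.\<close>

lemma P_symmetric_D:
  assumes x: "x \<in> D" and y: "y \<in> D" and t: "0 \<le> t"
  shows "P t x \<bullet> y = x \<bullet> P t y"
proof -
  have "((\<lambda>s. P s x \<bullet> P (t - s) y) has_vector_derivative 0) (at s within {0..t})" if "s \<in> {0..t}" for s
  proof -
    have "((\<lambda>s. P s y) \<circ> (\<lambda>s. t - s) has_vector_derivative - 1 *\<^sub>R P (t - s) (L y)) (at s within {0..t})"
      using that by (intro vector_diff_chain_within has_vector_derivative_within_subset[OF P_has_vector_derivative[OF y]])
        (auto intro!: derivative_eq_intros)
    moreover have "((\<lambda>s. P s x) has_vector_derivative P s (L x)) (at s within {0..t})"
      using that by (intro has_vector_derivative_within_subset[OF P_has_vector_derivative[OF x]]) auto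
    ultimately have "((\<lambda>s. P s x \<bullet> P (t - s) y) has_vector_derivative
        (P s x \<bullet> (- 1 *\<^sub>R P (t - s) (L y)) + P s (L x) \<bullet> P (t - s) y)) (at s within {0..t})"
      by (intro bounded_bilinear.has_vector_derivative[OF bounded_bilinear_inner]) (auto simp: o_def)
    moreover have "P s x \<bullet> (- 1 *\<^sub>R P (t - s) (L y)) + P s (L x) \<bullet> P (t - s) y = 0"
      using L_symmetric[of "P s x" "P (t - s) y"] that x y by (simp add: P_in_D L_P)
    ultimately show ?thesis by simp
  qed
  then obtain c where "\<And>s. s \<in> {0..t} \<Longrightarrow> P s x \<bullet> P (t - s) y = c"
    using has_vector_derivative_zero_constant[of "{0..t}" "\<lambda>s. P s x \<bullet> P (t - s) y"] by auto
  from this[of 0] this[of t] t show ?thesis by simp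
qed

lemma dense_induct:
  assumes "closed {x. Q x}" "\<And>x. x \<in> D \<Longrightarrow> Q x"
  shows "Q x"
proof -
  have "closure D \<subseteq> {x. Q x}"
    using assms by (intro closure_minimal) auto
  then show ?thesis by (auto simp: D_dense)
qed

lemma P_symmetric:
  assumes t: "0 \<le> t" shows "P t x \<bullet> y = x \<bullet> P t y"
proof (rule dense_induct[of "\<lambda>x. P t x \<bullet> y = x \<bullet> P t y"])
  show "closed {x. P t x \<bullet> y = x \<bullet> P t y}"
    using t by (intro closed_Collect_eq continuous_intros continuous_on_P) auto
  fix x assume x: "x \<in> D"
  show "P t x \<bullet> y = x \<bullet> P t y"
  proof (rule dense_induct[of "\<lambda>y. P t x \<bullet> y = x \<bullet> P t y"])
    show "closed {y. P t x \<bullet> y = x \<bullet> P t y}"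
      using t by (intro closed_Collect_eq continuous_intros continuous_on_P) auto
  qed (use x t P_symmetric_D in auto)
qed

lemma inner_L_P:
  assumes "x \<in> D" "y \<in> D" "0 \<le> t" shows "P t (L x) \<bullet> y = P t x \<bullet> L y"
  using L_symmetric[of "P t x" y] assms by (simp add: P_in_D L_P)

text \<open>This is self-adjointness of \<open>L\<close>, as opposed to mere symmetry. For each test
  vector \<open>x\<close> the mean value theorem for \<open>\<lambda>s. y \<bullet> P s x\<close>
  yields some \<open>s\<close> below \<open>r\<close> at which the error of the difference quotient,
  tested with \<open>x\<close>, is \<open>(P s h - h) \<bullet> x\<close>. As \<open>s\<close>
  depends on \<open>x\<close>, the bound \<open>e\<close> is asked for at all \<open>s\<close> below
  \<open>r\<close>; density of \<open>D\<close> then permits testing with the error itself.\<close>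

lemma in_D_if_weak:
  assumes weak: "\<And>x. x \<in> D \<Longrightarrow> y \<bullet> L x = h \<bullet> x"
  shows "y \<in> D" "L y = h"
proof -
  have bound: "norm ((P r y - y) /\<^sub>R r - h) \<le> e" if r: "0 < r" and e: "\<And>s. 0 < s \<Longrightarrow> s < r \<Longrightarrow> norm (P s h - h) \<le> e" for r e
  proof -
    define z where "z = (P r y - y) /\<^sub>R r - h"
    have D: "z \<bullet> x \<le> e * norm x" if x: "x \<in> D" for x
    proof -
      have "((\<lambda>s. y \<bullet> P s x) has_derivative (\<lambda>t. t * (y \<bullet> P s (L x)))) (at s within {0..r})"
        if "0 \<le> s" "s \<le> r" for s
      proof -
        have "((\<lambda>s. P s x) has_vector_derivative P s (L x)) (at s within {0..r})"
          using that by (intro has_vector_derivative_within_subset[OF P_has_vector_derivative[OF x]]) auto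
        then show ?thesis
          unfolding has_vector_derivative_def by (auto intro!: derivative_eq_intros)
      qed
      then obtain s where s: "s \<in> {0<..<r}" "y \<bullet> P r x - y \<bullet> P 0 x = (r - 0) * (y \<bullet> P s (L x))"
        using mvt_simple[OF r, of "\<lambda>s. y \<bullet> P s x" "\<lambda>s t. t * (y \<bullet> P s (L x))"] by auto
      have "y \<bullet> P s (L x) = h \<bullet> P s x"
        using weak[of "P s x"] x s(1) by (simp add: P_in_D L_P)
      also have "\<dots> = P s h \<bullet> x"
        using s(1) by (simp add: P_symmetric)
      finally have "y \<bullet> P s (L x) = P s h \<bullet> x" .
      moreover have "z \<bullet> x = (P r y \<bullet> x - y \<bullet> x) / r - h \<bullet> x"
        by (simp add: z_def inner_diff_left divide_inverse mult.commute)
      ultimately have "z \<bullet> x = (P s h - h) \<bullet> x"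
        using s(2) r by (simp add: inner_diff_left P_symmetric)
      also have "\<dots> \<le> norm (P s h - h) * norm x"
        by (rule norm_cauchy_schwarz)
      also have "\<dots> \<le> e * norm x"
        using e s by (intro mult_right_mono) auto
      finally show ?thesis .
    qed
    have "z \<bullet> z \<le> e * norm z"
      by (rule dense_induct[of "\<lambda>x. z \<bullet> x \<le> e * norm x"])
        (auto intro!: closed_Collect_le continuous_intros D)
    then have "norm z * norm z \<le> e * norm z"
      by (simp add: dot_square_norm power2_eq_square)
    moreover have "0 \<le> e"
      using e[of "r / 2"] r order_trans[OF norm_ge_zero] by auto
    ultimately show ?thesis
      by (cases "z = 0") (auto simp: z_def)
  qed
  have "((\<lambda>t. (P t y - y) /\<^sub>R t) \<longlongrightarrow> h) (at_right 0)"
  proof (rule tendstoI)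
    fix e :: real assume "0 < e"
    then have "eventually (\<lambda>s. dist (P s h) h < e / 2) (at_right 0)"
      using P_tendsto_0[of h] by (intro tendstoD) auto
    then obtain b where b: "0 < b" "\<And>s. 0 < s \<Longrightarrow> s < b \<Longrightarrow> dist (P s h) h < e / 2"
      by (auto simp: eventually_at_right_field)
    have "dist ((P t y - y) /\<^sub>R t) h < e" if "0 < t" "t < b" for t
    proof -
      have "norm ((P t y - y) /\<^sub>R t - h) \<le> e / 2"
        using b that by (intro bound) (auto simp: dist_norm intro: less_imp_le)
      then show ?thesis using \<open>0 < e\<close> by (simp add: dist_norm)
    qed
    then show "eventually (\<lambda>t. dist ((P t y - y) /\<^sub>R t) h < e) (at_right 0)"
      using b(1) by (auto simp: eventually_at_right_field)
  qed
  then show "y \<in> D" "L y = h"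
    by (simp_all add: generator_iff)
qed

lemma L_linear:
  assumes "x \<in> D" "y \<in> D"
  shows "a *\<^sub>R x + y \<in> D" "L (a *\<^sub>R x + y) = a *\<^sub>R L x + L y"
  by (rule in_D_if_weak[of _ "a *\<^sub>R L x + L y"], simp add: inner_add_left assms L_symmetric)+

lemma L_dissipative:
  assumes "x \<in> D" shows "L x \<bullet> x \<le> 0"
proof (rule tendsto_upperbound)
  show "((\<lambda>t. ((P t x - x) /\<^sub>R t) \<bullet> x) \<longlongrightarrow> L x \<bullet> x) (at_right 0)"
    using assms generator_iff by (intro tendsto_intros) auto
  have "((P t x - x) /\<^sub>R t) \<bullet> x \<le> 0" if "0 < t" for t
  proof -
    have "P t x \<bullet> x \<le> norm (P t x) * norm x" by (rule norm_cauchy_schwarz)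
    also have "\<dots> \<le> norm x * norm x" using that by (intro mult_right_mono norm_P_le) auto
    finally have "(P t x - x) \<bullet> x \<le> 0" by (simp add: inner_diff_left dot_square_norm power2_eq_square)
    then show ?thesis using that by (simp add: mult_nonneg_nonpos)
  qed
  then show "eventually (\<lambda>t. ((P t x - x) /\<^sub>R t) \<bullet> x \<le> 0) (at_right 0)"
    by (auto intro: eventually_at_right_less[THEN eventually_mono])
qed simp

lemma inner_P_P: "0 \<le> s \<Longrightarrow> 0 \<le> t \<Longrightarrow> P s x \<bullet> P t y = x \<bullet> P (s + t) y"
  using P_symmetric[of s x "P t y"] P_add[of s t y] by simp

lemma inner_P_nonneg: "0 \<le> t \<Longrightarrow> 0 \<le> x \<bullet> P t x"
proof -
  assume "0 \<le> t"
  then have "x \<bullet> P (t / 2 + t / 2) x = P (t / 2) x \<bullet> P (t / 2) x"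
    by (intro inner_P_P[symmetric]) auto
  then show ?thesis by (metis field_sum_of_halves inner_ge_zero)
qed

text \<open>Minus the derivative of \<open>t \<mapsto> x \<bullet> P t x\<close>.\<close>

definition energy :: "'h \<Rightarrow> real \<Rightarrow> real" where
  "energy x t = - (L x \<bullet> P t x)"

lemma energy_nonneg:
  assumes "x \<in> D" "0 \<le> t" shows "0 \<le> energy x t"
proof -
  have "L x \<bullet> P t x = P (t / 2) (L x) \<bullet> P (t / 2) x"
    using assms(2) by (simp add: inner_P_P)
  also have "\<dots> = L (P (t / 2) x) \<bullet> P (t / 2) x"
    using assms by (simp add: L_P)
  finally show ?thesis
    using L_dissipative[of "P (t / 2) x"] assms by (simp add: energy_def P_in_D)
qed

text \<open>The derivative of \<open>- energy x\<close> at \<open>r\<close> is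
  \<open>L x \<bullet> P r (L x)\<close>, which is nonnegative because \<open>P r\<close> is the
  square of the symmetric operator \<open>P (r / 2)\<close>.\<close>

lemma energy_antimono:
  assumes x: "x \<in> D" and st: "0 \<le> s" "s \<le> t" shows "energy x t \<le> energy x s"
proof -
  have "((\<lambda>s. - energy x s) has_field_derivative (L x \<bullet> P r (L x))) (at r)" if "0 < r" for r
    using P_has_vector_derivative_at[OF x that]
    unfolding has_field_derivative_def has_vector_derivative_def energy_def
    by (auto intro!: derivative_eq_intros)
  note deriv = this
  have "- energy x s \<le> - energy x t"
  proof (intro DERIV_nonneg_imp_increasing_open[where f="\<lambda>s. - energy x s"])
    show "continuous_on {s..t} (\<lambda>s. - energy x s)"
      unfolding energy_def using st by (intro continuous_intros continuous_on_P) auto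
    show "\<exists>y. ((\<lambda>s. - energy x s) has_real_derivative y) (at r) \<and> 0 \<le> y" if "s < r" for r
      using deriv[of r] inner_P_nonneg[of r "L x"] that st(1)
      by (intro exI[of _ "L x \<bullet> P r (L x)"]) simp
  qed (rule st(2))
  then show ?thesis by linarith
qed

lemma continuous_on_energy: "continuous_on {0..} (energy x)"
  unfolding energy_def by (intro continuous_intros continuous_on_P) auto

text \<open>Since \<open>energy x\<close> is the derivative of \<open>- (x \<bullet> P r x)\<close>,
  its integral over \<open>{0..n}\<close> is the squared norm of \<open>x\<close> minus
  \<open>x \<bullet> P n x\<close>, and the subtracted term is nonnegative. Monotone convergence
  removes \<open>n\<close>.\<close>

lemma nn_integral_energy_le:
  assumes x: "x \<in> D"
  shows "(\<integral>\<^sup>+r. ennreal (energy x r) * indicator {0..} r \<partial>lborel) \<le> ennreal ((norm x)\<^sup>2)"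
proof -
  have bound: "(\<integral>\<^sup>+r. ennreal (energy x r) * indicator {0..real n} r \<partial>lborel) \<le> ennreal ((norm x)\<^sup>2)" for n
  proof -
    have cont: "continuous_on {0..real n} (energy x)"
      by (rule continuous_on_subset[OF continuous_on_energy]) auto
    have "((\<lambda>r. - (x \<bullet> P r x)) has_vector_derivative energy x r) (at r within {0..real n})"
      if "0 \<le> r" "r \<le> real n" for r :: real
    proof -
      have "((\<lambda>s. P s x) has_vector_derivative P r (L x)) (at r within {0..real n})"
        using that by (intro has_vector_derivative_within_subset[OF P_has_vector_derivative[OF x]]) auto
      moreover have "x \<bullet> P r (L x) = L x \<bullet> P r x"
        using P_symmetric[OF that(1), of x "L x"] inner_commute[of "P r x" "L x"] by simp
      ultimately show ?thesis
        using has_vector_derivative_minus[OF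
            bounded_linear.has_vector_derivative[OF bounded_linear_inner_right[of x], of "\<lambda>s. P s x"]]
        unfolding energy_def by metis
    qed
    then have "(\<integral>r. indicator {0..real n} r *\<^sub>R energy x r \<partial>lborel) = - (x \<bullet> P n x) - - (x \<bullet> P 0 x)"
      using cont by (intro integral_FTC_atLeastAtMost) auto
    also have "\<dots> \<le> (norm x)\<^sup>2"
      using inner_P_nonneg[of n x] by (simp add: dot_square_norm)
    finally have le: "(\<integral>r. indicator {0..real n} r *\<^sub>R energy x r \<partial>lborel) \<le> (norm x)\<^sup>2" .
    have "(\<integral>\<^sup>+r. ennreal (energy x r) * indicator {0..real n} r \<partial>lborel) =
        (\<integral>\<^sup>+r. ennreal (indicator {0..real n} r *\<^sub>R energy x r) \<partial>lborel)"
      by (intro nn_integral_cong) (auto split: split_indicator)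
    also have "\<dots> = ennreal (\<integral>r. indicator {0..real n} r *\<^sub>R energy x r \<partial>lborel)"
      using energy_nonneg[OF x] borel_integrable_atLeastAtMost'[OF cont]
      by (intro nn_integral_eq_integral) (auto simp: set_integrable_def split: split_indicator)
    finally show ?thesis using le by (simp add: ennreal_leI)
  qed
  have meas: "(\<lambda>r. ennreal (energy x r) * indicator {0..real n} r) \<in> borel_measurable lborel" for n
  proof -
    have "(\<lambda>r. indicator {0..real n} r *\<^sub>R energy x r) \<in> borel_measurable lborel"
      using borel_integrable_atLeastAtMost'[OF continuous_on_subset[OF continuous_on_energy], of 0 n x]
      by (auto simp: set_integrable_def)
    then have "(\<lambda>r. ennreal (indicator {0..real n} r *\<^sub>R energy x r)) \<in> borel_measurable lborel"
      by measurable
    also have "(\<lambda>r. ennreal (indicator {0..real n} r *\<^sub>R energy x r)) =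
        (\<lambda>r. ennreal (energy x r) * indicator {0..real n} r)"
      by (auto split: split_indicator)
    finally show ?thesis .
  qed
  have "(\<integral>\<^sup>+r. ennreal (energy x r) * indicator {0..} r \<partial>lborel) =
      (\<integral>\<^sup>+r. (SUP n. ennreal (energy x r) * indicator {0..real n} r) \<partial>lborel)"
  proof (intro nn_integral_cong)
    fix r :: real
    obtain n where n: "r \<le> real n" using real_arch_simple by blast
    show "ennreal (energy x r) * indicator {0..} r = (SUP n. ennreal (energy x r) * indicator {0..real n} r)"
    proof (rule antisym)
      show "ennreal (energy x r) * indicator {0..} r \<le> (SUP n. ennreal (energy x r) * indicator {0..real n} r)"
        using n by (intro SUP_upper2[of n]) (auto split: split_indicator)
    qed (auto intro!: SUP_least split: split_indicator)
  qed
  also have "\<dots> = (SUP n. \<integral>\<^sup>+r. ennreal (energy x r) * indicator {0..real n} r \<partial>lborel)"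
    by (intro nn_integral_monotone_convergence_SUP meas)
      (auto simp: incseq_def le_fun_def intro!: mult_left_mono split: split_indicator)
  also have "\<dots> \<le> ennreal ((norm x)\<^sup>2)"
    by (intro SUP_least bound)
  finally show ?thesis .
qed

lemma measurable_P:
  assumes [measurable]: "a \<in> borel_measurable N" "b \<in> borel_measurable N"
    and nonneg: "\<And>x. x \<in> space N \<Longrightarrow> 0 \<le> a x"
  shows "(\<lambda>x. P (a x) (b x)) \<in> borel_measurable N"
proof -
  have "continuous_on UNIV (\<lambda>y. P (max 0 (fst y)) (snd y))"
    by (intro continuous_on_P continuous_intros) auto
  then have "(\<lambda>y. P (max 0 (fst y)) (snd y)) \<in> borel_measurable (borel \<Otimes>\<^sub>M borel)"
    unfolding borel_prod by (rule borel_measurable_continuous_onI)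
  then have "(\<lambda>y. P (max 0 (fst y)) (snd y)) \<circ> (\<lambda>x. (a x, b x)) \<in> borel_measurable N"
    by (rule measurable_comp[rotated]) measurable
  then show ?thesis
    by (rule measurable_cong[THEN iffD1, rotated]) (simp add: nonneg max_def)
qed

lemma integrable_P:
  assumes M: "finite_measure M" and X: "X \<in> borel_measurable M" "\<And>\<omega>. \<omega> \<in> space M \<Longrightarrow> 0 \<le> X \<omega>"
  shows "integrable M (\<lambda>\<omega>. P (X \<omega>) h)"
proof (rule finite_measure.integrable_const_bound[OF M])
  show "AE \<omega> in M. norm (P (X \<omega>) h) \<le> norm h"
    by (rule AE_I2) (simp add: norm_P_le X)
  show "(\<lambda>\<omega>. P (X \<omega>) h) \<in> borel_measurable M"
    using X by (intro measurable_P) auto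
qed

text \<open>The left-hand side is \<open>norm (L Q x)\<close> for the self-adjoint operator \<open>Q h = E (P X h)\<close>. By
  polarization it is enough to bound the quadratic form \<open>- (L Q x \<bullet> x)\<close>, which is the mean of the
  decreasing function \<open>energy x\<close> at \<open>X\<close>.\<close>

lemma norm_integral_P_L_le:
  assumes M: "finite_measure M" and X: "X \<in> borel_measurable M" "\<And>\<omega>. \<omega> \<in> space M \<Longrightarrow> 0 \<le> X \<omega>"
    and bound: "\<And>R. 0 \<le> R \<Longrightarrow> emeasure M {\<omega>\<in>space M. X \<omega> \<le> R} \<le> ennreal C * ennreal R"
    and C: "0 < C" and x: "x \<in> D"
  shows "norm (\<integral>\<omega>. P (X \<omega>) (L x) \<partial>M) \<le> C * norm x"
proof -
  interpret M: finite_measure M by fact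
  note intP = integrable_P[OF M X]
  have int_energy: "integrable M (\<lambda>\<omega>. energy y (X \<omega>))" for y
    unfolding energy_def by (intro Bochner_Integration.integrable_minus integrable_inner_right intP)
  have energy_le: "(\<integral>\<omega>. energy y (X \<omega>) \<partial>M) \<le> C * (norm y)\<^sup>2"
    and energy_ge: "0 \<le> (\<integral>\<omega>. energy y (X \<omega>) \<partial>M)" if y: "y \<in> D" for y
  proof -
    have "ennreal (\<integral>\<omega>. energy y (X \<omega>) \<partial>M) = (\<integral>\<^sup>+\<omega>. ennreal (energy y (X \<omega>)) \<partial>M)"
      using int_energy X(2) energy_nonneg[OF y]
      by (intro nn_integral_eq_integral[symmetric]) auto
    also have "\<dots> \<le> ennreal C * (\<integral>\<^sup>+r. ennreal (energy y r) * indicator {0..} r \<partial>lborel)"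
      using energy_antimono[OF y] energy_nonneg[OF y] continuous_on_energy X bound C
      by (intro nn_integral_antimono_le M.sigma_finite_measure_axioms) auto
    also have "\<dots> \<le> ennreal C * ennreal ((norm y)\<^sup>2)"
      using nn_integral_energy_le[OF y] by (intro mult_left_mono) auto
    also have "\<dots> = ennreal (C * (norm y)\<^sup>2)"
      using C by (simp add: ennreal_mult)
    finally show "(\<integral>\<omega>. energy y (X \<omega>) \<partial>M) \<le> C * (norm y)\<^sup>2"
      using C by (simp add: ennreal_le_iff)
    show "0 \<le> (\<integral>\<omega>. energy y (X \<omega>) \<partial>M)"
      using X(2) energy_nonneg[OF y] by (intro Bochner_Integration.integral_nonneg_AE AE_I2) auto
  qed
  define z where "z = (\<integral>\<omega>. P (X \<omega>) (L x) \<partial>M)"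
  \<comment> \<open>Polarization: \<open>- 4 * (z \<bullet> y)\<close> is the mean energy of
    \<open>x + y\<close> minus that of \<open>x - y\<close>, and the latter is nonnegative and
    dropped. The resulting inequality is closed in \<open>y\<close>, so density of \<open>D\<close>
    extends it to every \<open>y\<close>.\<close>
  have "- 4 * (z \<bullet> y) \<le> C * (norm (x + y))\<^sup>2" for y
  proof (rule dense_induct[of "\<lambda>y. - 4 * (z \<bullet> y) \<le> C * (norm (x + y))\<^sup>2"])
    show "closed {y. - 4 * (z \<bullet> y) \<le> C * (norm (x + y))\<^sup>2}"
      by (intro closed_Collect_le continuous_intros)
  next
    fix y assume y: "y \<in> D"
    have L_plus: "x + y \<in> D" "L (x + y) = L x + L y" and L_minus: "x - y \<in> D" "L (x - y) = L x - L y"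
      using L_linear[of x y 1] L_linear[of y x "-1"] x y by simp_all
    have "energy (x + y) r - energy (x - y) r = - 4 * (P r (L x) \<bullet> y)" if r: "0 \<le> r" for r
    proof -
      have "L x \<bullet> P r y = P r (L x) \<bullet> y" and "L y \<bullet> P r x = P r (L x) \<bullet> y"
        using inner_L_P[OF x y r] r by (simp_all add: P_symmetric inner_commute[of "L y"])
      then show ?thesis
        using r by (simp add: energy_def L_plus L_minus P_plus P_diff inner_add_left inner_add_right
            inner_diff_left inner_diff_right)
    qed
    then have "(\<integral>\<omega>. energy (x + y) (X \<omega>) - energy (x - y) (X \<omega>) \<partial>M) = (\<integral>\<omega>. - 4 * (P (X \<omega>) (L x) \<bullet> y) \<partial>M)"
      by (intro Bochner_Integration.integral_cong) (auto simp: X)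
    also have "\<dots> = - 4 * (z \<bullet> y)"
      using intP by (simp add: z_def)
    finally have "- 4 * (z \<bullet> y) = (\<integral>\<omega>. energy (x + y) (X \<omega>) \<partial>M) - (\<integral>\<omega>. energy (x - y) (X \<omega>) \<partial>M)"
      by (simp add: int_energy)
    then show "- 4 * (z \<bullet> y) \<le> C * (norm (x + y))\<^sup>2"
      using energy_le[OF L_plus(1)] energy_ge[OF L_minus(1)] by linarith
  qed
  note key = this
  have "norm z \<le> C * norm x"
  proof (cases "z = 0 \<or> x = 0")
    case True
    have "z = 0" if "x = 0"
    proof -
      have "L x = 0" using L_linear(2)[of x x "-1"] x that by simp
      then have "z = (\<integral>\<omega>. 0 \<partial>M)"
        unfolding z_def by (intro Bochner_Integration.integral_cong) (auto simp: X)
      then show ?thesis by simp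
    qed
    then show ?thesis using True C by auto
  next
    case False
    \<comment> \<open>Opposite to \<open>z\<close>, so that the left-hand side is extremal, and as
      long as \<open>x\<close>, so that \<open>norm (x + y) \<le> 2 * norm x\<close>. The two
      factors 4 then cancel and the constant is exactly \<open>C\<close>.\<close>
    define y where "y = - (norm x / norm z) *\<^sub>R z"
    have ny: "norm y = norm x" using False by (simp add: y_def)
    have "- 4 * (z \<bullet> y) = 4 * (norm x * norm z)"
      using False by (simp add: y_def dot_square_norm power2_eq_square)
    then have "4 * (norm x * norm z) \<le> C * (norm (x + y))\<^sup>2"
      using key[of y] by simp
    also have "\<dots> \<le> C * (2 * norm x)\<^sup>2"
      using C norm_triangle_ineq[of x y] ny by (intro mult_left_mono power_mono) auto
    finally have "norm x * norm z \<le> norm x * (C * norm x)"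
      by (simp add: power2_eq_square algebra_simps)
    then show ?thesis using False by simp
  qed
  then show ?thesis by (simp add: z_def)
qed

end

section \<open>From a Dirichlet form to a symmetric semigroup\<close>

lemma symmetric_contraction_semigroup_of_form:
  assumes form: "dirichlet_form \<mu> cls F \<E>" and assoc: "associated_semigroup F \<E> P"
  shows "symmetric_contraction_semigroup P (form_generator_dom F \<E>) (form_generator F \<E>)"
proof
  show "contraction_semigroup P" using assoc by (simp add: associated_semigroup_def)
  show "((\<lambda>t. (P t u - u) /\<^sub>R t) \<longlongrightarrow> h) (at_right 0) \<longleftrightarrow>
      u \<in> form_generator_dom F \<E> \<and> h = form_generator F \<E> u" for u h
    using assoc by (simp add: associated_semigroup_def)
  have dense: "closure F = UNIV" and sym: "\<And>u v. u \<in> F \<Longrightarrow> v \<in> F \<Longrightarrow> \<E> u v = \<E> v u"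
    using form by (auto simp: dirichlet_form_def)
  have gen: "\<E> u v = - (form_generator F \<E> u \<bullet> v)" if u: "u \<in> form_generator_dom F \<E>" and v: "v \<in> F" for u v
  proof -
    obtain h where h: "\<forall>v\<in>F. \<E> u v = - (h \<bullet> v)" using u by (auto simp: form_generator_dom_def)
    \<comment> \<open>Density of \<open>F\<close> leaves only one representing vector, so
      \<open>THE\<close> in \<open>form_generator\<close> returns the one that membership in the
      domain provides. Symmetry of the form then passes to the generator.\<close>
    have unique: "k = h" if k: "\<forall>v\<in>F. \<E> u v = - (k \<bullet> v)" for k
    proof -
      have "closure F \<subseteq> {v. (k - h) \<bullet> v = 0}"
      proof (rule closure_minimal)
        show "F \<subseteq> {v. (k - h) \<bullet> v = 0}"
        proof
          fix v assume v: "v \<in> F"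
          show "v \<in> {v. (k - h) \<bullet> v = 0}"
            using bspec[OF h v] bspec[OF k v] by (simp add: inner_diff_left)
        qed
        show "closed {v. (k - h) \<bullet> v = 0}" by (intro closed_Collect_eq continuous_intros)
      qed
      then have "(k - h) \<bullet> (k - h) = 0" using dense by blast
      then show ?thesis by simp
    qed
    have "form_generator F \<E> u = h"
      unfolding form_generator_def using h unique by (intro the_equality) auto
    then show ?thesis using bspec[OF h v] by simp
  qed
  show "form_generator F \<E> u \<bullet> v = u \<bullet> form_generator F \<E> v"
    if "u \<in> form_generator_dom F \<E>" "v \<in> form_generator_dom F \<E>" for u v
  proof -
    have "u \<in> F" "v \<in> F" using that by (auto simp: form_generator_dom_def)
    then show ?thesis
      using gen[OF that(1), of v] gen[OF that(2), of u] sym[of u v] inner_commute[of u "form_generator F \<E> v"]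
      by linarith
  qed
qed

section \<open>Uniqueness of Laplace transforms\<close>

text \<open>On \<open>{0..1}\<close> all moments are at most 1, so the exponential series may be
  integrated term by term. Hence a law on the unit interval is determined by its moments.\<close>

lemma char_eq_moment_series:
  assumes "real_distribution N" and AE: "AE y in N. 0 \<le> y \<and> y \<le> 1"
  shows "(\<lambda>n. ((\<i> * of_real t) ^ n / fact n) * of_real (\<integral>y. y ^ n \<partial>N)) sums char N t"
proof -
  interpret real_distribution N by fact
  have int: "integrable N (\<lambda>y. y ^ n)" for n
    by (rule integrable_const_bound[where B=1]) (use AE in \<open>auto simp: power_le_one\<close>)
  define f where "f n y = ((\<i> * of_real t) ^ n / fact n) * complex_of_real (y ^ n)" for n y
  have "(\<lambda>n. \<integral>y. f n y \<partial>N) sums (\<integral>y. (\<Sum>n. f n y) \<partial>N)"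
  proof (rule sums_integral)
    show "integrable N (f n)" for n
      unfolding f_def using int by (intro integrable_mult_right integrable_of_real)
    have norm_f: "norm (f n y) = norm ((\<i> * of_real (t * y)) ^ n /\<^sub>R fact n)" for n y
      by (simp add: f_def norm_mult norm_divide norm_power power_mult_distrib abs_mult field_simps)
    show "AE y in N. summable (\<lambda>n. norm (f n y))"
      unfolding norm_f by (intro AE_I2 summable_norm_exp)
    show "summable (\<lambda>n. \<integral>y. norm (f n y) \<partial>N)"
    proof (rule summable_comparison_test'[where N=0 and g="\<lambda>n. norm ((\<i> * of_real t) ^ n /\<^sub>R fact n)"])
      show "summable (\<lambda>n. norm ((\<i> * complex_of_real t) ^ n /\<^sub>R fact n))" by (rule summable_norm_exp)
      fix n
      have "(\<integral>y. norm (f n y) \<partial>N) \<le> (\<integral>y. norm ((\<i> * complex_of_real t) ^ n /\<^sub>R fact n) \<partial>N)"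
      proof (rule integral_mono_AE)
        show "integrable N (\<lambda>y. norm (f n y))"
          unfolding f_def using int by (intro integrable_norm integrable_mult_right integrable_of_real)
        show "AE y in N. norm (f n y) \<le> norm ((\<i> * complex_of_real t) ^ n /\<^sub>R fact n)"
          using AE
        proof eventually_elim
          case (elim y)
          then have "\<bar>t * y\<bar> ^ n \<le> \<bar>t\<bar> ^ n"
            by (intro power_mono) (auto simp: abs_mult intro: mult_left_le)
          then show ?case
            unfolding norm_f by (simp add: norm_power norm_mult abs_mult divide_right_mono field_simps)
        qed
      qed simp
      then show "norm (\<integral>y. norm (f n y) \<partial>N) \<le> norm ((\<i> * complex_of_real t) ^ n /\<^sub>R fact n)"
        using prob_space by simp
    qed
  qed
  moreover have "(\<Sum>n. f n y) = iexp (t * y)" for y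
    unfolding exp_def by (simp add: f_def power_mult_distrib scaleR_conv_of_real field_simps)
  moreover have "(\<integral>y. f n y \<partial>N) = ((\<i> * of_real t) ^ n / fact n) * of_real (\<integral>y. y ^ n \<partial>N)" for n
    unfolding f_def by (simp del: of_real_power)
  ultimately show ?thesis by (simp add: char_def)
qed

text \<open>The substitution \<open>y = exp (- x)\<close> maps the half-line into the unit interval
  and the Laplace transform at \<open>n\<close> to the \<open>n\<close>-th moment;
  \<open>- ln y\<close> undoes it.\<close>

lemma laplace_unique_prob:
  assumes "prob_space M\<^sub>1" "prob_space M\<^sub>2" and sets: "sets M\<^sub>1 = sets borel" "sets M\<^sub>2 = sets borel"
    and AE: "AE x in M\<^sub>1. 0 \<le> x" "AE x in M\<^sub>2. (0::real) \<le> x"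
    and eq: "\<And>n::nat. (\<integral>x. exp (- real n * x) \<partial>M\<^sub>1) = (\<integral>x. exp (- real n * x) \<partial>M\<^sub>2)"
  shows "M\<^sub>1 = M\<^sub>2"
proof -
  define N where "N M' = distr M' borel (\<lambda>x::real. exp (- x))" for M'
  have rd: "real_distribution (N M')" and ae: "AE y in N M'. 0 \<le> y \<and> y \<le> 1"
    and mom: "(\<integral>y. y ^ n \<partial>N M') = (\<integral>x. exp (- real n * x) \<partial>M')"
    and pull: "distr (N M') borel (\<lambda>y. - ln y) = M'"
    if "prob_space M'" and M': "sets M' = sets borel" and "AE x in M'. 0 \<le> x" for M' :: "real measure" and n
  proof -
    interpret prob_space M' by fact
    note M'[measurable_cong]
    show "real_distribution (N M')"
      unfolding N_def by (intro real_distribution_distr) measurable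
    show "AE y in N M'. 0 \<le> y \<and> y \<le> 1"
      unfolding N_def using that(3) by (subst AE_distr_iff) auto
    show "(\<integral>y. y ^ n \<partial>N M') = (\<integral>x. exp (- real n * x) \<partial>M')"
      unfolding N_def by (subst integral_distr) (auto simp: exp_of_nat_mult[symmetric])
    show "distr (N M') borel (\<lambda>y. - ln y) = M'"
      unfolding N_def by (subst distr_distr) (auto simp: o_def M' intro!: distr_id2)
  qed
  have "char (N M\<^sub>1) t = char (N M\<^sub>2) t" for t
  proof -
    have "(\<lambda>n. ((\<i> * of_real t) ^ n / fact n) * of_real (\<integral>y. y ^ n \<partial>N M\<^sub>1)) sums char (N M\<^sub>1) t"
      using assms by (intro char_eq_moment_series rd ae)
    moreover have "(\<lambda>n. ((\<i> * of_real t) ^ n / fact n) * of_real (\<integral>y. y ^ n \<partial>N M\<^sub>2)) sums char (N M\<^sub>2) t"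
      using assms by (intro char_eq_moment_series rd ae)
    ultimately show ?thesis
      using assms by (simp add: mom sums_iff)
  qed
  then have "N M\<^sub>1 = N M\<^sub>2"
    using assms by (intro Levy_uniqueness rd) auto
  then show ?thesis
    using pull[of M\<^sub>1] pull[of M\<^sub>2] assms by metis
qed

text \<open>Weighting with \<open>exp (- \<tau>)\<close> and dividing by \<open>I\<close> makes
  probability densities out of functions that need not be integrable themselves. The weight shifts
  the argument by one: the normalized law at \<open>n\<close> sees \<open>h\<close> at
  \<open>Suc n\<close>, so equality at positive integers suffices.\<close>

lemma laplace_unique_AE:
  fixes h\<^sub>1 h\<^sub>2 :: "real \<Rightarrow> ennreal"
  assumes [measurable]: "h\<^sub>1 \<in> borel_measurable borel" "h\<^sub>2 \<in> borel_measurable borel"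
    and eq: "\<And>n::nat. 0 < n \<Longrightarrow> (\<integral>\<^sup>+\<tau>\<in>{0<..}. ennreal (exp (- real n * \<tau>)) * h\<^sub>1 \<tau> \<partial>lborel) =
        (\<integral>\<^sup>+\<tau>\<in>{0<..}. ennreal (exp (- real n * \<tau>)) * h\<^sub>2 \<tau> \<partial>lborel)"
    and I: "(\<integral>\<^sup>+\<tau>\<in>{0<..}. ennreal (exp (- \<tau>)) * h\<^sub>1 \<tau> \<partial>lborel) = ennreal I" "0 < I"
  shows "AE \<tau> in lborel. 0 < \<tau> \<longrightarrow> h\<^sub>1 \<tau> = h\<^sub>2 \<tau>"
proof -
  define d where "d h \<tau> = ennreal (exp (- \<tau>)) * h \<tau> * indicator {0<..} \<tau> / ennreal I"
    for h :: "real \<Rightarrow> ennreal" and \<tau> :: real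
  have [measurable]: "d h \<in> borel_measurable borel" if "h \<in> borel_measurable borel" for h
    using that unfolding d_def by measurable
  define N where "N h = density lborel (d h)" for h
  have prob: "prob_space (N h)" and sets: "sets (N h) = sets borel" and AE: "AE x in N h. 0 \<le> x"
    and mom: "(\<integral>x. exp (- real n * x) \<partial>N h) =
      enn2real ((\<integral>\<^sup>+\<tau>\<in>{0<..}. ennreal (exp (- real (Suc n) * \<tau>)) * h \<tau> \<partial>lborel) / ennreal I)"
    if [measurable]: "h \<in> borel_measurable borel"
      and hI: "(\<integral>\<^sup>+\<tau>\<in>{0<..}. ennreal (exp (- \<tau>)) * h \<tau> \<partial>lborel) = ennreal I" for h n
  proof -
    have "emeasure (N h) (space (N h)) = (\<integral>\<^sup>+\<tau>\<in>{0<..}. ennreal (exp (- \<tau>)) * h \<tau> \<partial>lborel) / ennreal I"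
      unfolding N_def by (simp add: emeasure_density d_def nn_integral_divide)
    also have "\<dots> = 1"
      unfolding hI using I(2) by (simp add: divide_ennreal)
    finally show "prob_space (N h)" by (rule prob_spaceI)
    show "sets (N h) = sets borel" by (simp add: N_def)
    show "AE x in N h. 0 \<le> x"
      unfolding N_def by (subst AE_density) (auto simp: d_def split: split_indicator)
    have "(\<integral>x. exp (- real n * x) \<partial>N h) = enn2real (\<integral>\<^sup>+x. ennreal (exp (- real n * x)) \<partial>N h)"
      unfolding N_def by (intro integral_eq_nn_integral) auto
    also have "(\<integral>\<^sup>+x. ennreal (exp (- real n * x)) \<partial>N h) = (\<integral>\<^sup>+x. d h x * ennreal (exp (- real n * x)) \<partial>lborel)"
      unfolding N_def by (intro nn_integral_density) auto
    also have "\<dots> = (\<integral>\<^sup>+\<tau>. (ennreal (exp (- real (Suc n) * \<tau>)) * h \<tau> * indicator {0<..} \<tau>) / ennreal I \<partial>lborel)"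
    proof (intro nn_integral_cong)
      fix x :: real
      have "ennreal (exp (- real (Suc n) * x)) = ennreal (exp (- x)) * ennreal (exp (- real n * x))"
        by (simp add: ennreal_mult[symmetric] exp_add[symmetric] algebra_simps)
      then show "d h x * ennreal (exp (- real n * x)) =
          ennreal (exp (- real (Suc n) * x)) * h x * indicator {0<..} x / ennreal I"
        unfolding d_def by (simp add: divide_ennreal_def mult_ac)
    qed
    also have "\<dots> = (\<integral>\<^sup>+\<tau>\<in>{0<..}. ennreal (exp (- real (Suc n) * \<tau>)) * h \<tau> \<partial>lborel) / ennreal I"
      by (intro nn_integral_divide) measurable
    finally show "(\<integral>x. exp (- real n * x) \<partial>N h) =
      enn2real ((\<integral>\<^sup>+\<tau>\<in>{0<..}. ennreal (exp (- real (Suc n) * \<tau>)) * h \<tau> \<partial>lborel) / ennreal I)" .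
  qed
  have I2: "(\<integral>\<^sup>+\<tau>\<in>{0<..}. ennreal (exp (- \<tau>)) * h\<^sub>2 \<tau> \<partial>lborel) = ennreal I"
    using eq[of 1] I by simp
  have "N h\<^sub>1 = N h\<^sub>2"
  proof (intro laplace_unique_prob prob sets AE I(1) I2)
    show "(\<integral>x. exp (- real n * x) \<partial>N h\<^sub>1) = (\<integral>x. exp (- real n * x) \<partial>N h\<^sub>2)" for n
      using eq[of "Suc n"] by (simp only: mom[OF _ I(1)] mom[OF _ I2] assms(1,2) zero_less_Suc)
  qed simp_all
  then have "AE \<tau> in lborel. d h\<^sub>1 \<tau> = d h\<^sub>2 \<tau>"
    unfolding N_def by (intro sigma_finite_measure.density_unique[OF sigma_finite_lborel]) auto
  then show ?thesis
  proof eventually_elim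
    case (elim \<tau>)
    show ?case
    proof
      assume "0 < \<tau>"
      have "h \<tau> = d h \<tau> * ennreal I * ennreal (exp \<tau>)" for h
      proof -
        have "d h \<tau> * ennreal I = ennreal (exp (- \<tau>)) * h \<tau>"
          using \<open>0 < \<tau>\<close> I(2) by (simp add: d_def ennreal_divide_times ennreal_mult_divide_eq)
        moreover have "ennreal (exp (- \<tau>)) * ennreal (exp \<tau>) = 1"
          by (simp add: ennreal_mult[symmetric] exp_add[symmetric])
        ultimately show ?thesis
          by (simp add: mult.assoc mult.commute[of "h \<tau>"]) (simp add: mult.assoc[symmetric])
      qed
      then show "h\<^sub>1 \<tau> = h\<^sub>2 \<tau>" using elim by metis
    qed
  qed
qed

section \<open>Continuity of translations\<close>

text \<open>\<open>J B d\<close> is the length of the part of \<open>A\<close> that the shift by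
  \<open>d\<close> moves out of \<open>B\<close>. Small shifts keep each point of \<open>A\<close>
  inside an open \<open>U\<close> containing \<open>A\<close>, so \<open>J U\<close> tends to 0 by
  dominated convergence; outer regularity makes the error \<open>U - A\<close> small. The other half
  of the symmetric difference is \<open>J A\<close> at \<open>- d\<close>.\<close>

lemma tendsto_measure_translate:
  fixes A :: "real set"
  assumes A [measurable]: "A \<in> sets borel" and fin: "emeasure lborel A < \<infinity>"
  shows "((\<lambda>d. \<integral>x. \<bar>indicator A (x + d) - indicator A x :: real\<bar> \<partial>lborel) \<longlongrightarrow> 0) (at 0)"
proof -
  define J where "J B d = (\<integral>x. indicator A x * (1 - indicator B (x + d)) \<partial>lborel :: real)" for B :: "real set" and d
  have [measurable]: "(\<lambda>x. indicator B (x + d) :: real) \<in> borel_measurable borel" if "B \<in> sets borel" for B :: "real set" and d :: real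
    by (rule measurable_compose[OF _ borel_measurable_indicator[OF that]]) measurable
  have intA: "integrable lborel (\<lambda>x. indicator A x :: real)"
    using fin by (simp add: integrable_indicator_iff)
  have int: "integrable lborel (\<lambda>x. indicator A x * (1 - indicator B (x + d)) :: real)" if [measurable]: "B \<in> sets borel" for B d
    by (rule Bochner_Integration.integrable_bound[OF intA]) (auto split: split_indicator)
  have J0: "(J A \<longlongrightarrow> 0) (at 0)"
  proof (rule tendstoI)
    fix e :: real assume e: "0 < e"
    obtain U where U: "open U" "A \<subseteq> U" "emeasure lborel (U - A) < ennreal (e / 2)"
      using outer_regular_lborel[OF A, of "e / 2"] e by auto
    have [measurable]: "U \<in> sets borel" using U by simp
    have "(J U \<longlongrightarrow> 0) (at 0)"
      unfolding tendsto_at_iff_sequentially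
    proof (intro allI impI)
      fix d :: "nat \<Rightarrow> real" assume d: "d \<longlonglongrightarrow> 0"
      have "(\<lambda>n. J U (d n)) \<longlonglongrightarrow> (\<integral>x. 0 \<partial>(lborel :: real measure))"
        unfolding J_def
      proof (rule integral_dominated_convergence)
        show "integrable lborel (\<lambda>x. indicator A x :: real)" by (rule intA)
        show "AE x in lborel. (\<lambda>n. indicator A x * (1 - indicator U (x + d n))) \<longlonglongrightarrow> (0::real)"
        proof (rule AE_I2)
          fix x
          show "(\<lambda>n. indicator A x * (1 - indicator U (x + d n))) \<longlonglongrightarrow> (0::real)"
          proof (cases "x \<in> A")
            case True
            have "(\<lambda>n. x + d n) \<longlonglongrightarrow> x + 0" by (intro tendsto_intros d)
            then have "eventually (\<lambda>n. x + d n \<in> U) sequentially"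
              using True U by (intro topological_tendstoD) auto
            then have "eventually (\<lambda>n. indicator A x * (1 - indicator U (x + d n)) = (0::real)) sequentially"
              by eventually_elim simp
            then show ?thesis by (rule tendsto_eventually)
          qed simp
        qed
        show "AE x in lborel. norm (indicator A x * (1 - indicator U (x + d n)) :: real) \<le> indicator A x" for n
          by (auto split: split_indicator)
      qed measurable
      then show "(J U \<circ> d) \<longlonglongrightarrow> 0" by (simp add: o_def)
    qed
    then have "eventually (\<lambda>d. dist (J U d) 0 < e / 2) (at 0)"
      using e by (intro tendstoD) auto
    then show "eventually (\<lambda>d. dist (J A d) 0 < e) (at 0)"
    proof eventually_elim
      case (elim d)
      have intUA: "integrable lborel (\<lambda>x. indicator (U - A) x :: real)"
        using U(3) by (auto simp: integrable_indicator_iff intro: less_trans)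
      have "J A d \<le> (\<integral>x. indicator A x * (1 - indicator U (x + d)) + indicator (U - A) (d + 1 * x) \<partial>lborel)"
        unfolding J_def using lborel_integrable_real_affine[OF intUA, of 1 d]
        by (intro integral_mono int Bochner_Integration.integrable_add) (auto simp: add.commute split: split_indicator)
      also have "\<dots> = J U d + (\<integral>x. indicator (U - A) (d + 1 * x) \<partial>lborel)"
        unfolding J_def using lborel_integrable_real_affine[OF intUA, of 1 d]
        by (intro Bochner_Integration.integral_add int) auto
      also have "(\<integral>x. indicator (U - A) (d + 1 * x) \<partial>lborel) = measure lborel (U - A)"
        using lborel_integral_real_affine[of 1 "\<lambda>x. indicator (U - A) x :: real" d] by simp
      also have "measure lborel (U - A) < e / 2"
      proof -
        have "emeasure lborel (U - A) = ennreal (measure lborel (U - A))"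
          using U(3) by (intro emeasure_eq_ennreal_measure) auto
        then show ?thesis using U(3) by (simp add: ennreal_less_iff)
      qed
      finally have "J A d < e" using elim by (simp add: dist_real_def)
      moreover have "0 \<le> J A d"
        unfolding J_def by (intro Bochner_Integration.integral_nonneg) (auto split: split_indicator)
      ultimately show ?case by (simp add: dist_real_def)
    qed
  qed
  have J_neg: "((\<lambda>d. J A (- d)) \<longlongrightarrow> 0) (at 0)"
    by (rule filterlim_compose[OF J0]) (auto simp: filterlim_at eventually_at_filter intro!: tendsto_eq_intros)
  have "(\<integral>x. \<bar>indicator A (x + d) - indicator A x :: real\<bar> \<partial>lborel) = J A d + J A (- d)" for d
  proof -
    have "J A (- d) = (\<integral>x. indicator A (d + 1 * x) * (1 - indicator A (d + 1 * x + - d)) \<partial>lborel)"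
      unfolding J_def
      using lborel_integral_real_affine[of 1 "\<lambda>x. indicator A x * (1 - indicator A (x + - d)) :: real" d] by simp
    moreover have "integrable lborel (\<lambda>x. indicator A (d + 1 * x) * (1 - indicator A (d + 1 * x + - d)) :: real)"
      by (rule lborel_integrable_real_affine[OF int]) auto
    ultimately have "J A d + J A (- d) = (\<integral>x. indicator A x * (1 - indicator A (x + d)) +
        indicator A (d + 1 * x) * (1 - indicator A (d + 1 * x + - d)) \<partial>lborel)"
      unfolding J_def by (subst Bochner_Integration.integral_add) (auto intro: int)
    also have "\<dots> = (\<integral>x. \<bar>indicator A (x + d) - indicator A x :: real\<bar> \<partial>lborel)"
      by (intro Bochner_Integration.integral_cong) (auto simp: add.commute split: split_indicator)
    finally show ?thesis by simp
  qed
  then show ?thesis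
    using tendsto_add[OF J0 J_neg] by simp
qed

text \<open>Supplies the continuity of \<open>U\<close> in time: the densities are not assumed
  continuous, but time enters them as a translation.\<close>

lemma tendsto_L1_translate:
  fixes h :: "real \<Rightarrow> real"
  assumes "integrable lborel h"
  shows "((\<lambda>d. \<integral>x. \<bar>h (x + d) - h x\<bar> \<partial>lborel) \<longlongrightarrow> 0) (at 0)"
  using assms
proof (induction rule: integrable_induct)
  case (base A c)
  have "((\<lambda>d. \<bar>c\<bar> * (\<integral>x. \<bar>indicator A (x + d) - indicator A x :: real\<bar> \<partial>lborel)) \<longlongrightarrow> \<bar>c\<bar> * 0) (at 0)"
    using base by (intro tendsto_mult tendsto_const tendsto_measure_translate) auto
  also have "(\<lambda>d. \<bar>c\<bar> * (\<integral>x. \<bar>indicator A (x + d) - indicator A x :: real\<bar> \<partial>lborel)) =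
      (\<lambda>d. \<integral>x. \<bar>indicator A (x + d) *\<^sub>R c - indicator A x *\<^sub>R c\<bar> \<partial>lborel)"
    unfolding integral_mult_right_zero[symmetric]
    by (intro ext Bochner_Integration.integral_cong) (auto simp: abs_mult[symmetric] algebra_simps)
  finally show ?case by simp
next
  case (add f g)
  have int: "integrable lborel (\<lambda>x. \<bar>h (x + d) - h x\<bar>)" if "integrable lborel h" for h :: "real \<Rightarrow> real" and d
    using lborel_integrable_real_affine[OF that, of 1 d] that
    by (intro integrable_abs Bochner_Integration.integrable_diff) (auto simp: add.commute)
  have lim: "((\<lambda>d. (\<integral>x. \<bar>f (x + d) - f x\<bar> \<partial>lborel) + (\<integral>x. \<bar>g (x + d) - g x\<bar> \<partial>lborel)) \<longlongrightarrow> 0) (at 0)"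
    using tendsto_add[OF add.IH] by simp
  have "norm (\<integral>x. \<bar>f (x + d) + g (x + d) - (f x + g x)\<bar> \<partial>lborel) \<le>
      (\<integral>x. \<bar>f (x + d) - f x\<bar> \<partial>lborel) + (\<integral>x. \<bar>g (x + d) - g x\<bar> \<partial>lborel)" for d
  proof -
    have "(\<integral>x. \<bar>f (x + d) + g (x + d) - (f x + g x)\<bar> \<partial>lborel) \<le>
        (\<integral>x. \<bar>f (x + d) - f x\<bar> + \<bar>g (x + d) - g x\<bar> \<partial>lborel)"
      using int[OF Bochner_Integration.integrable_add[OF add.hyps]] add.hyps
      by (intro integral_mono Bochner_Integration.integrable_add int) auto
    then show ?thesis using add.hyps by (simp add: int)
  qed
  then show ?case
    by (intro Lim_null_comparison[OF _ lim] always_eventually) auto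
next
  case (lim f s)
  have int: "integrable lborel (\<lambda>x. \<bar>h (x + d) - h x\<bar>)" if "integrable lborel h" for h :: "real \<Rightarrow> real" and d
    using lborel_integrable_real_affine[OF that, of 1 d] that
    by (intro integrable_abs Bochner_Integration.integrable_diff) (auto simp: add.commute)
  have shift: "integrable lborel (\<lambda>x. h (x + d))" "(\<integral>x. \<bar>h (x + d)\<bar> \<partial>lborel) = (\<integral>x. \<bar>h x\<bar> \<partial>lborel)"
    if "integrable lborel h" for h :: "real \<Rightarrow> real" and d
    using lborel_integrable_real_affine[OF that, of 1 d] lborel_integral_real_affine[of 1 "\<lambda>x. \<bar>h x\<bar>" d]
    by (simp_all add: add.commute)
  have "(\<lambda>i. \<integral>x. \<bar>f x - s i x\<bar> \<partial>lborel) \<longlonglongrightarrow> (\<integral>x. \<bar>f x - f x\<bar> \<partial>lborel)"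
  proof (rule integral_dominated_convergence)
    \<comment> \<open>The approximating functions satisfy
      \<open>\<bar>s i x\<bar> \<le> 2 * \<bar>f x\<bar>\<close>, whence the factor 3.\<close>
    show "integrable lborel (\<lambda>x. 3 * \<bar>f x\<bar>)" using lim.hyps by simp
    show "AE x in lborel. (\<lambda>i. \<bar>f x - s i x\<bar>) \<longlonglongrightarrow> \<bar>f x - f x\<bar>"
      using lim.hyps by (intro AE_I2 tendsto_intros) auto
    show "AE x in lborel. norm \<bar>f x - s i x\<bar> \<le> 3 * \<bar>f x\<bar>" for i
    proof (rule AE_I2)
      fix x :: real
      show "norm \<bar>f x - s i x\<bar> \<le> 3 * \<bar>f x\<bar>" using lim.hyps(3)[of x i] by auto
    qed
  qed (use lim.hyps in auto)
  then have approx: "(\<lambda>i. \<integral>x. \<bar>f x - s i x\<bar> \<partial>lborel) \<longlonglongrightarrow> 0" by simp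
  show ?case
  proof (rule tendstoI)
    fix e :: real assume e: "0 < e"
    then obtain i where i: "\<bar>\<integral>x. \<bar>f x - s i x\<bar> \<partial>lborel\<bar> < e / 3"
      using tendstoD[OF approx, of "e / 3"] by (auto simp: eventually_sequentially)
    have "eventually (\<lambda>d. dist (\<integral>x. \<bar>s i (x + d) - s i x\<bar> \<partial>lborel) 0 < e / 3) (at 0)"
      using lim.IH e by (intro tendstoD) auto
    then show "eventually (\<lambda>d. dist (\<integral>x. \<bar>f (x + d) - f x\<bar> \<partial>lborel) 0 < e) (at 0)"
    proof eventually_elim
      case (elim d)
      let ?r = "\<lambda>x. f x - s i x"
      have r: "integrable lborel ?r" using lim.hyps by simp
      have "(\<integral>x. \<bar>f (x + d) - f x\<bar> \<partial>lborel) \<le>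
          (\<integral>x. \<bar>?r (x + d)\<bar> + \<bar>?r x\<bar> + \<bar>s i (x + d) - s i x\<bar> \<partial>lborel)"
        using lim.hyps(1,4) r by (intro integral_mono Bochner_Integration.integrable_add int integrable_abs shift(1)[OF r]) auto
      also have "\<dots> = (\<integral>x. \<bar>?r (x + d)\<bar> \<partial>lborel) + (\<integral>x. \<bar>?r x\<bar> \<partial>lborel) + (\<integral>x. \<bar>s i (x + d) - s i x\<bar> \<partial>lborel)"
      proof -
        have "integrable lborel (\<lambda>x. \<bar>?r (x + d)\<bar>)" "integrable lborel (\<lambda>x. \<bar>?r x\<bar>)"
          using r shift(1)[OF r, of d] by (simp_all add: integrable_abs)
        then show ?thesis using int[OF lim.hyps(1), of i d] by simp
      qed
      also have "\<dots> < e"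
        using i elim shift(2)[OF r, of d] by (simp add: dist_real_def)
      finally show ?case by (simp add: dist_real_def Bochner_Integration.integral_nonneg)
    qed
  qed
qed

section \<open>Subordinators with densities\<close>

lemma nn_integral_exp_Icc:
  assumes "0 < c" "0 \<le> z"
  shows "(\<integral>\<^sup>+x. ennreal (exp (- c * x)) * indicator {0..z} x \<partial>lborel) = ennreal ((1 - exp (- c * z)) / c)"
proof -
  have "(\<integral>\<^sup>+x. ennreal (exp (- c * x)) * indicator {0..z} x \<partial>lborel) =
      ennreal (- exp (- c * z) / c - (- exp (- c * 0) / c))"
    using assms by (intro nn_integral_FTC_Icc) (auto intro!: derivative_eq_intros)
  then show ?thesis by (simp add: diff_divide_distrib)
qed

lemma nn_integral_exp_Ici:
  assumes "0 < c"
  shows "(\<integral>\<^sup>+x. ennreal (exp (- c * x)) * indicator {a..} x \<partial>lborel) = ennreal (exp (- c * a) / c)"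
proof -
  have "((\<lambda>x. - exp (- c * x) / c) \<longlongrightarrow> - 0 / c) at_top"
    using assms by (intro tendsto_intros filterlim_compose[OF exp_at_bot])
      (auto intro!: filterlim_tendsto_pos_mult_at_top[OF tendsto_const] filterlim_ident simp: filterlim_uminus_at_bot)
  then have "(\<integral>\<^sup>+x. ennreal (exp (- c * x)) * indicator {a..} x \<partial>lborel) =
      ennreal (- 0 / c - (- exp (- c * a) / c))"
    using assms by (intro nn_integral_FTC_atLeast) (auto intro!: derivative_eq_intros)
  then show ?thesis by simp
qed

locale subordinator_with_density =
  fixes M :: "'w measure" and S :: "real \<Rightarrow> 'w \<Rightarrow> real" and \<nu> :: "real measure"
    and p :: "real \<Rightarrow> real \<Rightarrow> real"
  assumes driftless: "driftless_subordinator M S \<nu>"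
    and densities: "bounded_densities M S p"
    and infinite: "emeasure \<nu> {0<..} = \<infinity>"
begin

sublocale prob_space M
  using driftless by (simp add: driftless_subordinator_def subordinator_def)

lemma S_measurable [measurable (raw)]: "0 \<le> t \<Longrightarrow> S t \<in> borel_measurable M"
  and S_0: "\<omega> \<in> space M \<Longrightarrow> S 0 \<omega> = 0"
  and S_mono: "\<omega> \<in> space M \<Longrightarrow> 0 \<le> s \<Longrightarrow> s \<le> t \<Longrightarrow> S s \<omega> \<le> S t \<omega>"
  and S_right_cont: "\<omega> \<in> space M \<Longrightarrow> 0 \<le> t \<Longrightarrow> ((\<lambda>s. S s \<omega>) \<longlongrightarrow> S t \<omega>) (at_right t)"
  using driftless
  by (auto simp: driftless_subordinator_def subordinator_def mono_on_def continuous_within)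

lemma S_nonneg: "\<omega> \<in> space M \<Longrightarrow> 0 \<le> t \<Longrightarrow> 0 \<le> S t \<omega>"
  using S_mono[of \<omega> 0 t] S_0 by auto

lemma sets_nu [measurable_cong]: "sets \<nu> = sets borel"
  and nu_nonpos: "emeasure \<nu> {..0} = 0"
  and nn_integral_min_nu: "(\<integral>\<^sup>+x. ennreal (min 1 x) \<partial>\<nu>) < \<infinity>"
  using driftless by (auto simp: driftless_subordinator_def levy_measure_subordinator_def)

lemma AE_nu_pos: "AE x in \<nu>. 0 < x"
  by (rule AE_I[of _ _ "{..0}"]) (auto simp: nu_nonpos)

definition \<phi> :: "real \<Rightarrow> real" where
  "\<phi> c = (\<integral>x. 1 - exp (- c * x) \<partial>\<nu>)"

lemma nu_tail_finite:
  assumes "0 < x" shows "emeasure \<nu> {x<..} < \<infinity>"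
proof -
  have "ennreal (min 1 x) * emeasure \<nu> {x<..} = (\<integral>\<^sup>+z. ennreal (min 1 x) * indicator {x<..} z \<partial>\<nu>)"
    by (simp add: nn_integral_cmult)
  also have "\<dots> \<le> (\<integral>\<^sup>+z. ennreal (min 1 z) \<partial>\<nu>)"
    using assms by (intro nn_integral_mono) (auto split: split_indicator intro!: ennreal_leI)
  also have "\<dots> < \<infinity>" by (rule nn_integral_min_nu)
  finally show ?thesis
    using assms by (auto simp: ennreal_mult_less_top)
qed

sublocale nu: sigma_finite_measure \<nu>
proof
  define A where "A = insert {..0} (range (\<lambda>n. {inverse (real (Suc n))<..}))"
  have "\<Union>A = UNIV"
  proof (intro set_eqI iffI UNIV_I)
    fix x :: real
    show "x \<in> \<Union>A"
    proof (cases "0 < x")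
      case True
      then obtain n where "inverse (real (Suc n)) < x" using reals_Archimedean by blast
      then show ?thesis by (auto simp: A_def)
    qed (auto simp: A_def)
  qed
  moreover have "emeasure \<nu> a \<noteq> \<infinity>" if "a \<in> A" for a
    using that nu_nonpos nu_tail_finite by (force simp: A_def less_top[symmetric])
  ultimately show "\<exists>A. countable A \<and> A \<subseteq> sets \<nu> \<and> \<Union> A = space \<nu> \<and> (\<forall>a\<in>A. emeasure \<nu> a \<noteq> \<infinity>)"
    using sets_eq_imp_space_eq[OF sets_nu] by (intro exI[of _ A]) (auto simp: A_def)
qed

lemma one_minus_exp_le: "0 \<le> c \<Longrightarrow> 0 \<le> x \<Longrightarrow> 1 - exp (- c * x) \<le> max 1 c * min 1 (x::real)"
proof -
  assume cx: "0 \<le> c" "0 \<le> x"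
  have "1 - exp (- c * x) \<le> c * x" using exp_ge_add_one_self[of "- c * x"] by simp
  moreover have "c * x \<le> max 1 c * x" using cx by (intro mult_right_mono) auto
  ultimately show ?thesis
    using cx by (auto simp: min_def intro: order_trans[of _ 1])
qed

lemma integrable_phi: "0 \<le> c \<Longrightarrow> integrable \<nu> (\<lambda>x. 1 - exp (- c * x))"
proof (rule Bochner_Integration.integrable_bound)
  show "integrable \<nu> (\<lambda>x. max 1 c * max 0 (min 1 x))"
  proof (intro integrable_mult_right integrableI_bounded)
    have "(\<integral>\<^sup>+ x. ennreal (norm (max 0 (min 1 x))) \<partial>\<nu>) = (\<integral>\<^sup>+x. ennreal (min 1 x) \<partial>\<nu>)"
      by (intro nn_integral_cong) (auto simp: max_def ennreal_neg)
    then show "(\<integral>\<^sup>+ x. ennreal (norm (max 0 (min 1 x))) \<partial>\<nu>) < \<infinity>"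
      using nn_integral_min_nu by simp
  qed simp
  assume "0 \<le> c"
  show "AE x in \<nu>. norm (1 - exp (- c * x)) \<le> norm (max 1 c * max 0 (min 1 x))"
    using AE_nu_pos
  proof eventually_elim
    case (elim x)
    then show ?case using one_minus_exp_le[of c x] \<open>0 \<le> c\<close> by (simp add: abs_mult max_def)
  qed
qed simp

lemma nn_integral_phi: "0 \<le> c \<Longrightarrow> (\<integral>\<^sup>+x. ennreal (1 - exp (- c * x)) \<partial>\<nu>) = ennreal (\<phi> c)"
  unfolding \<phi>_def using AE_nu_pos by (intro nn_integral_eq_integral integrable_phi) auto

lemma phi_pos: assumes "0 < c" shows "0 < \<phi> c"
proof (rule ccontr)
  assume "\<not> 0 < \<phi> c"
  then have "(\<integral>\<^sup>+x. ennreal (1 - exp (- c * x)) \<partial>\<nu>) = 0"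
    using nn_integral_phi[of c] assms by (simp add: ennreal_neg)
  then have "AE x in \<nu>. ennreal (1 - exp (- c * x)) = 0"
    by (subst (asm) nn_integral_0_iff_AE) auto
  then have "AE x in \<nu>. x \<notin> {0<..}"
    by eventually_elim (use assms in \<open>auto simp: ennreal_eq_0_iff mult_le_0_iff\<close>)
  then have "emeasure \<nu> {0<..} = 0"
    by (subst (asm) AE_iff_measurable[of "{0<..}"]) (auto simp: sets_eq_imp_space_eq[OF sets_nu])
  then show False using infinite by simp
qed

lemma nn_integral_laplace:
  assumes "0 \<le> t" "0 \<le> c"
  shows "(\<integral>\<^sup>+\<omega>. ennreal (exp (- c * S t \<omega>)) \<partial>M) = ennreal (exp (- t * \<phi> c))"
proof -
  have "integrable M (\<lambda>\<omega>. exp (- c * S t \<omega>))"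
    using assms S_nonneg by (intro integrable_const_bound[where B=1]) auto
  then have "(\<integral>\<^sup>+\<omega>. ennreal (exp (- c * S t \<omega>)) \<partial>M) = ennreal (\<integral>\<omega>. exp (- c * S t \<omega>) \<partial>M)"
    by (intro nn_integral_eq_integral) auto
  also have "(\<integral>\<omega>. exp (- c * S t \<omega>) \<partial>M) = exp (- t * \<phi> c)"
    using driftless assms by (simp add: driftless_subordinator_def \<phi>_def)
  finally show ?thesis .
qed

text \<open>The values of \<open>p\<close> at other arguments never matter.\<close>

definition dens :: "real \<Rightarrow> real \<Rightarrow> real" where
  "dens r x = (if 0 < r \<and> 0 \<le> x then p r x else 0)"

lemma dens_nonneg: "0 \<le> dens r x"
  using densities by (simp add: dens_def bounded_densities_def)

lemma measurable_dens [measurable]: "(\<lambda>(r, x). dens r x) \<in> borel_measurable (borel \<Otimes>\<^sub>M borel)"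
proof -
  define N where "N = restrict_space (borel \<Otimes>\<^sub>M borel) {z :: real \<times> real. 0 < fst z}"
  have "(\<lambda>(r, x). p r x) \<in> borel_measurable (restrict_space borel {0<..} \<Otimes>\<^sub>M borel)"
    using densities by (simp add: bounded_densities_def)
  moreover have "(\<lambda>z. (fst z, snd z)) \<in> N \<rightarrow>\<^sub>M restrict_space borel {0<..} \<Otimes>\<^sub>M borel"
    unfolding N_def
    by (intro measurable_Pair measurable_restrict_space2 measurable_restrict_space1) (auto simp: space_restrict_space)
  ultimately have "(\<lambda>z. case (fst z, snd z) of (r, x) \<Rightarrow> p r x) \<in> borel_measurable N"
    by (rule measurable_compose[rotated])
  then have "(\<lambda>z. if z \<in> {z. 0 < fst z} then case (fst z, snd z) of (r, x) \<Rightarrow> p r x else 0)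
      \<in> borel_measurable (borel \<Otimes>\<^sub>M borel)"
    unfolding N_def by (subst (asm) measurable_restrict_space_iff[where c=0]) auto
  then have "(\<lambda>z. (if z \<in> {z. 0 < fst z} then case (fst z, snd z) of (r, x) \<Rightarrow> p r x else 0) *
      indicator {0..} (snd z)) \<in> borel_measurable (borel \<Otimes>\<^sub>M borel)"
    by measurable
  also have "(\<lambda>z. (if z \<in> {z. 0 < fst z} then case (fst z, snd z) of (r, x) \<Rightarrow> p r x else 0) *
      indicator {0..} (snd z)) = (\<lambda>(r, x). dens r x)"
    by (auto simp: dens_def fun_eq_iff)
  finally show ?thesis .
qed

lemma measurable_dens' [measurable (raw)]:
  assumes "f \<in> borel_measurable N" "g \<in> borel_measurable N"
  shows "(\<lambda>x. dens (f x) (g x)) \<in> borel_measurable N"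
  using measurable_compose[OF measurable_Pair[OF assms] measurable_dens] by simp

lemma nn_integral_S:
  assumes r: "0 < r" and [measurable]: "g \<in> borel_measurable borel"
  shows "(\<integral>\<^sup>+\<omega>. g (S r \<omega>) \<partial>M) = (\<integral>\<^sup>+x. ennreal (dens r x) * g x \<partial>lborel)"
proof -
  have d: "distributed M lborel (S r) (\<lambda>x. ennreal (p r x))"
    using densities r by (simp add: bounded_densities_def)
  have "(\<integral>\<^sup>+\<omega>. g (S r \<omega>) \<partial>M) = (\<integral>\<^sup>+\<omega>. g (S r \<omega>) * indicator {0..} (S r \<omega>) \<partial>M)"
    using r S_nonneg by (intro nn_integral_cong) auto
  also have "\<dots> = (\<integral>\<^sup>+x. ennreal (p r x) * (g x * indicator {0..} x) \<partial>lborel)"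
    using distributed_nn_integral[OF d, of "\<lambda>x. g x * indicator {0..} x"] by simp
  also have "\<dots> = (\<integral>\<^sup>+x. ennreal (dens r x) * g x \<partial>lborel)"
    using r by (intro nn_integral_cong) (auto simp: dens_def split: split_indicator)
  finally show ?thesis .
qed

lemma nn_integral_dens: "0 < r \<Longrightarrow> (\<integral>\<^sup>+x. ennreal (dens r x) \<partial>lborel) = 1"
  using nn_integral_S[of r "\<lambda>_. 1"] by (simp add: emeasure_space_1)

text \<open>A law with a density has no atoms. This allows strict and weak inequalities between
  \<open>S r\<close> and a fixed level to be exchanged, and is the source of continuity of the
  inverse process.\<close>

lemma AE_S_neq: "0 < r \<Longrightarrow> AE \<omega> in M. S r \<omega> \<noteq> x"
proof -
  assume r: "0 < r"
  have "(\<integral>\<^sup>+\<omega>. indicator {x} (S r \<omega>) \<partial>M) = 0"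
    using r by (subst nn_integral_S) (auto simp: nn_integral_0_iff_AE AE_lborel_singleton)
  then show ?thesis
    using r by (subst (asm) nn_integral_0_iff_AE) (auto split: split_indicator_asm)
qed

section \<open>The tail of the Levy measure and its Laplace transform\<close>

abbreviation w :: "real \<Rightarrow> real" where "w \<equiv> levy_tail \<nu>"

text \<open>A default value at work: \<open>measure\<close> sends infinite mass to 0, and the tail
  is infinite at 0 and below because \<open>\<nu>\<close> is. So \<open>w\<close> vanishes there and
  convolutions with \<open>w\<close> need no explicit cut-off.\<close>

lemma w_nonpos: "x \<le> 0 \<Longrightarrow> w x = 0"
proof -
  assume "x \<le> 0"
  then have "emeasure \<nu> {0<..} \<le> emeasure \<nu> {x<..}"
    by (intro emeasure_mono) auto
  then show ?thesis
    using infinite by (simp add: levy_tail_def measure_def top_unique)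
qed

lemma w_nonneg: "0 \<le> w x" by (simp add: levy_tail_def)

lemma ennreal_w: "0 < x \<Longrightarrow> ennreal (w x) = emeasure \<nu> {x<..}"
  using nu_tail_finite[of x] by (simp add: levy_tail_def emeasure_eq_ennreal_measure)

lemma measurable_w [measurable]: "w \<in> borel_measurable borel"
proof -
  have "(\<lambda>x. \<integral>\<^sup>+z. indicator {x<..} z \<partial>\<nu>) \<in> borel_measurable borel"
    by (intro nu.borel_measurable_nn_integral) (simp add: indicator_def)
  then have "(\<lambda>x. enn2real (\<integral>\<^sup>+z. indicator {x<..} z \<partial>\<nu>)) \<in> borel_measurable borel"
    by measurable
  then show ?thesis by (simp add: levy_tail_def[abs_def] measure_def)
qed

text \<open>Tonelli: integrated over \<open>x\<close> first, the exponential contributes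
  \<open>(1 - exp (- c * z)) / c\<close>, whose integral against \<open>\<nu>\<close> is
  \<open>\<phi> c / c\<close>.\<close>

lemma nn_integral_laplace_w:
  assumes "0 < c"
  shows "(\<integral>\<^sup>+x. ennreal (exp (- c * x)) * ennreal (w x) \<partial>lborel) = ennreal (\<phi> c / c)"
proof -
  interpret pair_sigma_finite lborel \<nu> ..
  have "(\<integral>\<^sup>+x. ennreal (exp (- c * x)) * ennreal (w x) \<partial>lborel) =
      (\<integral>\<^sup>+x. \<integral>\<^sup>+z. ennreal (exp (- c * x)) * indicator {0<..} x * indicator {x<..} z \<partial>\<nu> \<partial>lborel)"
    by (intro nn_integral_cong) (auto simp: nn_integral_cmult ennreal_w w_nonpos split: split_indicator)
  also have "\<dots> = (\<integral>\<^sup>+z. \<integral>\<^sup>+x. ennreal (exp (- c * x)) * indicator {0<..} x * indicator {x<..} z \<partial>lborel \<partial>\<nu>)"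
    by (intro Fubini'[symmetric]) (simp add: indicator_def)
  also have "\<dots> = (\<integral>\<^sup>+z. ennreal (1 / c) * ennreal (1 - exp (- c * z)) \<partial>\<nu>)"
  proof (intro nn_integral_cong_AE, use AE_nu_pos in eventually_elim)
    case (elim z)
    have "(\<integral>\<^sup>+x. ennreal (exp (- c * x)) * indicator {0<..} x * indicator {x<..} z \<partial>lborel) =
        (\<integral>\<^sup>+x. ennreal (exp (- c * x)) * indicator {0..z} x \<partial>lborel)"
      using AE_lborel_singleton[of 0] AE_lborel_singleton[of z]
      by (intro nn_integral_cong_AE, eventually_elim) (auto split: split_indicator)
    then show ?case
      using elim assms nn_integral_exp_Icc[of c z] by (simp add: ennreal_mult[symmetric])
  qed
  also have "\<dots> = ennreal (\<phi> c / c)"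
    using assms nn_integral_phi[of c] phi_pos[of c]
    by (subst nn_integral_cmult) (auto simp: ennreal_mult[symmetric])
  finally show ?thesis .
qed

text \<open>Finiteness of the Laplace transform at 1 gives local integrability, as
  \<open>exp T * exp (- x)\<close> is at least 1 for \<open>x < T\<close>.\<close>

lemma integrable_w: "integrable lborel (\<lambda>x. indicator {0<..<T} x *\<^sub>R w x)"
proof (rule integrableI_bounded)
  have "(\<integral>\<^sup>+x. ennreal (norm (indicator {0<..<T} x *\<^sub>R w x)) \<partial>lborel) \<le>
     (\<integral>\<^sup>+x. ennreal (exp T) * (ennreal (exp (- 1 * x)) * ennreal (w x)) \<partial>lborel)"
  proof (intro nn_integral_mono)
    fix x :: real
    have "w x \<le> exp T * (exp (- x) * w x)" if "x < T"
      using that w_nonneg[of x] mult_right_mono[of 1 "exp T * exp (- x)" "w x"]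
      by (simp add: mult_exp_exp mult.assoc[symmetric])
    then show "ennreal (norm (indicator {0<..<T} x *\<^sub>R w x)) \<le> ennreal (exp T) * (ennreal (exp (- 1 * x)) * ennreal (w x))"
      using w_nonneg[of x] by (auto simp: ennreal_mult[symmetric] split: split_indicator intro!: ennreal_leI)
  qed
  also have "\<dots> = ennreal (exp T) * ennreal (\<phi> 1 / 1)"
    by (subst nn_integral_cmult) (auto simp: nn_integral_laplace_w[of 1, simplified])
  also have "\<dots> < \<infinity>" by (simp add: ennreal_mult_less_top)
  finally show "(\<integral>\<^sup>+x. ennreal (norm (indicator {0<..<T} x *\<^sub>R w x)) \<partial>lborel) < \<infinity>" .
qed simp

lemma integrable_w_reflect: "integrable lborel (\<lambda>s. indicator {0<..<T} s * w (T - s))"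
  using lborel_integrable_real_affine[OF integrable_w, of "-1" T T]
  by (rule Bochner_Integration.integrable_cong[THEN iffD1, rotated -1]) (auto split: split_indicator)

lemma nn_integral_laplace_dens:
  assumes "0 < r" "0 \<le> c"
  shows "(\<integral>\<^sup>+x. ennreal (dens r x) * ennreal (exp (- c * x)) \<partial>lborel) = ennreal (exp (- r * \<phi> c))"
  using nn_integral_S[of r "\<lambda>x. ennreal (exp (- c * x))"] nn_integral_laplace[of r c] assms by simp

text \<open>\<open>q \<tau>\<close> turns out to be the density of the inverse subordinator at time \<open>\<tau>\<close>, for almost
  every \<open>\<tau> > 0\<close>.\<close>

definition q :: "real \<Rightarrow> real \<Rightarrow> ennreal" where
  "q \<tau> r = (\<integral>\<^sup>+x. ennreal (dens r x) * ennreal (w (\<tau> - x)) \<partial>lborel)"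

lemma measurable_q [measurable (raw)]:
  assumes [measurable]: "f \<in> borel_measurable N" "g \<in> borel_measurable N"
  shows "(\<lambda>x. q (f x) (g x)) \<in> borel_measurable N"
  unfolding q_def by measurable

lemma q_eq_0: "\<tau> \<le> 0 \<or> r \<le> 0 \<Longrightarrow> q \<tau> r = 0"
proof -
  assume "\<tau> \<le> 0 \<or> r \<le> 0"
  then have "ennreal (dens r x) * ennreal (w (\<tau> - x)) = 0" for x
    by (cases "0 \<le> x") (auto simp: dens_def w_nonpos)
  then show ?thesis by (simp only: q_def) simp
qed

text \<open>For fixed \<open>r\<close> the convolution of \<open>w\<close> with the density has
  transform \<open>\<phi> c / c * exp (- r * \<phi> c)\<close>. Integration over
  \<open>r > R\<close> cancels the factor \<open>\<phi> c\<close>, leaving the same value as in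
  \<open>nn_integral_laplace_cdf\<close>.\<close>

lemma nn_integral_laplace_q:
  assumes c: "0 < c" and R: "0 \<le> R"
  shows "(\<integral>\<^sup>+\<tau>\<in>{0<..}. ennreal (exp (- c * \<tau>)) * (\<integral>\<^sup>+r\<in>{R<..}. q \<tau> r \<partial>lborel) \<partial>lborel) =
     ennreal (exp (- R * \<phi> c) / c)"
proof -
  have shift: "(\<integral>\<^sup>+\<tau>. ennreal (exp (- c * \<tau>)) * ennreal (w (\<tau> - x)) \<partial>lborel) =
      ennreal (\<phi> c / c) * ennreal (exp (- c * x))" for x
  proof -
    have "(\<integral>\<^sup>+\<tau>. ennreal (exp (- c * \<tau>)) * ennreal (w (\<tau> - x)) \<partial>lborel) =
        (\<integral>\<^sup>+y. ennreal (exp (- c * (x + y))) * ennreal (w y) \<partial>lborel)"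
      by (subst nn_integral_real_affine[where c=1 and t=x]) auto
    also have "\<dots> = (\<integral>\<^sup>+y. ennreal (exp (- c * x)) * (ennreal (exp (- c * y)) * ennreal (w y)) \<partial>lborel)"
    proof (intro nn_integral_cong)
      fix y :: real
      have "ennreal (exp (- c * (x + y))) = ennreal (exp (- c * x)) * ennreal (exp (- c * y))"
        by (simp add: ennreal_mult[symmetric] mult_exp_exp distrib_left)
      then show "ennreal (exp (- c * (x + y))) * ennreal (w y) =
          ennreal (exp (- c * x)) * (ennreal (exp (- c * y)) * ennreal (w y))"
        by (simp only: mult.assoc)
    qed
    also have "\<dots> = ennreal (\<phi> c / c) * ennreal (exp (- c * x))"
      by (subst nn_integral_cmult) (auto simp: nn_integral_laplace_w[OF c, simplified] mult.commute[of "ennreal (\<phi> c / c)"])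
    finally show ?thesis .
  qed
  have "(\<integral>\<^sup>+\<tau>\<in>{0<..}. ennreal (exp (- c * \<tau>)) * (\<integral>\<^sup>+r\<in>{R<..}. q \<tau> r \<partial>lborel) \<partial>lborel) =
      (\<integral>\<^sup>+\<tau>. \<integral>\<^sup>+r. ennreal (exp (- c * \<tau>)) * (q \<tau> r * indicator {R<..} r) \<partial>lborel \<partial>lborel)"
    by (intro nn_integral_cong) (auto simp: nn_integral_cmult q_eq_0 split: split_indicator)
  also have "\<dots> = (\<integral>\<^sup>+r. \<integral>\<^sup>+\<tau>. ennreal (exp (- c * \<tau>)) * (q \<tau> r * indicator {R<..} r) \<partial>lborel \<partial>lborel)"
    by (intro lborel_pair.Fubini') measurable
  also have "\<dots> = (\<integral>\<^sup>+r\<in>{R<..}. (ennreal (\<phi> c / c) * ennreal (exp (- r * \<phi> c))) \<partial>lborel)"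
  proof (intro nn_integral_cong)
    fix r :: real
    have "(\<integral>\<^sup>+\<tau>. ennreal (exp (- c * \<tau>)) * q \<tau> r \<partial>lborel) = ennreal (\<phi> c / c) * ennreal (exp (- r * \<phi> c))"
      if "0 < r"
    proof -
      have "(\<integral>\<^sup>+\<tau>. ennreal (exp (- c * \<tau>)) * q \<tau> r \<partial>lborel) =
          (\<integral>\<^sup>+\<tau>. \<integral>\<^sup>+x. ennreal (exp (- c * \<tau>)) * (ennreal (dens r x) * ennreal (w (\<tau> - x))) \<partial>lborel \<partial>lborel)"
        unfolding q_def by (intro nn_integral_cong nn_integral_cmult[symmetric]) measurable
      also have "\<dots> = (\<integral>\<^sup>+x. \<integral>\<^sup>+\<tau>. ennreal (exp (- c * \<tau>)) * (ennreal (dens r x) * ennreal (w (\<tau> - x))) \<partial>lborel \<partial>lborel)"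
        by (intro lborel_pair.Fubini') measurable
      also have "\<dots> = (\<integral>\<^sup>+x. ennreal (dens r x) * (\<integral>\<^sup>+\<tau>. ennreal (exp (- c * \<tau>)) * ennreal (w (\<tau> - x)) \<partial>lborel) \<partial>lborel)"
        by (intro nn_integral_cong, subst nn_integral_cmult[symmetric])
          (measurable, simp only: mult.left_commute)
      also have "\<dots> = (\<integral>\<^sup>+x. ennreal (\<phi> c / c) * (ennreal (dens r x) * ennreal (exp (- c * x))) \<partial>lborel)"
        by (intro nn_integral_cong) (simp only: shift mult.left_commute)
      also have "\<dots> = ennreal (\<phi> c / c) * ennreal (exp (- r * \<phi> c))"
        using that c by (subst nn_integral_cmult) (auto simp: nn_integral_laplace_dens[of r c, simplified])
      finally show ?thesis .
    qed
    then show "(\<integral>\<^sup>+\<tau>. ennreal (exp (- c * \<tau>)) * (q \<tau> r * indicator {R<..} r) \<partial>lborel) =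
        ennreal (\<phi> c / c) * ennreal (exp (- r * \<phi> c)) * indicator {R<..} r"
      using R by (auto split: split_indicator)
  qed
  also have "\<dots> = (\<integral>\<^sup>+r. ennreal (\<phi> c / c) * (ennreal (exp (- \<phi> c * r)) * indicator {R..} r) \<partial>lborel)"
    using AE_lborel_singleton[of R]
    by (intro nn_integral_cong_AE, eventually_elim) (auto split: split_indicator simp: mult.commute)
  also have "\<dots> = ennreal (\<phi> c / c) * ennreal (exp (- \<phi> c * R) / \<phi> c)"
    by (subst nn_integral_cmult) (auto simp: nn_integral_exp_Ici[OF phi_pos[OF c], simplified])
  also have "\<dots> = ennreal (exp (- R * \<phi> c) / c)"
    using c phi_pos[OF c] by (simp add: ennreal_mult[symmetric] mult.commute)
  finally show ?thesis .
qed

section \<open>Distribution functions of \<open>S\<close> and comparison of Laplace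
  transforms\<close>

lemma measurable_indicator_S:
  assumes "0 \<le> R" and [measurable]: "f \<in> N \<rightarrow>\<^sub>M M" "g \<in> borel_measurable N"
  shows "(\<lambda>x. indicator {S R (f x)..} (g x) :: ennreal) \<in> borel_measurable N"
proof -
  have [measurable]: "S R \<in> borel_measurable M" using assms(1) by simp
  show ?thesis unfolding indicator_def atLeast_iff by measurable
qed

lemma emeasure_S_le_eq: "0 \<le> R \<Longrightarrow> emeasure M {\<omega>\<in>space M. S R \<omega> \<le> t} = (\<integral>\<^sup>+\<omega>. indicator {S R \<omega>..} t \<partial>M)"
proof -
  assume "0 \<le> R"
  then have "emeasure M {\<omega>\<in>space M. S R \<omega> \<le> t} = (\<integral>\<^sup>+\<omega>. indicator {\<omega>\<in>space M. S R \<omega> \<le> t} \<omega> \<partial>M)"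
    by (intro nn_integral_indicator[symmetric]) measurable
  also have "\<dots> = (\<integral>\<^sup>+\<omega>. indicator {S R \<omega>..} t \<partial>M)"
    by (intro nn_integral_cong) (auto split: split_indicator)
  finally show ?thesis .
qed

lemma nn_integral_laplace_cdf:
  assumes c: "0 < c" and R: "0 \<le> R"
  shows "(\<integral>\<^sup>+\<tau>\<in>{0<..}. ennreal (exp (- c * \<tau>)) * emeasure M {\<omega>\<in>space M. S R \<omega> \<le> \<tau>} \<partial>lborel) =
     ennreal (exp (- R * \<phi> c) / c)"
proof -
  interpret pair_sigma_finite M lborel ..
  have "(\<integral>\<^sup>+\<tau>\<in>{0<..}. ennreal (exp (- c * \<tau>)) * emeasure M {\<omega>\<in>space M. S R \<omega> \<le> \<tau>} \<partial>lborel) =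
      (\<integral>\<^sup>+\<tau>. \<integral>\<^sup>+\<omega>. ennreal (exp (- c * \<tau>)) * indicator {0<..} \<tau> * indicator {S R \<omega>..} \<tau> \<partial>M \<partial>lborel)"
    using R by (intro nn_integral_cong) (auto simp: nn_integral_cmult measurable_indicator_S emeasure_S_le_eq split: split_indicator)
  also have "\<dots> = (\<integral>\<^sup>+\<omega>. \<integral>\<^sup>+\<tau>. ennreal (exp (- c * \<tau>)) * indicator {0<..} \<tau> * indicator {S R \<omega>..} \<tau> \<partial>lborel \<partial>M)"
    using R by (intro Fubini') (auto simp: split_beta' intro!: borel_measurable_times_ennreal measurable_indicator_S)
  also have "\<dots> = (\<integral>\<^sup>+\<omega>. \<integral>\<^sup>+\<tau>. ennreal (exp (- c * \<tau>)) * indicator {S R \<omega>..} \<tau> \<partial>lborel \<partial>M)"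
  proof (rule nn_integral_cong, rule nn_integral_cong_AE)
    fix \<omega> assume \<omega>: "\<omega> \<in> space M"
    show "AE \<tau> in lborel. ennreal (exp (- c * \<tau>)) * indicator {0<..} \<tau> * indicator {S R \<omega>..} \<tau> =
       ennreal (exp (- c * \<tau>)) * indicator {S R \<omega>..} \<tau>"
      using AE_lborel_singleton[of 0]
      by eventually_elim (use S_nonneg[OF \<omega> R] in \<open>auto split: split_indicator\<close>)
  qed
  also have "\<dots> = (\<integral>\<^sup>+\<omega>. ennreal (1 / c) * ennreal (exp (- c * S R \<omega>)) \<partial>M)"
    using c by (intro nn_integral_cong) (simp add: nn_integral_exp_Ici[OF c, simplified] ennreal_mult[symmetric])
  also have "\<dots> = ennreal (exp (- R * \<phi> c) / c)"
    using c R nn_integral_laplace[of R c] by (subst nn_integral_cmult) (auto simp: ennreal_mult[symmetric])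
  finally show ?thesis .
qed

text \<open>For each \<open>R\<close> the two sides have equal Laplace transforms in
  \<open>\<tau>\<close>, so they agree outside a null set depending on \<open>R\<close>. Restricting
  to rational \<open>R\<close> gives one null set for all; right-continuity recovers the other
  \<open>R\<close> in \<open>distr_X_AE\<close>.\<close>

lemma AE_tail_eq:
  "AE \<tau> in lborel. 0 < \<tau> \<longrightarrow> (\<forall>R\<in>\<rat> \<inter> {0..}.
     emeasure M {\<omega>\<in>space M. S R \<omega> \<le> \<tau>} = (\<integral>\<^sup>+r\<in>{R<..}. q \<tau> r \<partial>lborel))"
proof -
  have "AE \<tau> in lborel. 0 < \<tau> \<longrightarrow>
     emeasure M {\<omega>\<in>space M. S R \<omega> \<le> \<tau>} = (\<integral>\<^sup>+r\<in>{R<..}. q \<tau> r \<partial>lborel)" if R: "0 \<le> R" for R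
  proof (rule laplace_unique_AE)
    show "(\<lambda>\<tau>. emeasure M {\<omega>\<in>space M. S R \<omega> \<le> \<tau>}) \<in> borel_measurable borel"
      unfolding emeasure_S_le_eq[OF R] using R
      by (intro borel_measurable_nn_integral) (auto simp: split_beta' intro!: measurable_indicator_S)
    show "(\<lambda>\<tau>. \<integral>\<^sup>+r\<in>{R<..}. q \<tau> r \<partial>lborel) \<in> borel_measurable borel"
      by measurable
    show "(\<integral>\<^sup>+\<tau>\<in>{0<..}. ennreal (exp (- \<tau>)) * emeasure M {\<omega>\<in>space M. S R \<omega> \<le> \<tau>} \<partial>lborel) =
       ennreal (exp (- R * \<phi> 1))"
      using nn_integral_laplace_cdf[of 1 R] R by simp
  qed (use nn_integral_laplace_cdf nn_integral_laplace_q R in simp_all)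
  then have "AE \<tau> in lborel. \<forall>R\<in>\<rat> \<inter> {0..}. 0 < \<tau> \<longrightarrow>
     emeasure M {\<omega>\<in>space M. S R \<omega> \<le> \<tau>} = (\<integral>\<^sup>+r\<in>{R<..}. q \<tau> r \<partial>lborel)"
    by (subst AE_ball_countable) (auto simp: countable_rat)
  then show ?thesis by eventually_elim auto
qed

text \<open>Exponential Markov inequality at rate 1. The decay in \<open>r\<close> makes
  \<open>S\<close> tend to infinity almost surely and makes the distribution functions integrable in
  \<open>r\<close>.\<close>

lemma emeasure_S_le_bound:
  assumes "0 \<le> r"
  shows "emeasure M {\<omega>\<in>space M. S r \<omega> \<le> t} \<le> ennreal (exp t * exp (- r * \<phi> 1))"
proof -
  have "emeasure M {\<omega>\<in>space M. S r \<omega> \<le> t} = (\<integral>\<^sup>+\<omega>. indicator {S r \<omega>..} t \<partial>M)"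
    using assms by (rule emeasure_S_le_eq)
  also have "\<dots> \<le> (\<integral>\<^sup>+\<omega>. ennreal (exp t) * ennreal (exp (- 1 * S r \<omega>)) \<partial>M)"
    by (intro nn_integral_mono) (auto simp: ennreal_mult[symmetric] mult_exp_exp split: split_indicator)
  also have "\<dots> = ennreal (exp t * exp (- r * \<phi> 1))"
    using assms nn_integral_laplace[of r 1] by (subst nn_integral_cmult) (auto simp: ennreal_mult[symmetric])
  finally show ?thesis .
qed

lemma AE_S_unbounded: "AE \<omega> in M. \<forall>t. \<exists>n::nat. t < S (real n) \<omega>"
proof -
  have "AE \<omega> in M. \<exists>n::nat. real m < S (real n) \<omega>" for m :: nat
  proof (rule AE_I)
    let ?N = "{\<omega>\<in>space M. \<forall>n::nat. S (real n) \<omega> \<le> real m}"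
    show "{\<omega> \<in> space M. \<not> (\<exists>n::nat. real m < S (real n) \<omega>)} \<subseteq> ?N" by (auto simp: not_less)
    show "?N \<in> sets M" by measurable
    have "(\<lambda>n. ennreal (exp m * exp (- real n * \<phi> 1))) \<longlonglongrightarrow> ennreal (exp m * 0)"
    proof (intro tendsto_ennrealI tendsto_mult tendsto_const)
      have "(\<lambda>n. exp (- \<phi> 1) ^ n) \<longlonglongrightarrow> 0"
        using phi_pos[of 1] by (intro LIMSEQ_power_zero) simp
      then show "(\<lambda>n. exp (- real n * \<phi> 1)) \<longlonglongrightarrow> 0"
        by (simp add: exp_of_nat_mult[symmetric])
    qed
    moreover have "emeasure M ?N \<le> ennreal (exp m * exp (- real n * \<phi> 1))" for n
      by (rule order_trans[OF _ emeasure_S_le_bound]) (auto intro!: emeasure_mono)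
    ultimately have "emeasure M ?N \<le> ennreal (exp m * 0)"
      by (intro LIMSEQ_le_const) auto
    then show "emeasure M ?N = 0" by simp
  qed
  then have "AE \<omega> in M. \<forall>m::nat. \<exists>n::nat. real m < S (real n) \<omega>"
    by (simp add: AE_all_countable)
  then show ?thesis
  proof eventually_elim
    case (elim \<omega>)
    show ?case
    proof
      fix t
      obtain m :: nat where "t < real m" using reals_Archimedean2 by blast
      then show "\<exists>n::nat. t < S (real n) \<omega>" using elim by (meson less_trans)
    qed
  qed
qed

section \<open>The inverse subordinator\<close>

text \<open>The process \<open>E\<close> of the statement. The maximum only matters on the null event where the set
  defining the infimum is empty.\<close>

definition X :: "real \<Rightarrow> 'w \<Rightarrow> real" where
  "X t \<omega> = max 0 (inverse_subordinator S t \<omega>)"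

lemma X_nonneg: "0 \<le> X t \<omega>" by (simp add: X_def)

lemma level_set_empty_iff:
  assumes \<omega>: "\<omega> \<in> space M" and t: "0 \<le> t"
  shows "{s. 0 < s \<and> t < S s \<omega>} = {} \<longleftrightarrow> (\<forall>n::nat. S (real n) \<omega> \<le> t)"
proof
  assume e: "{s. 0 < s \<and> t < S s \<omega>} = {}"
  show "\<forall>n::nat. S (real n) \<omega> \<le> t"
  proof
    fix n :: nat
    have "real n \<notin> {s. 0 < s \<and> t < S s \<omega>}" using e by blast
    then show "S (real n) \<omega> \<le> t" using S_0[OF \<omega>] t by (cases "n = 0") auto
  qed
next
  assume le: "\<forall>n::nat. S (real n) \<omega> \<le> t"
  have "S r \<omega> \<le> t" if "0 < r" for r
  proof -
    obtain n :: nat where "r < real n" using reals_Archimedean2 by blast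
    then have "S r \<omega> \<le> S (real n) \<omega>" using S_mono[OF \<omega>, of r "real n"] that by simp
    then show ?thesis using le order_trans by blast
  qed
  then show "{s. 0 < s \<and> t < S s \<omega>} = {}" using leD by blast
qed

lemma inverse_subordinator_nonneg:
  assumes "{s. 0 < s \<and> t < S s \<omega>} \<noteq> {}" shows "0 \<le> inverse_subordinator S t \<omega>"
  unfolding inverse_subordinator_def using assms by (rule cInf_greatest) simp

text \<open>Isolates the event where the infimum is over the empty set. There the inverse takes a
  constant value, possibly negative, at which \<open>P\<close> is unspecified; elsewhere it is
  \<open>X\<close>. Measurability can thus be shown by cases.\<close>

lemma inverse_subordinator_cases:
  assumes "\<omega> \<in> space M" "0 \<le> t"
  shows "inverse_subordinator S t \<omega> = (if \<forall>n::nat. S (real n) \<omega> \<le> t then Inf {} else X t \<omega>)"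
proof (cases "{s. 0 < s \<and> t < S s \<omega>} = {}")
  case True
  then have "inverse_subordinator S t \<omega> = Inf {}"
    unfolding inverse_subordinator_def by (rule arg_cong)
  moreover have "\<forall>n::nat. S (real n) \<omega> \<le> t"
    using True level_set_empty_iff[OF assms] by blast
  ultimately show ?thesis by (simp only: simp_thms if_True)
next
  case False
  then show ?thesis
    unfolding level_set_empty_iff[OF assms] if_not_P[OF False[unfolded level_set_empty_iff[OF assms]]] X_def
    using inverse_subordinator_nonneg[OF False] by simp
qed

lemma S_le_imp_le_X:
  assumes \<omega>: "\<omega> \<in> space M" and unbounded: "\<forall>t. \<exists>n::nat. t < S (real n) \<omega>"
    and st: "0 \<le> s" "0 \<le> t" "S s \<omega> \<le> t"
  shows "s \<le> X t \<omega>"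
proof -
  have "{s. 0 < s \<and> t < S s \<omega>} \<noteq> {}"
    unfolding level_set_empty_iff[OF \<omega> st(2)] using unbounded by (simp add: not_le)
  then have "s \<le> Inf {s. 0 < s \<and> t < S s \<omega>}"
  proof (rule cInf_greatest)
    fix r assume r: "r \<in> {s. 0 < s \<and> t < S s \<omega>}"
    show "s \<le> r"
      using S_mono[OF \<omega>, of r s] r st by (cases "s \<le> r") auto
  qed
  then show ?thesis by (simp add: X_def inverse_subordinator_def)
qed

lemma less_S_imp_X_le:
  assumes "0 < s" "t < S s \<omega>" shows "X t \<omega> \<le> s"
proof -
  have "Inf {s. 0 < s \<and> t < S s \<omega>} \<le> s"
    using assms by (intro cInf_lower) (auto intro!: bdd_belowI[of _ 0])
  then show ?thesis using assms by (simp add: X_def inverse_subordinator_def)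
qed

text \<open>Monotone paths allow rational times to witness \<open>X t \<omega> < s\<close>, so that
  the event is a countable union.\<close>

lemma measurable_X [measurable]:
  assumes t: "0 \<le> t" shows "X t \<in> borel_measurable M"
proof (rule borel_measurable_iff_less[THEN iffD2], intro allI)
  fix s :: real
  let ?e = "\<lambda>\<omega>. \<forall>n::nat. S (real n) \<omega> \<le> t"
  have "X t \<omega> < s \<longleftrightarrow> 0 < s \<and> ((\<exists>q\<in>{q\<in>\<rat>. 0 < q \<and> q < s}. t < S q \<omega>) \<or> ?e \<omega> \<and> Inf {} < s)"
    if \<omega>: "\<omega> \<in> space M" for \<omega>
  proof (cases "{s. 0 < s \<and> t < S s \<omega>} = {}")
    case True
    then have "X t \<omega> = max 0 (Inf {})"
      unfolding X_def inverse_subordinator_def by (intro arg_cong[where f="max 0"] arg_cong[where f=Inf])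
    then show ?thesis using True level_set_empty_iff[OF \<omega> t] by auto
  next
    case False
    let ?A = "{s. 0 < s \<and> t < S s \<omega>}"
    note ne = False
    have bdd: "bdd_below ?A" by (auto intro!: bdd_belowI[of _ 0])
    have X: "X t \<omega> = Inf ?A"
      using cInf_greatest[OF ne, of 0] by (auto simp: X_def inverse_subordinator_def)
    have "X t \<omega> < s \<longleftrightarrow> (\<exists>r. 0 < r \<and> r < s \<and> t < S r \<omega>)"
      unfolding X using cInf_less_iff[OF ne bdd] by auto
    also have "\<dots> \<longleftrightarrow> (\<exists>q\<in>{q\<in>\<rat>. 0 < q \<and> q < s}. t < S q \<omega>)"
    proof
      assume "\<exists>r. 0 < r \<and> r < s \<and> t < S r \<omega>"
      then obtain r where r: "0 < r" "r < s" "t < S r \<omega>" by blast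
      obtain q where q: "q \<in> \<rat>" "r < q" "q < s" using Rats_dense_in_real[OF r(2)] by blast
      then have "t < S q \<omega>" using r S_mono[OF \<omega>, of r q] by linarith
      then show "\<exists>q\<in>{q\<in>\<rat>. 0 < q \<and> q < s}. t < S q \<omega>" using q r by force
    qed auto
    finally have "X t \<omega> < s \<longleftrightarrow> (\<exists>q\<in>{q\<in>\<rat>. 0 < q \<and> q < s}. t < S q \<omega>)" .
    moreover have "\<not> ?e \<omega>" using ne level_set_empty_iff[OF \<omega> t] by blast
    ultimately show ?thesis by auto
  qed
  then have eq: "{\<omega>\<in>space M. X t \<omega> < s} =
      {\<omega>\<in>space M. 0 < s \<and> ((\<exists>q\<in>{q\<in>\<rat>. 0 < q \<and> q < s}. t < S q \<omega>) \<or> ?e \<omega> \<and> Inf {} < s)}"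
    by auto
  have c: "countable {q\<in>\<rat>. 0 < q \<and> q < s}"
    by (rule countable_subset[OF _ countable_rat]) auto
  have "{\<omega>\<in>space M. \<exists>q\<in>{q\<in>\<rat>. 0 < q \<and> q < s}. t < S q \<omega>} \<in> sets M"
  proof -
    have "{\<omega>\<in>space M. \<exists>q\<in>{q\<in>\<rat>. 0 < q \<and> q < s}. t < S q \<omega>} =
        (\<Union>q\<in>{q\<in>\<rat>. 0 < q \<and> q < s}. {\<omega>\<in>space M. t < S q \<omega>})"
      by auto
    also have "\<dots> \<in> sets M"
      by (intro sets.countable_UN'[OF c]) auto
    finally show ?thesis .
  qed
  moreover have "{\<omega>\<in>space M. ?e \<omega>} \<in> sets M" by measurable
  ultimately show "{\<omega>\<in>space M. X t \<omega> < s} \<in> sets M"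
    unfolding eq by (intro sets.sets_Collect) auto
qed

lemma AE_X_eq: "0 \<le> t \<Longrightarrow> AE \<omega> in M. inverse_subordinator S t \<omega> = X t \<omega>"
  using AE_S_unbounded AE_space
proof eventually_elim
  case (elim \<omega>)
  then have "\<not> (\<forall>n::nat. S (real n) \<omega> \<le> t)" by (meson not_le)
  then show ?case using inverse_subordinator_cases[of \<omega> t] elim by (simp only: if_False simp_thms)
qed

text \<open>If \<open>S R \<omega> < t\<close>, right-continuity keeps \<open>S\<close> below
  \<open>t\<close> for a while after \<open>R\<close>, so \<open>R < X t \<omega>\<close>; if
  \<open>S R \<omega> > t\<close>, the infimum is at most \<open>R\<close>. The boundary case
  \<open>S R \<omega> = t\<close> is a null event, so this holds at every
  \<open>t > 0\<close>.\<close>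

lemma emeasure_X_gt:
  assumes t: "0 < t" and R: "0 \<le> R"
  shows "emeasure M {\<omega>\<in>space M. R < X t \<omega>} = emeasure M {\<omega>\<in>space M. S R \<omega> \<le> t}"
proof (rule emeasure_eq_AE)
  have neq: "AE \<omega> in M. S R \<omega> \<noteq> t"
    using AE_S_neq[of R t] AE_space t R S_0 by (cases "R = 0") auto
  show "AE \<omega> in M. \<omega> \<in> {\<omega>\<in>space M. R < X t \<omega>} \<longleftrightarrow> \<omega> \<in> {\<omega>\<in>space M. S R \<omega> \<le> t}"
    using AE_S_unbounded AE_space neq
  proof eventually_elim
    case (elim \<omega>)
    have "R < X t \<omega>" if "S R \<omega> < t"
    proof -
      have "eventually (\<lambda>s. S s \<omega> < t) (at_right R)"
        using S_right_cont[of \<omega> R] elim R that by (auto dest: order_tendstoD)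
      then obtain b where b: "R < b" "\<And>s. R < s \<Longrightarrow> s < b \<Longrightarrow> S s \<omega> < t"
        by (auto simp: eventually_at_right_field)
      define s where "s = (R + b) / 2"
      have "R < s" "S s \<omega> \<le> t" using b(2)[of s] b(1) by (auto simp: s_def)
      then show ?thesis using S_le_imp_le_X[of \<omega> s t] elim t R by auto
    qed
    moreover have "S R \<omega> \<le> t" if "R < X t \<omega>"
    proof (rule ccontr)
      assume "\<not> S R \<omega> \<le> t"
      then show False
        using less_S_imp_X_le[of R t \<omega>] S_0[of \<omega>] that t R elim by (cases "R = 0") auto
    qed
    ultimately show ?case using elim by force
  qed
qed (use t R in auto)

text \<open>The tails agree at rational points by \<open>AE_tail_eq\<close>; approaching a real
  point from the right through rationals identifies the two distribution functions everywhere. The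
  exceptional null set of times is harmless, as the law enters the equation only under a time
  integral.\<close>

lemma distr_X_AE:
  "AE \<tau> in lborel. 0 < \<tau> \<longrightarrow> distr M borel (X \<tau>) = density lborel (q \<tau>)"
  using AE_tail_eq
proof eventually_elim
  case (elim \<tau>)
  show ?case
  proof
    assume \<tau>: "0 < \<tau>"
    have X [measurable]: "X \<tau> \<in> borel_measurable M" using \<tau> by simp
    define N\<^sub>1 where "N\<^sub>1 = distr M borel (X \<tau>)"
    define N\<^sub>2 where "N\<^sub>2 = density lborel (q \<tau>)"
    have tail1: "emeasure N\<^sub>1 {R<..} = emeasure M {\<omega>\<in>space M. S R \<omega> \<le> \<tau>}" if "0 \<le> R" for R
      using emeasure_X_gt[OF \<tau> that] by (simp add: N\<^sub>1_def emeasure_distr vimage_def Int_def conj_commute)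
    have tail2: "emeasure N\<^sub>2 {R<..} = emeasure M {\<omega>\<in>space M. S R \<omega> \<le> \<tau>}" if "0 \<le> R" "R \<in> \<rat>" for R
      using elim \<tau> that by (simp add: N\<^sub>2_def emeasure_density)
    have neg1: "emeasure N\<^sub>1 {..R} = 0" if "R < 0" for R
    proof -
      have "X \<tau> -` {..R} \<inter> space M = {}"
        using X_nonneg[of \<tau>] that by (force dest: order_trans)
      then show ?thesis by (simp add: N\<^sub>1_def emeasure_distr)
    qed
    have neg2: "emeasure N\<^sub>2 {..R} = 0" if "R < 0" for R
      using that by (auto simp: N\<^sub>2_def emeasure_density nn_integral_0_iff_AE q_eq_0 split: split_indicator)
    interpret N1: prob_space N\<^sub>1 unfolding N\<^sub>1_def by (rule prob_space_distr) simp
    \<comment> \<open>The tail identity at \<open>R = 0\<close> compares with the sure event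
      \<open>S 0 \<omega> \<le> \<tau>\<close>, so \<open>q \<tau>\<close> has total mass 1 without
      a further computation.\<close>
    have "emeasure N\<^sub>2 (space N\<^sub>2) = emeasure N\<^sub>2 {0<..}"
      by (auto simp: N\<^sub>2_def emeasure_density q_eq_0 intro!: nn_integral_cong split: split_indicator)
    also have "\<dots> = emeasure M (space M)"
      using tail2[of 0] S_0 \<tau> by (auto intro!: arg_cong[where f="emeasure M"])
    finally interpret N2: prob_space N\<^sub>2
      by (intro prob_spaceI) (simp add: emeasure_space_1)
    have rd: "real_distribution N\<^sub>1" "real_distribution N\<^sub>2"
      by (rule real_distribution.intro[OF N1.prob_space_axioms], simp add: real_distribution_axioms_def N\<^sub>1_def)
        (rule real_distribution.intro[OF N2.prob_space_axioms], simp add: real_distribution_axioms_def N\<^sub>2_def)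
    interpret R1: real_distribution N\<^sub>1 by (fact rd)
    interpret R2: real_distribution N\<^sub>2 by (fact rd)
    have rat: "cdf N\<^sub>1 R = cdf N\<^sub>2 R" if "R \<in> \<rat>" for R
    proof (cases "R < 0")
      case True
      then show ?thesis using neg1 neg2 by (simp add: cdf_def measure_def)
    next
      case False
      have eq: "measure N\<^sub>1 {R<..} = measure N\<^sub>2 {R<..}"
        using tail1[of R] tail2[of R] that False by (simp add: measure_def)
      have "- {R<..} = {..R}" by auto
      then have "measure N\<^sub>1 {..R} = 1 - measure N\<^sub>1 {R<..}" "measure N\<^sub>2 {..R} = 1 - measure N\<^sub>2 {R<..}"
        using N1.prob_compl[of "{R<..}"] N2.prob_compl[of "{R<..}"] by (simp_all add: Compl_eq_Diff_UNIV)
      then show ?thesis using eq by (simp add: cdf_def)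
    qed
    have "cdf N\<^sub>1 x = cdf N\<^sub>2 x" for x
    proof -
      have "\<exists>r\<in>\<rat>. x < r \<and> r < x + inverse (real (Suc n))" for n
        using Rats_dense_in_real[of x "x + inverse (real (Suc n))"] by auto
      then obtain r where r: "\<And>n. r n \<in> \<rat>" "\<And>n. x < r n" "\<And>n. r n < x + inverse (real (Suc n))"
        by metis
      have "r \<longlonglongrightarrow> x"
      proof (rule tendsto_sandwich[where f="\<lambda>_. x" and h="\<lambda>n. x + inverse (real (Suc n))"])
        show "(\<lambda>n. x + inverse (real (Suc n))) \<longlonglongrightarrow> x"
          using tendsto_add[OF tendsto_const LIMSEQ_inverse_real_of_nat, of x] by simp
      qed (use r in \<open>simp_all add: less_imp_le del: of_nat_Suc\<close>)
      then have lim: "filterlim r (at_right x) sequentially"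
        using r(2) by (auto simp: filterlim_at intro!: always_eventually)
      have "(\<lambda>n. cdf N\<^sub>1 (r n)) \<longlonglongrightarrow> cdf N\<^sub>1 x"
        using R1.cdf_is_right_cont[of x] lim by (auto simp: continuous_within intro: filterlim_compose)
      moreover have "(\<lambda>n. cdf N\<^sub>2 (r n)) \<longlonglongrightarrow> cdf N\<^sub>2 x"
        using R2.cdf_is_right_cont[of x] lim by (auto simp: continuous_within intro: filterlim_compose)
      ultimately show ?thesis
        using rat[OF r(1)] LIMSEQ_unique by simp
    qed
    then show "distr M borel (X \<tau>) = density lborel (q \<tau>)"
      using cdf_unique[OF rd] by (auto simp: N\<^sub>1_def N\<^sub>2_def)
  qed
qed

text \<open>A jump of the inverse at \<open>t\<close> is a flat stretch of the path of
  \<open>S\<close> at level \<open>t\<close>. Such a stretch would contain a rational time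
  \<open>s\<close> with \<open>S s \<omega> = t\<close>, which is excluded almost surely for
  countably many \<open>s\<close> at once.\<close>

lemma AE_X_continuous:
  assumes t: "0 \<le> t"
  shows "AE \<omega> in M. ((\<lambda>s. X s \<omega>) \<longlongrightarrow> X t \<omega>) (at t within {0..})"
proof -
  have "AE \<omega> in M. \<forall>s\<in>\<rat> \<inter> {0<..}. S s \<omega> \<noteq> t"
    using AE_S_neq by (subst AE_ball_countable) (auto simp: countable_rat)
  then show ?thesis using AE_S_unbounded AE_space
  proof eventually_elim
    case (elim \<omega>)
    show ?case
    proof (rule order_tendstoI)
      fix a assume a: "a < X t \<omega>"
      show "eventually (\<lambda>s. a < X s \<omega>) (at t within {0..})"
      proof (cases "a < 0")
        case True
        then show ?thesis using less_le_trans[OF True X_nonneg] by (simp add: always_eventually)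
      next
        case False
        obtain r where r: "r \<in> \<rat>" "a < r" "r < X t \<omega>" using Rats_dense_in_real[OF a] by blast
        then have "\<not> t < S r \<omega>" using less_S_imp_X_le[of r t \<omega>] False by auto
        then have "S r \<omega> < t" using elim(1) r False by force
        then have "eventually (\<lambda>s. S r \<omega> < s) (at t within {0..})"
          by (rule order_tendstoD(1)[OF tendsto_ident_at])
        moreover have "eventually (\<lambda>s. 0 \<le> s) (at t within {0..})"
          by (auto simp: eventually_at_filter)
        ultimately show ?thesis
        proof eventually_elim
          case (elim s)
          then show ?case using S_le_imp_le_X[of \<omega> r s] False r \<open>\<omega> \<in> space M\<close>
              \<open>\<forall>t. \<exists>n::nat. t < S (real n) \<omega>\<close> by auto
        qed
      qed
    next
      fix a assume a: "X t \<omega> < a"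
      obtain r where r: "r \<in> \<rat>" "X t \<omega> < r" "r < a" using Rats_dense_in_real[OF a] by blast
      have r0: "0 < r" using X_nonneg[of t \<omega>] r by linarith
      have "\<not> S r \<omega> \<le> t" using S_le_imp_le_X[of \<omega> r t] r r0 elim t by auto
      then have "eventually (\<lambda>s. s < S r \<omega>) (at t within {0..})"
        by (intro order_tendstoD(2)[OF tendsto_ident_at]) simp
      then show "eventually (\<lambda>s. X s \<omega> < a) (at t within {0..})"
        by eventually_elim (use less_S_imp_X_le[OF r0] r in \<open>auto intro: le_less_trans\<close>)
    qed
  qed
qed

lemma AE_X_0: "AE \<omega> in M. X 0 \<omega> = 0"
proof -
  have "AE \<omega> in M. \<forall>n::nat. S (inverse (real (Suc n))) \<omega> \<noteq> 0"
    using AE_S_neq by (simp add: AE_all_countable del: of_nat_Suc)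
  then show ?thesis using AE_space
  proof eventually_elim
    case (elim \<omega>)
    have "X 0 \<omega> \<le> inverse (real (Suc n))" for n
      using elim S_nonneg[of \<omega> "inverse (real (Suc n))"]
      by (intro less_S_imp_X_le) (auto simp: less_le simp del: of_nat_Suc)
    then have "X 0 \<omega> \<le> 0"
      by (intro LIMSEQ_le_const[OF LIMSEQ_inverse_real_of_nat]) auto
    then show ?case using X_nonneg[of 0 \<omega>] by simp
  qed
qed

text \<open>The constant comes from Markov's inequality for \<open>1 - exp (- S R / a)\<close>.\<close>

lemma emeasure_X_le:
  assumes a: "0 < a" "a \<le> t" and R: "0 \<le> R"
  shows "emeasure M {\<omega>\<in>space M. X t \<omega> \<le> R} \<le> ennreal (\<phi> (1 / a) / (1 - exp (- 1))) * ennreal R"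
proof -
  have c0: "0 < 1 - exp (- 1 :: real)" by simp
  have [measurable]: "X t \<in> borel_measurable M" using a by simp
  have [measurable]: "S R \<in> borel_measurable M" using R by simp
  have int: "integrable M (\<lambda>\<omega>. exp (- (1 / a) * S R \<omega>))"
    using S_nonneg a R by (intro integrable_const_bound[where B=1]) auto
  have "emeasure M {\<omega>\<in>space M. X t \<omega> \<le> R} = 1 - emeasure M {\<omega>\<in>space M. R < X t \<omega>}"
  proof -
    have "{\<omega>\<in>space M. X t \<omega> \<le> R} = space M - {\<omega>\<in>space M. R < X t \<omega>}" by auto
    then show ?thesis by (simp add: emeasure_compl emeasure_space_1)
  qed
  also have "\<dots> = 1 - emeasure M {\<omega>\<in>space M. S R \<omega> \<le> t}"
    using a R by (simp add: emeasure_X_gt)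
  also have "\<dots> = emeasure M {\<omega>\<in>space M. t < S R \<omega>}"
  proof -
    have "{\<omega>\<in>space M. t < S R \<omega>} = space M - {\<omega>\<in>space M. S R \<omega> \<le> t}" by auto
    then show ?thesis by (simp add: emeasure_compl emeasure_space_1)
  qed
  also have "\<dots> = ennreal (prob {\<omega>\<in>space M. t < S R \<omega>})" by (rule emeasure_eq_measure)
  \<comment> \<open>On \<open>t < S R \<omega>\<close> the quotient \<open>S R \<omega> / a\<close>
    exceeds 1 because \<open>a \<le> t\<close>. Using \<open>a\<close> instead of \<open>t\<close>
    gives one constant for all \<open>t \<ge> a\<close>, which the continuity of
    \<open>L (Q t h)\<close> in \<open>t\<close> needs.\<close>
  also have "prob {\<omega>\<in>space M. t < S R \<omega>} \<le> prob {\<omega>\<in>space M. 1 - exp (- 1) \<le> 1 - exp (- (1 / a) * S R \<omega>)}"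
    using a by (intro finite_measure_mono) (auto simp: field_simps)
  also have "\<dots> \<le> (\<integral>\<omega>. 1 - exp (- (1 / a) * S R \<omega>) \<partial>M) / (1 - exp (- 1))"
    using int c0 S_nonneg a R by (intro integral_Markov_inequality_measure[where A="{}"]) auto
  also have "(\<integral>\<omega>. 1 - exp (- (1 / a) * S R \<omega>) \<partial>M) = 1 - exp (- R * \<phi> (1 / a))"
  proof -
    have "(\<integral>\<omega>. exp (- (1 / a) * S R \<omega>) \<partial>M) = exp (- R * \<phi> (1 / a))"
    proof -
      have "\<forall>t\<ge>0. \<forall>c\<ge>0. (\<integral>\<omega>. exp (- c * S t \<omega>) \<partial>M) = exp (- t * \<phi> c)"
        using driftless unfolding driftless_subordinator_def \<phi>_def by blast
      from this[rule_format, of R "1 / a"] show ?thesis using a R by simp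
    qed
    then show ?thesis using int by (simp add: prob_space)
  qed
  also have "1 - exp (- R * \<phi> (1 / a)) \<le> R * \<phi> (1 / a)"
    using exp_ge_add_one_self[of "- R * \<phi> (1 / a)"] by simp
  finally have "emeasure M {\<omega>\<in>space M. X t \<omega> \<le> R} \<le> ennreal (R * \<phi> (1 / a) / (1 - exp (- 1)))"
    using c0 by (simp add: divide_right_mono ennreal_leI)
  also have "\<dots> = ennreal (\<phi> (1 / a) / (1 - exp (- 1))) * ennreal R"
    using R c0 phi_pos[of "1 / a"] a by (simp add: ennreal_mult[symmetric] mult.commute)
  finally show ?thesis .
qed

section \<open>Distribution functions of \<open>S\<close> as weights in the semigroup time
  \<open>r\<close>\<close>

abbreviation cdfS :: "real \<Rightarrow> real \<Rightarrow> real" where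
  "cdfS r t \<equiv> measure M {\<omega>\<in>space M. S r \<omega> \<le> t}"

lemma nn_integral_dens_reflect:
  assumes "0 < r"
  shows "(\<integral>\<^sup>+s\<in>{0<..}. ennreal (dens r (t - s)) \<partial>lborel) = ennreal (cdfS r t)"
proof -
  have "(\<integral>\<^sup>+s\<in>{0<..}. ennreal (dens r (t - s)) \<partial>lborel) =
      (\<integral>\<^sup>+x. ennreal (dens r x) * indicator {..<t} x \<partial>lborel)"
    by (subst nn_integral_real_affine[where c="-1" and t=t]) (auto intro!: nn_integral_cong split: split_indicator)
  also have "\<dots> = (\<integral>\<^sup>+\<omega>. indicator {..<t} (S r \<omega>) \<partial>M)"
    using assms by (simp add: nn_integral_S)
  also have "\<dots> = (\<integral>\<^sup>+\<omega>. indicator {\<omega>\<in>space M. S r \<omega> \<le> t} \<omega> \<partial>M)"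
    using AE_S_neq[OF assms, of t] AE_space
    by (intro nn_integral_cong_AE, eventually_elim) (auto split: split_indicator)
  also have "\<dots> = ennreal (cdfS r t)"
    using assms by (simp add: emeasure_eq_measure)
  finally show ?thesis .
qed

lemma integrable_dens: "integrable lborel (dens r)"
proof (cases "0 < r")
  case True
  then show ?thesis
    using nn_integral_dens[OF True] by (intro integrableI_nonneg) (auto simp: dens_nonneg)
next
  case False
  then have "dens r = (\<lambda>_. 0)" by (auto simp: dens_def)
  then show ?thesis by simp
qed

lemma integral_dens_atMost:
  assumes "0 < r"
  shows "(\<integral>x. indicator {0<..} (t - x) * dens r x \<partial>lborel) = cdfS r t"
proof -
  have "(\<integral>x. indicator {0<..} (t - x) * dens r x \<partial>lborel) =
      enn2real (\<integral>\<^sup>+x. ennreal (indicator {0<..} (t - x) * dens r x) \<partial>lborel)"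
    by (intro integral_eq_nn_integral) (auto simp: dens_nonneg)
  also have "(\<integral>\<^sup>+x. ennreal (indicator {0<..} (t - x) * dens r x) \<partial>lborel) =
      (\<integral>\<^sup>+s\<in>{0<..}. ennreal (dens r (t - s)) \<partial>lborel)"
    by (subst nn_integral_real_affine[where c="-1" and t=t]) (auto intro!: nn_integral_cong split: split_indicator)
  finally show ?thesis using assms by (simp add: nn_integral_dens_reflect)
qed

text \<open>The right-hand side bounds the renewal function \<open>E (X t)\<close>.\<close>

lemma nn_integral_cdfS_le:
  "(\<integral>\<^sup>+r\<in>{0<..}. ennreal (cdfS r t) \<partial>lborel) \<le> ennreal (exp t / \<phi> 1)"
proof -
  have "(\<integral>\<^sup>+r\<in>{0<..}. ennreal (cdfS r t) \<partial>lborel) \<le>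
      (\<integral>\<^sup>+r. ennreal (exp t) * (ennreal (exp (- \<phi> 1 * r)) * indicator {0..} r) \<partial>lborel)"
  proof (intro nn_integral_mono)
    fix r :: real
    show "ennreal (cdfS r t) * indicator {0<..} r \<le> ennreal (exp t) * (ennreal (exp (- \<phi> 1 * r)) * indicator {0..} r)"
      using emeasure_S_le_bound[of r t]
      by (auto simp: emeasure_eq_measure ennreal_mult[symmetric] mult.commute[of r] split: split_indicator)
  qed
  also have "\<dots> = ennreal (exp t / \<phi> 1)"
    using phi_pos[of 1]
    by (subst nn_integral_cmult) (auto simp: nn_integral_exp_Ici[of "\<phi> 1" 0, simplified] ennreal_mult[symmetric])
  finally show ?thesis .
qed

text \<open>Measurability in the time \<open>r\<close> of the process is not visible from the paths;
  it comes from the joint measurability of \<open>dens\<close>, by writing the distribution function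
  as an integral.\<close>

lemma measurable_cdfS:
  "(\<lambda>r. indicator {0<..} r * cdfS r t) \<in> borel_measurable borel"
proof -
  have "(\<lambda>r. enn2real (\<integral>\<^sup>+s\<in>{0<..}. ennreal (dens r (t - s)) \<partial>lborel)) \<in> borel_measurable borel"
    by measurable
  also have "(\<lambda>r. enn2real (\<integral>\<^sup>+s\<in>{0<..}. ennreal (dens r (t - s)) \<partial>lborel)) = (\<lambda>r. indicator {0<..} r * cdfS r t)"
  proof
    fix r
    have "dens r x = 0" if "r \<le> 0" for x using that by (simp add: dens_def)
    then show "enn2real (\<integral>\<^sup>+s\<in>{0<..}. ennreal (dens r (t - s)) \<partial>lborel) = indicator {0<..} r * cdfS r t"
      by (cases "0 < r") (simp_all add: nn_integral_dens_reflect)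
  qed
  finally show ?thesis .
qed

lemma measurable_ennreal_cdfS [measurable]:
  "(\<lambda>r. ennreal (cdfS r t) * indicator {0<..} r) \<in> borel_measurable borel"
proof -
  have "(\<lambda>r. ennreal (indicator {0<..} r * cdfS r t)) \<in> borel_measurable borel"
    using measurable_cdfS[of t] by measurable
  also have "(\<lambda>r. ennreal (indicator {0<..} r * cdfS r t)) = (\<lambda>r. ennreal (cdfS r t) * indicator {0<..} r)"
    by (auto split: split_indicator)
  finally show ?thesis .
qed

lemma integrable_cdfS: "integrable lborel (\<lambda>r. indicator {0<..} r * cdfS r t)"
proof (rule integrableI_nonneg)
  have "(\<integral>\<^sup>+r. ennreal (indicator {0<..} r * cdfS r t) \<partial>lborel) = (\<integral>\<^sup>+r\<in>{0<..}. ennreal (cdfS r t) \<partial>lborel)"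
    by (intro nn_integral_cong) (auto split: split_indicator)
  also have "\<dots> < \<infinity>" using nn_integral_cdfS_le[of t] by (auto intro: le_less_trans)
  finally show "(\<integral>\<^sup>+r. ennreal (indicator {0<..} r * cdfS r t) \<partial>lborel) < \<infinity>" .
qed (auto intro: measurable_cdfS)

lemma cdfS_mono: "0 \<le> r \<Longrightarrow> s \<le> t \<Longrightarrow> cdfS r s \<le> cdfS r t"
  by (intro finite_measure_mono) auto

end

section \<open>The operators of the solution formula\<close>

locale fractional_equation = subordinator_with_density M S \<nu> p + symmetric_contraction_semigroup P D L
  for M :: "'w measure" and S :: "real \<Rightarrow> 'w \<Rightarrow> real" and \<nu> :: "real measure" and p :: "real \<Rightarrow> real \<Rightarrow> real"
    and P :: "real \<Rightarrow> 'h::{real_inner, banach, second_countable_topology} \<Rightarrow> 'h" and D :: "'h set" and L :: "'h \<Rightarrow> 'h"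
begin

text \<open>\<open>P r\<close> is unspecified for negative \<open>r\<close>.\<close>

definition P' :: "real \<Rightarrow> 'h \<Rightarrow> 'h" where "P' r = P (max 0 r)"

lemma P'_eq: "0 \<le> r \<Longrightarrow> P' r = P r" by (simp add: P'_def max_def)

lemma norm_P'_le: "norm (P' r h) \<le> norm h"
  by (simp add: P'_def norm_P_le)

lemma inner_L_P': "x \<in> D \<Longrightarrow> y \<in> D \<Longrightarrow> P' r (L x) \<bullet> y = P' r x \<bullet> L y"
  by (simp add: P'_def inner_L_P)

lemma measurable_P' [measurable (raw)]:
  assumes "f \<in> borel_measurable N" "g \<in> borel_measurable N"
  shows "(\<lambda>x. P' (f x) (g x)) \<in> borel_measurable N"
  unfolding P'_def using assms by (intro measurable_P) auto

text \<open>Borel rather than Lebesgue measurable and bounded everywhere rather than almost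
  everywhere, so that Tonelli on \<open>lborel\<close> applies directly;
  \<open>ex_admissible_version\<close> finds such a version of the given source.\<close>

definition admissible :: "(real \<Rightarrow> 'h) \<Rightarrow> bool" where
  "admissible f \<longleftrightarrow> f \<in> borel_measurable borel \<and> (\<forall>s\<le>0. f s = 0) \<and> (\<exists>K. \<forall>s. norm (f s) \<le> K)"

text \<open>The second term of the solution formula; the constraint \<open>0 < s \<le> t\<close> is built into
  \<open>admissible\<close> and \<open>dens\<close>.\<close>

definition U :: "(real \<Rightarrow> 'h) \<Rightarrow> real \<Rightarrow> 'h" where
  "U f t = (\<integral>s. (\<integral>r. dens r (t - s) *\<^sub>R P' r (f s) \<partial>lborel) \<partial>lborel)"

lemma admissible_measurable: "admissible f \<Longrightarrow> f \<in> borel_measurable borel"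
  by (simp add: admissible_def)

lemma admissible_bound:
  assumes "admissible f"
  obtains K where "0 \<le> K" "\<And>s. norm (f s) \<le> K * indicator {0<..} s"
proof -
  obtain K where K: "\<And>s. norm (f s) \<le> K" using assms by (auto simp: admissible_def)
  have "norm (f s) \<le> K * indicator {0<..} s" for s
    using K[of s] assms by (cases "0 < s") (auto simp: admissible_def)
  moreover have "0 \<le> K" using K[of 0] norm_ge_zero order_trans by blast
  ultimately show ?thesis using that by blast
qed

lemma admissible_const: "admissible (\<lambda>s. indicator {0<..} s *\<^sub>R g)"
  unfolding admissible_def by (auto intro!: exI[of _ "norm g"] split: split_indicator)

lemma nn_integral_norm_U_le:
  assumes "admissible f" and K: "0 \<le> K" "\<And>s. norm (f s) \<le> K * indicator {0<..} s"
  shows "(\<integral>\<^sup>+r. \<integral>\<^sup>+s. ennreal (norm (dens r (t - s) *\<^sub>R P' r (f s))) \<partial>lborel \<partial>lborel)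
     \<le> ennreal K * ennreal (exp t / \<phi> 1)"
    and "0 < r \<Longrightarrow> (\<integral>\<^sup>+s. ennreal (norm (dens r (t - s) *\<^sub>R P' r (f s))) \<partial>lborel) \<le> ennreal (K * cdfS r t)"
proof -
  have le: "norm (dens r (t - s) *\<^sub>R P' r (f s)) \<le> dens r (t - s) * (K * indicator {0<..} s)" for r s
    using norm_P'_le[of r "f s"] K(2)[of s] dens_nonneg[of r "t - s"]
    by (auto intro!: mult_left_mono)
  show *: "(\<integral>\<^sup>+s. ennreal (norm (dens r (t - s) *\<^sub>R P' r (f s))) \<partial>lborel) \<le> ennreal (K * cdfS r t)" if "0 < r" for r
  proof -
    have "(\<integral>\<^sup>+s. ennreal (norm (dens r (t - s) *\<^sub>R P' r (f s))) \<partial>lborel) \<le>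
        (\<integral>\<^sup>+s. ennreal K * (ennreal (dens r (t - s)) * indicator {0<..} s) \<partial>lborel)"
    proof (intro nn_integral_mono)
      fix s
      show "ennreal (norm (dens r (t - s) *\<^sub>R P' r (f s))) \<le> ennreal K * (ennreal (dens r (t - s)) * indicator {0<..} s)"
        using ennreal_leI[OF le[of r s]] K dens_nonneg[of r "t - s"]
        by (simp add: ennreal_mult ennreal_indicator[symmetric] mult_ac)
    qed
    also have "\<dots> = ennreal (K * cdfS r t)"
      using that K(1) by (subst nn_integral_cmult) (auto simp: nn_integral_dens_reflect ennreal_mult)
    finally show ?thesis .
  qed
  have "(\<integral>\<^sup>+r. \<integral>\<^sup>+s. ennreal (norm (dens r (t - s) *\<^sub>R P' r (f s))) \<partial>lborel \<partial>lborel) \<le>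
      (\<integral>\<^sup>+r. ennreal K * (ennreal (cdfS r t) * indicator {0<..} r) \<partial>lborel)"
  proof (intro nn_integral_mono)
    fix r
    show "(\<integral>\<^sup>+s. ennreal (norm (dens r (t - s) *\<^sub>R P' r (f s))) \<partial>lborel) \<le>
        ennreal K * (ennreal (cdfS r t) * indicator {0<..} r)"
      using *[of r] K(1) by (cases "0 < r") (auto simp: ennreal_mult dens_def)
  qed
  also have "\<dots> = ennreal K * (\<integral>\<^sup>+r\<in>{0<..}. ennreal (cdfS r t) \<partial>lborel)"
  by (rule nn_integral_cmult) measurable
  also have "\<dots> \<le> ennreal K * ennreal (exp t / \<phi> 1)"
    by (intro mult_left_mono nn_integral_cdfS_le) simp
  finally show "(\<integral>\<^sup>+r. \<integral>\<^sup>+s. ennreal (norm (dens r (t - s) *\<^sub>R P' r (f s))) \<partial>lborel \<partial>lborel)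
     \<le> ennreal K * ennreal (exp t / \<phi> 1)" .
qed

lemma integrable_U:
  assumes f: "admissible f"
  shows "integrable (lborel \<Otimes>\<^sub>M lborel) (\<lambda>(s, r). dens r (t - s) *\<^sub>R P' r (f s))"
proof (rule integrableI_bounded)
  obtain K where K: "0 \<le> K" "\<And>s. norm (f s) \<le> K * indicator {0<..} s"
    using admissible_bound[OF f] by blast
  note [measurable] = admissible_measurable[OF f]
  have "(\<integral>\<^sup>+z. ennreal (norm (case z of (s, r) \<Rightarrow> dens r (t - s) *\<^sub>R P' r (f s))) \<partial>(lborel \<Otimes>\<^sub>M lborel)) =
      (\<integral>\<^sup>+r. \<integral>\<^sup>+s. ennreal (norm (dens r (t - s) *\<^sub>R P' r (f s))) \<partial>lborel \<partial>lborel)"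
    by (subst lborel_pair.nn_integral_snd[symmetric]) (auto simp: split_beta')
  also have "\<dots> < \<infinity>"
    using nn_integral_norm_U_le(1)[OF f K, of t] by (auto intro: le_less_trans simp: ennreal_mult_less_top)
  finally show "(\<integral>\<^sup>+z. ennreal (norm (case z of (s, r) \<Rightarrow> dens r (t - s) *\<^sub>R P' r (f s))) \<partial>(lborel \<Otimes>\<^sub>M lborel)) < \<infinity>" .
  show "(\<lambda>(s, r). dens r (t - s) *\<^sub>R P' r (f s)) \<in> borel_measurable (lborel \<Otimes>\<^sub>M lborel)"
    by measurable
qed

lemma U_eq_swap:
  assumes f: "admissible f"
  shows "U f t = (\<integral>r. (\<integral>s. dens r (t - s) *\<^sub>R P' r (f s) \<partial>lborel) \<partial>lborel)"
  unfolding U_def by (rule lborel_pair.Fubini_integral[symmetric, OF integrable_U[OF f]])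

lemma inner_U:
  assumes f: "admissible f"
  shows "U f t \<bullet> \<psi> = (\<integral>z. dens (snd z) (t - fst z) * (P' (snd z) (f (fst z)) \<bullet> \<psi>) \<partial>(lborel \<Otimes>\<^sub>M lborel))"
proof -
  have "U f t = (\<integral>z. (case z of (s, r) \<Rightarrow> dens r (t - s) *\<^sub>R P' r (f s)) \<partial>(lborel \<Otimes>\<^sub>M lborel))"
    unfolding U_def using lborel_pair.integral_fst'[OF integrable_U[OF f]] by simp
  then show ?thesis
    using integrable_U[OF f] by (simp add: integral_inner_left[symmetric] split_beta')
qed

lemma integrable_U_slice:
  assumes f: "admissible f"
  shows "integrable lborel (\<lambda>s. dens r (t - s) *\<^sub>R P' r (f s))"
proof (rule integrableI_bounded)
  obtain K where K: "0 \<le> K" "\<And>s. norm (f s) \<le> K * indicator {0<..} s"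
    using admissible_bound[OF f] by blast
  note [measurable] = admissible_measurable[OF f]
  show "(\<lambda>s. dens r (t - s) *\<^sub>R P' r (f s)) \<in> borel_measurable lborel" by measurable
  show "(\<integral>\<^sup>+s. ennreal (norm (dens r (t - s) *\<^sub>R P' r (f s))) \<partial>lborel) < \<infinity>"
    using nn_integral_norm_U_le(2)[OF f K, of r t]
    by (cases "0 < r") (auto intro: le_less_trans simp: dens_def)
qed

lemma norm_U_slice_le:
  assumes f: "admissible f" and K: "0 \<le> K" "\<And>s. norm (f s) \<le> K * indicator {0<..} s"
  shows "norm (\<integral>s. dens r (t - s) *\<^sub>R P' r (f s) \<partial>lborel) \<le> K * (indicator {0<..} r * cdfS r t)"
proof (cases "0 < r")
  case True
  have "ennreal (norm (\<integral>s. dens r (t - s) *\<^sub>R P' r (f s) \<partial>lborel)) \<le> ennreal (K * cdfS r t)"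
    by (rule order_trans[OF integral_norm_bound_ennreal[OF integrable_U_slice[OF f]] nn_integral_norm_U_le(2)[OF f K True]])
  then show ?thesis using K True by simp
qed (simp add: dens_def)

lemma U_nonpos: assumes f: "admissible f" and t: "t \<le> 0" shows "U f t = 0"
proof -
  have zero: "dens r (t - s) *\<^sub>R P' r (f s) = 0" for r s
    using f t by (cases "0 < s") (auto simp: dens_def admissible_def P'_def)
  show ?thesis unfolding U_def zero by simp
qed

lemma norm_U_le:
  assumes f: "admissible f" and K: "0 \<le> K" "\<And>s. norm (f s) \<le> K * indicator {0<..} s"
  shows "norm (U f t) \<le> K * (\<integral>r. indicator {0<..} r * cdfS r t \<partial>lborel)"
    and "norm (U f t) \<le> K * exp t / \<phi> 1"
proof -
  have "norm (U f t) \<le> (\<integral>r. K * (indicator {0<..} r * cdfS r t) \<partial>lborel)"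
    unfolding U_eq_swap[OF f] using integrable_cdfS[of t]
    by (intro Bochner_Integration.integral_norm_bound_integral[OF lborel_pair.integrable_snd[OF integrable_U[OF f]]] norm_U_slice_le[OF f K]) auto
  then show le: "norm (U f t) \<le> K * (\<integral>r. indicator {0<..} r * cdfS r t \<partial>lborel)" by simp
  have "(\<integral>r. indicator {0<..} r * cdfS r t \<partial>lborel) \<le> exp t / \<phi> 1"
  proof -
    have "(\<integral>r. indicator {0<..} r * cdfS r t \<partial>lborel) = enn2real (\<integral>\<^sup>+r. ennreal (indicator {0<..} r * cdfS r t) \<partial>lborel)"
      using measurable_cdfS by (intro integral_eq_nn_integral) auto
    also have "(\<integral>\<^sup>+r. ennreal (indicator {0<..} r * cdfS r t) \<partial>lborel) = (\<integral>\<^sup>+r\<in>{0<..}. ennreal (cdfS r t) \<partial>lborel)"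
      by (intro nn_integral_cong) (auto split: split_indicator)
    also have "enn2real \<dots> \<le> exp t / \<phi> 1"
      using nn_integral_cdfS_le[of t] phi_pos[of 1] by (intro enn2real_leI) auto
    finally show ?thesis .
  qed
  then show "norm (U f t) \<le> K * exp t / \<phi> 1"
    using le K(1) mult_left_mono order_trans by fastforce
qed

text \<open>For fixed \<open>r\<close> the slice depends on time through a translate of
  \<open>dens r\<close>, and \<open>norm (P' r (f s)) \<le> K\<close>, so the slice is continuous by
  \<open>tendsto_L1_translate\<close>. The integral over \<open>r\<close> follows by dominated
  convergence: \<open>cdfS r\<close> is monotone, so its value at an upper bound \<open>T\<close> of
  the times yields a majorant.\<close>

lemma continuous_U:
  assumes f: "admissible f"
  shows "continuous_on UNIV (U f)"
proof (rule continuous_on_sequentiallyI)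
  fix t :: "nat \<Rightarrow> real" and t\<^sub>0 assume t: "t \<longlonglongrightarrow> t\<^sub>0"
  obtain K where K: "0 \<le> K" "\<And>s. norm (f s) \<le> K * indicator {0<..} s"
    using admissible_bound[OF f] by blast
  note [measurable] = admissible_measurable[OF f]
  obtain T where T: "\<And>n. t n \<le> T"
    using convergent_imp_Bseq[OF convergentI[OF t]] by (auto simp: Bseq_def abs_le_iff)
  have lim: "(\<lambda>n. \<integral>s. dens r (t n - s) *\<^sub>R P' r (f s) \<partial>lborel) \<longlonglongrightarrow> (\<integral>s. dens r (t\<^sub>0 - s) *\<^sub>R P' r (f s) \<partial>lborel)" for r
  proof -
    define J where "J d = (\<integral>x. \<bar>dens r (x + d) - dens r x\<bar> \<partial>lborel)" for d
    have "isCont J 0"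
      unfolding isCont_def using tendsto_L1_translate[OF integrable_dens[of r]]
      by (simp add: J_def[abs_def])
    then have "(\<lambda>n. J (t n - t\<^sub>0)) \<longlonglongrightarrow> J 0"
      by (rule isCont_tendsto_compose) (use LIM_zero[OF t] in simp)
    then have lim0: "(\<lambda>n. K * J (t n - t\<^sub>0)) \<longlonglongrightarrow> K * 0"
      by (intro tendsto_mult tendsto_const) (simp add: J_def)
    have bound: "norm ((\<integral>s. dens r (t n - s) *\<^sub>R P' r (f s) \<partial>lborel) - (\<integral>s. dens r (t\<^sub>0 - s) *\<^sub>R P' r (f s) \<partial>lborel))
        \<le> K * J (t n - t\<^sub>0)" for n
    proof -
      have int: "integrable lborel (\<lambda>x. dens r (a - x))" for a
        using lborel_integrable_real_affine[OF integrable_dens, of "-1" r a] by simp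
      have eq: "(\<integral>s. dens r (t n - s) *\<^sub>R P' r (f s) \<partial>lborel) - (\<integral>s. dens r (t\<^sub>0 - s) *\<^sub>R P' r (f s) \<partial>lborel) =
          (\<integral>s. (dens r (t n - s) - dens r (t\<^sub>0 - s)) *\<^sub>R P' r (f s) \<partial>lborel)"
        by (simp add: scaleR_diff_left integrable_U_slice[OF f])
      have "norm (\<integral>s. (dens r (t n - s) - dens r (t\<^sub>0 - s)) *\<^sub>R P' r (f s) \<partial>lborel) \<le> (\<integral>s. K * \<bar>dens r (t n - s) - dens r (t\<^sub>0 - s)\<bar> \<partial>lborel)"
      proof (rule Bochner_Integration.integral_norm_bound_integral)
        show "integrable lborel (\<lambda>s. (dens r (t n - s) - dens r (t\<^sub>0 - s)) *\<^sub>R P' r (f s))"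
          by (simp add: scaleR_diff_left integrable_U_slice[OF f])
        show "integrable lborel (\<lambda>s. K * \<bar>dens r (t n - s) - dens r (t\<^sub>0 - s)\<bar>)"
          by (intro integrable_mult_right integrable_abs Bochner_Integration.integrable_diff int)
        fix s
        have "norm (P' r (f s)) \<le> K"
          using norm_P'_le[of r "f s"] K(2)[of s] K(1) by (auto split: split_indicator_asm)
        then show "norm ((dens r (t n - s) - dens r (t\<^sub>0 - s)) *\<^sub>R P' r (f s)) \<le> K * \<bar>dens r (t n - s) - dens r (t\<^sub>0 - s)\<bar>"
          using mult_left_mono[of "norm (P' r (f s))" K "\<bar>dens r (t n - s) - dens r (t\<^sub>0 - s)\<bar>"]
          by (simp only: norm_scaleR real_norm_def mult.commute[of K] abs_ge_zero)
      qed
      also have "\<dots> = K * J (t n - t\<^sub>0)"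
      proof -
        have eqs: "t\<^sub>0 + - 1 * s + (t n - t\<^sub>0) = t n - s" "t\<^sub>0 + - 1 * s = t\<^sub>0 - s"
          "t\<^sub>0 - s + (t n - t\<^sub>0) = t n - s" for s by linarith+
        have "J (t n - t\<^sub>0) = (\<integral>s. \<bar>dens r (t n - s) - dens r (t\<^sub>0 - s)\<bar> \<partial>lborel)"
        proof -
          have "J (t n - t\<^sub>0) = \<bar>- 1\<bar> *\<^sub>R
              (\<integral>s. \<bar>dens r (t\<^sub>0 + - 1 * s + (t n - t\<^sub>0)) - dens r (t\<^sub>0 + - 1 * s)\<bar> \<partial>lborel)"
            unfolding J_def by (rule lborel_integral_real_affine) simp
          then show ?thesis by (simp only: eqs abs_minus_cancel abs_one scaleR_one)
        qed
        then show ?thesis by simp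
      qed
      finally show ?thesis unfolding eq .
    qed
    show ?thesis
    proof (rule LIM_zero_cancel, rule Lim_null_comparison)
      show "(\<lambda>n. K * J (t n - t\<^sub>0)) \<longlonglongrightarrow> 0" using lim0 by simp
    qed (intro always_eventually allI bound)
  qed
  show "(\<lambda>n. U f (t n)) \<longlonglongrightarrow> U f t\<^sub>0"
    unfolding U_eq_swap[OF f]
  proof (rule integral_dominated_convergence)
    show "integrable lborel (\<lambda>r. K * (indicator {0<..} r * cdfS r T))"
      using integrable_cdfS by simp
    show "AE r in lborel. norm (\<integral>s. dens r (t n - s) *\<^sub>R P' r (f s) \<partial>lborel) \<le> K * (indicator {0<..} r * cdfS r T)" for n
    proof (rule AE_I2)
      fix r
      have "norm (\<integral>s. dens r (t n - s) *\<^sub>R P' r (f s) \<partial>lborel) \<le> K * (indicator {0<..} r * cdfS r (t n))"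
        by (rule norm_U_slice_le[OF f K])
      also have "\<dots> \<le> K * (indicator {0<..} r * cdfS r T)"
        using K(1) cdfS_mono[OF _ T[of n], of r] by (cases "0 < r") (auto intro: mult_left_mono)
      finally show "norm (\<integral>s. dens r (t n - s) *\<^sub>R P' r (f s) \<partial>lborel) \<le> K * (indicator {0<..} r * cdfS r T)" .
    qed
  qed (auto intro!: lim)
qed

section \<open>Means of \<open>P\<close> at the inverse subordinator\<close>

definition Q :: "real \<Rightarrow> 'h \<Rightarrow> 'h" where
  "Q t h = (\<integral>\<omega>. P (X t \<omega>) h \<partial>M)"

lemma integrable_Q: "0 \<le> t \<Longrightarrow> integrable M (\<lambda>\<omega>. P (X t \<omega>) h)"
  by (intro integrable_P finite_measure_axioms X_nonneg) auto

lemma norm_Q_le: "0 \<le> t \<Longrightarrow> norm (Q t h) \<le> norm h"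
proof -
  assume t: "0 \<le> t"
  have "norm (Q t h) \<le> (\<integral>\<omega>. norm (P (X t \<omega>) h) \<partial>M)"
    unfolding Q_def by (rule integral_norm_bound)
  also have "\<dots> \<le> (\<integral>\<omega>. norm h \<partial>M)"
    using integrable_Q[OF t] by (intro integral_mono) (auto simp: norm_P_le X_nonneg)
  finally have "norm (Q t h) \<le> (\<integral>\<omega>. norm h \<partial>M)" .
  then show ?thesis by (simp add: prob_space)
qed

lemma continuous_Q: "continuous_on {0..} (\<lambda>t. Q t h)"
proof (rule continuous_on_sequentiallyI)
  fix t :: "nat \<Rightarrow> real" and t\<^sub>0 assume t: "\<forall>n. t n \<in> {0..}" "t\<^sub>0 \<in> {0..}" "t \<longlonglongrightarrow> t\<^sub>0"
  show "(\<lambda>n. Q (t n) h) \<longlonglongrightarrow> Q t\<^sub>0 h"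
    unfolding Q_def
  proof (rule integral_dominated_convergence)
    show "integrable M (\<lambda>_. norm h)" by simp
    show "(\<lambda>\<omega>. P (X t\<^sub>0 \<omega>) h) \<in> borel_measurable M" "(\<lambda>\<omega>. P (X (t n) \<omega>) h) \<in> borel_measurable M" for n
      using integrable_Q t by (auto dest: borel_measurable_integrable)
    show "AE \<omega> in M. norm (P (X (t n) \<omega>) h) \<le> norm h" for n
      by (simp add: norm_P_le X_nonneg)
    show "AE \<omega> in M. (\<lambda>n. P (X (t n) \<omega>) h) \<longlonglongrightarrow> P (X t\<^sub>0 \<omega>) h"
      using AE_X_continuous[of t\<^sub>0, OF t(2)[simplified]]
    proof eventually_elim
      case (elim \<omega>)
      then have "continuous (at t\<^sub>0 within {0..}) (\<lambda>s. X s \<omega>)" by (simp add: continuous_within)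
      then have "(\<lambda>n. X (t n) \<omega>) \<longlonglongrightarrow> X t\<^sub>0 \<omega>"
        using t by (intro continuous_within_tendsto_compose'[where f="\<lambda>s. X s \<omega>" and S="{0..}"]) auto
      then show "(\<lambda>n. P (X (t n) \<omega>) h) \<longlonglongrightarrow> P (X t\<^sub>0 \<omega>) h"
        by (intro tendsto_P tendsto_const) (auto simp: X_nonneg)
    qed
  qed
qed

lemma Q_0: "Q 0 h = h"
proof -
  have "Q 0 h = (\<integral>\<omega>. h \<partial>M)"
    unfolding Q_def using AE_X_0 integrable_Q[of 0 h]
    by (intro integral_cong_AE) (auto elim!: eventually_mono dest: borel_measurable_integrable)
  then show ?thesis by (simp add: prob_space)
qed

lemma inner_Q: "0 \<le> t \<Longrightarrow> Q t h \<bullet> \<psi> = (\<integral>\<omega>. P (X t \<omega>) h \<bullet> \<psi> \<partial>M)"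
  unfolding Q_def using integrable_Q by (simp add: integral_inner_left)

text \<open>Dynkin's formula for \<open>r \<mapsto> P r h \<bullet> \<phi>\<close> at the random time \<open>X t\<close>.\<close>

lemma inner_Q_dynkin:
  assumes t: "0 < t" and x: "x \<in> D"
  shows "Q t h \<bullet> x = h \<bullet> x + (\<integral>r. indicator {0<..} r * cdfS r t * (P' r h \<bullet> L x) \<partial>lborel)"
proof -
  interpret pair_sigma_finite M lborel ..
  have [measurable]: "X t \<in> borel_measurable M" using t by simp
  let ?F = "\<lambda>\<omega> r. indicator {r. 0 < r \<and> r < X t \<omega>} r * (P' r h \<bullet> L x)"
  have ind: "(\<lambda>(\<omega>, r). indicator {r. 0 < r \<and> r < X t \<omega>} r :: real) \<in> borel_measurable (M \<Otimes>\<^sub>M lborel)"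
    unfolding indicator_def mem_Collect_eq by measurable
  have F_meas: "(\<lambda>(\<omega>, r). ?F \<omega> r) \<in> borel_measurable (M \<Otimes>\<^sub>M lborel)"
    using borel_measurable_times[OF ind, of "\<lambda>(\<omega>, r). P' r h \<bullet> L x"] by (simp add: split_beta')
  have law: "emeasure M {\<omega>\<in>space M. r < X t \<omega>} = ennreal (cdfS r t)" if "0 < r" for r
    using emeasure_X_gt[OF t, of r] that by (simp add: emeasure_eq_measure)
  \<comment> \<open>Averaging over \<open>\<omega>\<close> first turns the indicator into the tail
    of the law of \<open>X t\<close>. Only \<open>emeasure_X_gt\<close> is used here, so the formula
    holds at every \<open>t > 0\<close>.\<close>
  have int_ind: "(\<integral>\<omega>. indicator {r. 0 < r \<and> r < X t \<omega>} r \<partial>M) = indicator {0<..} r * cdfS r t" for r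
  proof (cases "0 < r")
    case True
    have "(\<integral>\<omega>. indicator {r. 0 < r \<and> r < X t \<omega>} r \<partial>M) = (\<integral>\<omega>. indicator {\<omega>\<in>space M. r < X t \<omega>} \<omega> \<partial>M :: real)"
      using True by (intro Bochner_Integration.integral_cong) (auto split: split_indicator)
    also have "\<dots> = cdfS r t"
      using law[OF True] by (simp add: measure_def)
    finally show ?thesis using True by simp
  qed simp
  have "integrable (M \<Otimes>\<^sub>M lborel) (\<lambda>(\<omega>, r). ?F \<omega> r)"
  proof (rule integrableI_bounded[OF F_meas])
    have "(\<integral>\<^sup>+z. ennreal (norm (case z of (\<omega>, r) \<Rightarrow> ?F \<omega> r)) \<partial>(M \<Otimes>\<^sub>M lborel)) =
        (\<integral>\<^sup>+r. \<integral>\<^sup>+\<omega>. ennreal (norm (?F \<omega> r)) \<partial>M \<partial>lborel)"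
      using F_meas by (subst nn_integral_snd[symmetric]) (auto simp: split_beta')
    also have "\<dots> \<le> (\<integral>\<^sup>+r. ennreal (norm h * norm (L x)) * (ennreal (cdfS r t) * indicator {0<..} r) \<partial>lborel)"
    proof (intro nn_integral_mono)
      fix r :: real
      have le: "\<bar>P' r h \<bullet> L x\<bar> \<le> norm h * norm (L x)"
        by (rule order_trans[OF Cauchy_Schwarz_ineq2 mult_right_mono[OF norm_P'_le norm_ge_zero]])
      show "(\<integral>\<^sup>+\<omega>. ennreal (norm (?F \<omega> r)) \<partial>M) \<le> ennreal (norm h * norm (L x)) * (ennreal (cdfS r t) * indicator {0<..} r)"
      proof (cases "0 < r")
        case True
        have "(\<integral>\<^sup>+\<omega>. ennreal (norm (?F \<omega> r)) \<partial>M) \<le>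
            (\<integral>\<^sup>+\<omega>. ennreal (norm h * norm (L x)) * indicator {\<omega>\<in>space M. r < X t \<omega>} \<omega> \<partial>M)"
          using le by (intro nn_integral_mono) (auto split: split_indicator intro!: ennreal_leI)
        then show ?thesis using law[OF True] True by (simp add: nn_integral_cmult)
      qed simp
    qed
    also have "\<dots> = ennreal (norm h * norm (L x)) * (\<integral>\<^sup>+r\<in>{0<..}. ennreal (cdfS r t) \<partial>lborel)"
    by (rule nn_integral_cmult) measurable
    also have "\<dots> < \<infinity>"
      using nn_integral_cdfS_le[of t] by (auto simp: ennreal_mult_less_top intro: le_less_trans)
    finally show "(\<integral>\<^sup>+z. ennreal (norm (case z of (\<omega>, r) \<Rightarrow> ?F \<omega> r)) \<partial>(M \<Otimes>\<^sub>M lborel)) < \<infinity>" .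
  qed
  then have "(\<integral>\<omega>. (\<integral>r. ?F \<omega> r \<partial>lborel) \<partial>M) = (\<integral>r. (\<integral>\<omega>. ?F \<omega> r \<partial>M) \<partial>lborel)"
    by (intro Fubini_integral[symmetric])
  also have "\<dots> = (\<integral>r. indicator {0<..} r * cdfS r t * (P' r h \<bullet> L x) \<partial>lborel)"
    by (simp add: int_ind)
  finally have swap: "(\<integral>\<omega>. (\<integral>r. ?F \<omega> r \<partial>lborel) \<partial>M) = (\<integral>r. indicator {0<..} r * cdfS r t * (P' r h \<bullet> L x) \<partial>lborel)" .
  have ftc: "(\<integral>r. ?F \<omega> r \<partial>lborel) = P (X t \<omega>) h \<bullet> x - h \<bullet> x" for \<omega>
  proof -
    let ?b = "X t \<omega>"
    have b: "0 \<le> ?b" by (rule X_nonneg)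
    have "(\<integral>r. indicator {0..?b} r *\<^sub>R (P' r h \<bullet> L x) \<partial>lborel) = h \<bullet> P ?b x - h \<bullet> P 0 x"
    proof (rule integral_FTC_atLeastAtMost[OF b])
      fix r assume r: "0 \<le> r" "r \<le> ?b"
      have "((\<lambda>s. P s x) has_vector_derivative P r (L x)) (at r within {0..?b})"
        using r by (intro has_vector_derivative_within_subset[OF P_has_vector_derivative[OF x]]) auto
      then have "((\<lambda>s. h \<bullet> P s x) has_vector_derivative h \<bullet> P r (L x)) (at r within {0..?b})"
        by (rule bounded_linear.has_vector_derivative[OF bounded_linear_inner_right])
      then show "((\<lambda>s. h \<bullet> P s x) has_vector_derivative P' r h \<bullet> L x) (at r within {0..?b})"
        using r by (simp add: P'_eq P_symmetric)
    next
      show "continuous_on {0..?b} (\<lambda>r. P' r h \<bullet> L x)"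
        unfolding P'_def by (intro continuous_intros continuous_on_P) auto
    qed
    also have "(\<integral>r. indicator {0..?b} r *\<^sub>R (P' r h \<bullet> L x) \<partial>lborel) = (\<integral>r. ?F \<omega> r \<partial>lborel)"
    proof (rule integral_cong_AE)
      show "AE r in lborel. indicator {0..?b} r *\<^sub>R (P' r h \<bullet> L x) = ?F \<omega> r"
        using AE_lborel_singleton[of 0] AE_lborel_singleton[of ?b]
        by eventually_elim (auto split: split_indicator)
    qed measurable
    finally show ?thesis using b by (simp add: P_symmetric)
  qed
  have "Q t h \<bullet> x = (\<integral>\<omega>. h \<bullet> x + (\<integral>r. ?F \<omega> r \<partial>lborel) \<partial>M)"
    using t by (simp add: inner_Q ftc)
  also have "\<dots> = h \<bullet> x + (\<integral>\<omega>. (\<integral>r. ?F \<omega> r \<partial>lborel) \<partial>M)"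
    unfolding ftc using integrable_Q[of t h] t by (simp add: prob_space)
  finally show ?thesis by (simp add: swap)
qed

lemma Q_diff: "0 \<le> t \<Longrightarrow> Q t (x - y) = Q t x - Q t y"
proof -
  assume t: "0 \<le> t"
  have "Q t (x - y) = (\<integral>\<omega>. P (X t \<omega>) x - P (X t \<omega>) y \<partial>M)"
    unfolding Q_def by (simp add: P_diff X_nonneg)
  then show ?thesis unfolding Q_def using integrable_Q[OF t] by simp
qed

lemma continuous_on_Q:
  assumes a: "continuous_on A a" "\<And>x. x \<in> A \<Longrightarrow> 0 \<le> a x" and b: "continuous_on A b"
  shows "continuous_on A (\<lambda>x. Q (a x) (b x))"
  unfolding continuous_on_def
proof
  fix x assume x: "x \<in> A"
  have "((\<lambda>y. Q (a y) (b x)) \<longlongrightarrow> Q (a x) (b x)) (at x within A)"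
    using continuous_on_compose2[OF continuous_Q a(1)] a(2) x by (auto simp: continuous_on_def)
  then have "((\<lambda>y. norm (b y - b x) + norm (Q (a y) (b x) - Q (a x) (b x))) \<longlongrightarrow> 0 + 0) (at x within A)"
    using b x by (intro tendsto_add tendsto_norm_zero LIM_zero) (auto simp: continuous_on_def)
  then have lim: "((\<lambda>y. norm (b y - b x) + norm (Q (a y) (b x) - Q (a x) (b x))) \<longlongrightarrow> 0) (at x within A)"
    by simp
  have "((\<lambda>y. Q (a y) (b y) - Q (a x) (b x)) \<longlongrightarrow> 0) (at x within A)"
  proof (rule Lim_null_comparison[OF _ lim])
    have "norm (Q (a y) (b y) - Q (a x) (b x)) \<le> norm (b y - b x) + norm (Q (a y) (b x) - Q (a x) (b x))"
      if "y \<in> A" for y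
    proof -
      have "Q (a y) (b y) - Q (a x) (b x) = Q (a y) (b y - b x) + (Q (a y) (b x) - Q (a x) (b x))"
        using a(2)[OF that] by (simp add: Q_diff)
      also have "norm \<dots> \<le> norm (Q (a y) (b y - b x)) + norm (Q (a y) (b x) - Q (a x) (b x))"
        by (rule norm_triangle_ineq)
      also have "\<dots> \<le> norm (b y - b x) + norm (Q (a y) (b x) - Q (a x) (b x))"
        using norm_Q_le[OF a(2)[OF that]] by simp
      finally show ?thesis .
    qed
    then show "\<forall>\<^sub>F y in at x within A. norm (Q (a y) (b y) - Q (a x) (b x)) \<le>
        norm (b y - b x) + norm (Q (a y) (b x) - Q (a x) (b x))"
      by (simp add: eventually_at_filter)
  qed
  then show "((\<lambda>y. Q (a y) (b y)) \<longlongrightarrow> Q (a x) (b x)) (at x within A)"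
    by (rule LIM_zero_cancel)
qed

lemma measurable_Q:
  assumes [measurable]: "a \<in> borel_measurable N" "b \<in> borel_measurable N"
  shows "(\<lambda>x. Q (max 0 (a x)) (b x)) \<in> borel_measurable N"
proof -
  have "continuous_on UNIV (\<lambda>y. Q (max 0 (fst y)) (snd y))"
    by (intro continuous_on_Q continuous_intros) auto
  then have "(\<lambda>y. Q (max 0 (fst y)) (snd y)) \<in> borel_measurable (borel \<Otimes>\<^sub>M borel)"
    unfolding borel_prod by (rule borel_measurable_continuous_onI)
  then have "(\<lambda>y. Q (max 0 (fst y)) (snd y)) \<circ> (\<lambda>x. (a x, b x)) \<in> borel_measurable N"
    by (rule measurable_comp[rotated]) measurable
  then show ?thesis by (simp add: o_def)
qed

section \<open>Convolution identities and the weak equation\<close>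

lemma convolution_U:
  fixes k :: "real \<Rightarrow> real"
  assumes f: "admissible f" and k [measurable]: "k \<in> borel_measurable borel" and k_nonneg: "\<And>x. 0 \<le> k x"
    and k_int: "(\<integral>\<^sup>+x. ennreal (exp (- x)) * ennreal (k x) \<partial>lborel) < \<infinity>"
  shows "integrable lborel (\<lambda>t. k (T - t) * (U f t \<bullet> \<psi>))"
    and "integrable lborel (\<lambda>s. \<integral>r. (\<integral>x. k (T - s - x) * dens r x \<partial>lborel) * (P' r (f s) \<bullet> \<psi>) \<partial>lborel)"
    and "(\<integral>t. k (T - t) * (U f t \<bullet> \<psi>) \<partial>lborel) =
      (\<integral>s. \<integral>r. (\<integral>x. k (T - s - x) * dens r x \<partial>lborel) * (P' r (f s) \<bullet> \<psi>) \<partial>lborel \<partial>lborel)"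
proof -
  obtain K where K: "0 \<le> K" "\<And>s. norm (f s) \<le> K * indicator {0<..} s"
    using admissible_bound[OF f] by blast
  note [measurable] = admissible_measurable[OF f]
  let ?LL = "lborel \<Otimes>\<^sub>M lborel :: (real \<times> real) measure"
  have LL: "sigma_finite_measure ?LL"
    by (intro sigma_finite_pair_measure sigma_finite_lborel)
  interpret pair_sigma_finite "lborel :: real measure" ?LL
    by (intro pair_sigma_finite.intro sigma_finite_lborel LL)
  define h where "h t z = k (T - t) * (dens (snd z) (t - fst z) * (P' (snd z) (f (fst z)) \<bullet> \<psi>))"
    for t :: real and z :: "real \<times> real"
  have h_meas [measurable]: "(\<lambda>(t, z). h t z) \<in> borel_measurable (lborel \<Otimes>\<^sub>M ?LL)"
    unfolding h_def by measurable
  have h_int: "integrable (lborel \<Otimes>\<^sub>M ?LL) (\<lambda>(t, z). h t z)"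
  proof (rule integrableI_bounded[OF h_meas])
    have "(\<integral>\<^sup>+y. ennreal (norm (case y of (t, z) \<Rightarrow> h t z)) \<partial>(lborel \<Otimes>\<^sub>M ?LL)) =
        (\<integral>\<^sup>+t. \<integral>\<^sup>+z. ennreal (norm (h t z)) \<partial>?LL \<partial>lborel)"
      by (subst sigma_finite_measure.nn_integral_fst[OF LL, symmetric]) (auto simp: split_beta')
    \<comment> \<open>The norm of \<open>U f t\<close> grows at most like \<open>exp t\<close>.
      Written as \<open>exp T * exp (- (T - t))\<close>, this growth produces exactly the weight of
      \<open>k_int\<close>, a condition that both \<open>w\<close> and the indicator of
      \<open>{0<..}\<close> satisfy.\<close>
    also have "\<dots> \<le> (\<integral>\<^sup>+t. ennreal (K * norm \<psi> * exp T / \<phi> 1) * (ennreal (exp (- (T - t))) * ennreal (k (T - t))) \<partial>lborel)"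
    proof (intro nn_integral_mono)
      fix t :: real
      have "(\<integral>\<^sup>+z. ennreal (norm (h t z)) \<partial>?LL) \<le>
          (\<integral>\<^sup>+z. ennreal (k (T - t) * norm \<psi>) * ennreal (norm (dens (snd z) (t - fst z) *\<^sub>R P' (snd z) (f (fst z)))) \<partial>?LL)"
      proof (intro nn_integral_mono)
        fix z :: "real \<times> real"
        have "norm (h t z) = k (T - t) * (dens (snd z) (t - fst z) * \<bar>P' (snd z) (f (fst z)) \<bullet> \<psi>\<bar>)"
          unfolding h_def by (simp add: abs_mult k_nonneg dens_nonneg)
        also have "\<dots> \<le> k (T - t) * (dens (snd z) (t - fst z) * (norm (P' (snd z) (f (fst z))) * norm \<psi>))"
          by (intro mult_left_mono Cauchy_Schwarz_ineq2 k_nonneg dens_nonneg)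
        also have "\<dots> = k (T - t) * norm \<psi> * norm (dens (snd z) (t - fst z) *\<^sub>R P' (snd z) (f (fst z)))"
          by (simp add: dens_nonneg)
        finally show "ennreal (norm (h t z)) \<le> ennreal (k (T - t) * norm \<psi>) * ennreal (norm (dens (snd z) (t - fst z) *\<^sub>R P' (snd z) (f (fst z))))"
          by (subst ennreal_mult[symmetric]) (auto intro!: ennreal_leI simp: k_nonneg)
      qed
      also have "\<dots> = ennreal (k (T - t) * norm \<psi>) * (\<integral>\<^sup>+z. ennreal (norm (dens (snd z) (t - fst z) *\<^sub>R P' (snd z) (f (fst z)))) \<partial>?LL)"
        by (intro nn_integral_cmult) measurable
      also have "(\<integral>\<^sup>+z. ennreal (norm (dens (snd z) (t - fst z) *\<^sub>R P' (snd z) (f (fst z)))) \<partial>?LL) =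
          (\<integral>\<^sup>+r. \<integral>\<^sup>+s. ennreal (norm (dens r (t - s) *\<^sub>R P' r (f s))) \<partial>lborel \<partial>lborel)"
        by (subst lborel_pair.nn_integral_snd[symmetric]) (auto simp: split_beta')
      also have "ennreal (k (T - t) * norm \<psi>) * \<dots> \<le> ennreal (k (T - t) * norm \<psi>) * (ennreal K * ennreal (exp t / \<phi> 1))"
        by (intro mult_left_mono nn_integral_norm_U_le(1)[OF f K]) simp
      also have "\<dots> = ennreal (k (T - t) * norm \<psi> * (K * (exp t / \<phi> 1)))"
        using K(1) phi_pos[of 1] k_nonneg by (simp add: ennreal_mult[symmetric])
      also have "k (T - t) * norm \<psi> * (K * (exp t / \<phi> 1)) = (K * norm \<psi> * exp T / \<phi> 1) * (exp (- (T - t)) * k (T - t))"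
        by (simp add: exp_diff exp_minus field_simps)
      also have "ennreal \<dots> = ennreal (K * norm \<psi> * exp T / \<phi> 1) * (ennreal (exp (- (T - t))) * ennreal (k (T - t)))"
        using K(1) phi_pos[of 1] k_nonneg by (simp add: ennreal_mult[symmetric])
      finally show "(\<integral>\<^sup>+z. ennreal (norm (h t z)) \<partial>?LL) \<le>
          ennreal (K * norm \<psi> * exp T / \<phi> 1) * (ennreal (exp (- (T - t))) * ennreal (k (T - t)))" .
    qed
    also have "\<dots> = ennreal (K * norm \<psi> * exp T / \<phi> 1) * (\<integral>\<^sup>+t. ennreal (exp (- (T - t))) * ennreal (k (T - t)) \<partial>lborel)"
      by (intro nn_integral_cmult) measurable
    also have "(\<integral>\<^sup>+t. ennreal (exp (- (T - t))) * ennreal (k (T - t)) \<partial>lborel) = (\<integral>\<^sup>+x. ennreal (exp (- x)) * ennreal (k x) \<partial>lborel)"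
      by (subst (2) nn_integral_real_affine[where c="-1" and t=T]) auto
    also have "ennreal (K * norm \<psi> * exp T / \<phi> 1) * \<dots> < \<infinity>"
      using k_int by (simp add: ennreal_mult_less_top)
    finally show "(\<integral>\<^sup>+y. ennreal (norm (case y of (t, z) \<Rightarrow> h t z)) \<partial>(lborel \<Otimes>\<^sub>M ?LL)) < \<infinity>" .
  qed
  have inner1: "(\<integral>z. h t z \<partial>?LL) = k (T - t) * (U f t \<bullet> \<psi>)" for t
    unfolding h_def inner_U[OF f] by simp
  have inner2: "(\<integral>t. h t (s, r) \<partial>lborel) = (\<integral>x. k (T - s - x) * dens r x \<partial>lborel) * (P' r (f s) \<bullet> \<psi>)" for s r
  proof -
    have "(\<integral>t. h t (s, r) \<partial>lborel) = (\<integral>t. k (T - t) * dens r (t - s) \<partial>lborel) * (P' r (f s) \<bullet> \<psi>)"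
      unfolding h_def by (simp add: mult.assoc[symmetric])
    also have "(\<integral>t. k (T - t) * dens r (t - s) \<partial>lborel) = (\<integral>x. k (T - s - x) * dens r x \<partial>lborel)"
      using lborel_integral_real_affine[of 1 "\<lambda>t. k (T - t) * dens r (t - s)" s] by (simp add: algebra_simps)
    finally show ?thesis .
  qed
  show "integrable lborel (\<lambda>t. k (T - t) * (U f t \<bullet> \<psi>))"
    using integrable_fst'[OF h_int] by (simp add: inner1)
  have int2: "integrable ?LL (\<lambda>z. \<integral>t. h t z \<partial>lborel)"
    by (rule integrable_snd[OF h_int])
  have "(\<integral>t. k (T - t) * (U f t \<bullet> \<psi>) \<partial>lborel) = (\<integral>z. (\<integral>t. h t z \<partial>lborel) \<partial>?LL)"
    unfolding inner1[symmetric] by (rule Fubini_integral[OF h_int, symmetric])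
  also have "\<dots> = (\<integral>s. \<integral>r. (\<integral>t. h t (s, r) \<partial>lborel) \<partial>lborel \<partial>lborel)"
    by (rule lborel_pair.integral_fst'[OF int2, symmetric])
  finally show "(\<integral>t. k (T - t) * (U f t \<bullet> \<psi>) \<partial>lborel) =
      (\<integral>s. \<integral>r. (\<integral>x. k (T - s - x) * dens r x \<partial>lborel) * (P' r (f s) \<bullet> \<psi>) \<partial>lborel \<partial>lborel)"
    by (simp only: inner2)
  show "integrable lborel (\<lambda>s. \<integral>r. (\<integral>x. k (T - s - x) * dens r x \<partial>lborel) * (P' r (f s) \<bullet> \<psi>) \<partial>lborel)"
    using lborel_pair.integrable_fst'[OF int2] by (simp only: inner2)
qed

lemma integral_q_eq:
  assumes \<tau>: "0 < \<tau>" and eq: "distr M borel (X \<tau>) = density lborel (q \<tau>)"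
  shows "(\<integral>r. (\<integral>x. w (\<tau> - x) * dens r x \<partial>lborel) * (P' r h \<bullet> \<psi>) \<partial>lborel) = Q \<tau> h \<bullet> \<psi>"
proof -
  have [measurable]: "X \<tau> \<in> borel_measurable M" using \<tau> by simp
  have "(\<integral>x. w (\<tau> - x) * dens r x \<partial>lborel) = enn2real (q \<tau> r)" for r
  proof -
    have "(\<integral>x. w (\<tau> - x) * dens r x \<partial>lborel) = enn2real (\<integral>\<^sup>+x. ennreal (w (\<tau> - x) * dens r x) \<partial>lborel)"
      by (intro integral_eq_nn_integral) (auto simp: w_nonneg dens_nonneg)
    then show ?thesis
      by (simp add: q_def ennreal_mult w_nonneg dens_nonneg mult.commute)
  qed
  note q_eq = this
  have "emeasure (distr M borel (X \<tau>)) UNIV = 1"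
    by (simp add: emeasure_distr emeasure_space_1)
  then have "(\<integral>\<^sup>+r. q \<tau> r \<partial>lborel) = 1"
    unfolding eq by (simp add: emeasure_density)
  \<comment> \<open>A density of total mass 1 is finite almost everywhere; without this,
    \<open>enn2real\<close> could lose mass when passing to a real density.\<close>
  then have fin: "AE r in lborel. q \<tau> r \<noteq> \<infinity>"
    by (intro nn_integral_noteq_infinite) auto
  have "density lborel (q \<tau>) = density lborel (\<lambda>r. ennreal (enn2real (q \<tau> r)))"
    by (intro density_cong) (use fin in \<open>auto elim!: eventually_mono simp: less_top\<close>)
  then have distr: "distr M borel (X \<tau>) = density lborel (\<lambda>r. ennreal (enn2real (q \<tau> r)))"
    using eq by simp
  have "Q \<tau> h \<bullet> \<psi> = (\<integral>\<omega>. P' (X \<tau> \<omega>) h \<bullet> \<psi> \<partial>M)"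
    using \<tau> by (simp add: inner_Q P'_eq X_nonneg)
  also have "\<dots> = (\<integral>r. P' r h \<bullet> \<psi> \<partial>distr M borel (X \<tau>))"
    by (subst integral_distr) auto
  also have "\<dots> = (\<integral>r. enn2real (q \<tau> r) *\<^sub>R (P' r h \<bullet> \<psi>) \<partial>lborel)"
    unfolding distr by (intro integral_density) auto
  finally show ?thesis by (simp add: q_eq)
qed

lemma convolution_w_U:
  assumes f: "admissible f"
  shows "integrable lborel (\<lambda>s. indicator {0<..<T} s * (Q (T - s) (f s) \<bullet> \<psi>))"
    and "(\<integral>t. w (T - t) * (U f t \<bullet> \<psi>) \<partial>lborel) = (\<integral>s. indicator {0<..<T} s * (Q (T - s) (f s) \<bullet> \<psi>) \<partial>lborel)"
    and "integrable lborel (\<lambda>t. w (T - t) * (U f t \<bullet> \<psi>))"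
proof -
  have k_int: "(\<integral>\<^sup>+x. ennreal (exp (- x)) * ennreal (w x) \<partial>lborel) < \<infinity>"
    using nn_integral_laplace_w[of 1] by simp
  note conv = convolution_U[OF f measurable_w w_nonneg k_int, where T=T and \<psi>=\<psi>]
  note [measurable] = admissible_measurable[OF f]
  have meas: "(\<lambda>s. indicator {0<..<T} s * (Q (T - s) (f s) \<bullet> \<psi>)) \<in> borel_measurable lborel"
  proof -
    have "(\<lambda>s. indicator {0<..<T} s * (Q (max 0 (T - s)) (f s) \<bullet> \<psi>)) \<in> borel_measurable lborel"
      using measurable_Q[of "\<lambda>s. T - s" lborel f] by measurable
    also have "(\<lambda>s. indicator {0<..<T} s * (Q (max 0 (T - s)) (f s) \<bullet> \<psi>)) = (\<lambda>s. indicator {0<..<T} s * (Q (T - s) (f s) \<bullet> \<psi>))"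
      by (auto simp: max_def split: split_indicator)
    finally show ?thesis .
  qed
  \<comment> \<open>The exceptional null set of \<open>distr_X_AE\<close> is carried along by the
    reflection of time at \<open>T\<close>, which preserves null sets. For almost every
    \<open>s\<close> the law is thus known at the remaining time \<open>T - s\<close>.\<close>
  have "AE s in lborel. 0 < T + (-1) * s \<longrightarrow> distr M borel (X (T + (-1) * s)) = density lborel (q (T + (-1) * s))"
  proof -
    obtain N where N: "N \<in> null_sets lborel"
        "{\<tau>. \<not> (0 < \<tau> \<longrightarrow> distr M borel (X \<tau>) = density lborel (q \<tau>))} \<subseteq> N"
      using distr_X_AE by (auto simp: eventually_ae_filter)
    have [measurable]: "N \<in> sets borel" using N(1) by auto
    have "AE s in lborel. T + (-1) * s \<notin> N"
      by (rule AE_borel_affine[OF _ _ AE_not_in[OF N(1)]]) auto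
    then show ?thesis by eventually_elim (use N(2) in blast)
  qed
  then have eq: "AE s in lborel. (\<integral>r. (\<integral>x. w (T - s - x) * dens r x \<partial>lborel) * (P' r (f s) \<bullet> \<psi>) \<partial>lborel) =
      indicator {0<..<T} s * (Q (T - s) (f s) \<bullet> \<psi>)"
  proof eventually_elim
    case (elim s)
    show ?case
    proof (cases "0 < s \<and> s < T")
      case True
      then show ?thesis using elim by (simp add: integral_q_eq)
    next
      case False
      \<comment> \<open>The cut-off to \<open>{0<..<T}\<close> is automatic: \<open>f\<close>
        vanishes for \<open>s \<le> 0\<close>, and for \<open>s \<ge> T\<close> the argument of
        \<open>w\<close> is nonpositive wherever \<open>dens r\<close> is nonzero.\<close>
      have zero: "(\<integral>x. w (T - s - x) * dens r x \<partial>lborel) * (P' r (f s) \<bullet> \<psi>) = 0" for r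
      proof (cases "0 < s")
        case True
        then have "w (T - s - x) * dens r x = 0" for x
          using False by (cases "0 \<le> x") (auto simp: w_nonpos dens_def)
        then show ?thesis by (simp only: integral_zero mult_zero_left)
      qed (use f in \<open>simp add: admissible_def P'_def\<close>)
      have "(\<integral>r. (\<integral>x. w (T - s - x) * dens r x \<partial>lborel) * (P' r (f s) \<bullet> \<psi>) \<partial>lborel) = 0"
        unfolding zero by simp
      moreover have "indicator {0<..<T} s = (0 :: real)" using False by simp
      ultimately show ?thesis by (simp only: mult_zero_left)
    qed
  qed
  show "integrable lborel (\<lambda>s. indicator {0<..<T} s * (Q (T - s) (f s) \<bullet> \<psi>))"
    using integrable_cong_AE_imp[OF conv(2) meas] eq by (auto elim!: eventually_mono)
  show "(\<integral>t. w (T - t) * (U f t \<bullet> \<psi>) \<partial>lborel) = (\<integral>s. indicator {0<..<T} s * (Q (T - s) (f s) \<bullet> \<psi>) \<partial>lborel)"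
    unfolding conv(3) using eq meas conv(2) by (intro integral_cong_AE) auto
  show "integrable lborel (\<lambda>t. w (T - t) * (U f t \<bullet> \<psi>))" by (rule conv(1))
qed

lemma convolution_1_U:
  assumes f: "admissible f"
  shows "integrable lborel (\<lambda>s. \<integral>r. indicator {0<..} r * cdfS r (T - s) * (P' r (f s) \<bullet> \<psi>) \<partial>lborel)"
    and "(\<integral>t. indicator {..<T} t * (U f t \<bullet> \<psi>) \<partial>lborel) =
      (\<integral>s. \<integral>r. indicator {0<..} r * cdfS r (T - s) * (P' r (f s) \<bullet> \<psi>) \<partial>lborel \<partial>lborel)"
proof -
  have k_int: "(\<integral>\<^sup>+x. ennreal (exp (- x)) * ennreal (indicator {0<..} x) \<partial>lborel) < \<infinity>"
  proof -
    have "(\<integral>\<^sup>+x. ennreal (exp (- x)) * ennreal (indicator {0<..} x) \<partial>lborel) \<le> (\<integral>\<^sup>+x. ennreal (exp (- 1 * x)) * indicator {0..} x \<partial>lborel)"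
      by (intro nn_integral_mono) (auto split: split_indicator)
    also have "\<dots> < \<infinity>" by (subst nn_integral_exp_Ici) auto
    finally show ?thesis .
  qed
  have "(\<integral>x. indicator {0<..} (\<tau> - x) * dens r x \<partial>lborel) = indicator {0<..} r * cdfS r \<tau>" for \<tau> r
    by (cases "0 < r", simp add: integral_dens_atMost) (simp add: dens_def)
  note conv = convolution_U[OF f _ _ k_int, where T=T and \<psi>=\<psi>, unfolded this]
  show "integrable lborel (\<lambda>s. \<integral>r. indicator {0<..} r * cdfS r (T - s) * (P' r (f s) \<bullet> \<psi>) \<partial>lborel)"
    by (rule conv(2)) auto
  have "indicator {0<..} (T - t) = (indicator {..<T} t :: real)" for t
    by (auto split: split_indicator)
  then show "(\<integral>t. indicator {..<T} t * (U f t \<bullet> \<psi>) \<partial>lborel) =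
      (\<integral>s. \<integral>r. indicator {0<..} r * cdfS r (T - s) * (P' r (f s) \<bullet> \<psi>) \<partial>lborel \<partial>lborel)"
    using conv(3) by simp
qed

lemma cdfS_nonpos: "0 < r \<Longrightarrow> t \<le> 0 \<Longrightarrow> cdfS r t = 0"
proof -
  assume r: "0 < r" and t: "t \<le> 0"
  have "AE \<omega> in M. \<not> S r \<omega> \<le> t"
    using AE_S_neq[OF r, of 0] AE_space
  proof eventually_elim
    case (elim \<omega>)
    then show ?case using S_nonneg[of \<omega> r] r t by auto
  qed
  then show ?thesis
    using r by (intro measure_eq_0_null_sets) (auto simp: AE_iff_null_sets)
qed

lemma inner_U_iterated:
  assumes f: "admissible f"
  shows "U f t \<bullet> \<psi> = (\<integral>s. (\<integral>r. dens r (t - s) * (P' r (f s) \<bullet> \<psi>) \<partial>lborel) \<partial>lborel)"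
proof -
  have "integrable (lborel \<Otimes>\<^sub>M lborel) (\<lambda>z. (case z of (s, r) \<Rightarrow> dens r (t - s) *\<^sub>R P' r (f s)) \<bullet> \<psi>)"
    using integrable_U[OF f] by (intro integrable_inner_left)
  then show ?thesis
    unfolding inner_U[OF f] by (subst lborel_pair.integral_fst'[symmetric]) (auto simp: split_beta')
qed

text \<open>The right-hand side is the integral in \<open>inner_Q_dynkin\<close> once
  \<open>\<psi>\<close> is \<open>L x\<close>. So the increment \<open>Q t g - g\<close>, tested
  with \<open>x\<close>, is the response to a constant source, tested with \<open>L x\<close>, and
  the initial value needs no convolution lemma of its own.\<close>

lemma inner_U_const:
  "U (\<lambda>s. indicator {0<..} s *\<^sub>R g) t \<bullet> \<psi> = (\<integral>r. indicator {0<..} r * cdfS r t * (P' r g \<bullet> \<psi>) \<partial>lborel)"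
proof -
  have slice: "(\<integral>s. dens r (t - s) *\<^sub>R P' r (indicator {0<..} s *\<^sub>R g) \<partial>lborel) =
      (indicator {0<..} r * cdfS r t) *\<^sub>R P' r g" for r
  proof (cases "0 < r")
    case True
    have "(\<integral>s. dens r (t - s) *\<^sub>R P' r (indicator {0<..} s *\<^sub>R g) \<partial>lborel) =
        (\<integral>s. (indicator {0<..} s * dens r (t - s)) *\<^sub>R P' r g \<partial>lborel)"
      using True by (intro Bochner_Integration.integral_cong) (auto simp: P'_def P_scaleR split: split_indicator)
    also have "\<dots> = (\<integral>s. indicator {0<..} s * dens r (t - s) \<partial>lborel) *\<^sub>R P' r g"
    proof (rule integral_scaleR_left)
      have "integrable lborel (\<lambda>s. dens r (t + (- 1) * s))"
        by (rule lborel_integrable_real_affine[OF integrable_dens]) simp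
      then show "integrable lborel (\<lambda>s. indicator {0<..} s * dens r (t - s))"
        using integrable_mult_indicator[of "{0<..}" lborel "\<lambda>s. dens r (t - s)"] by simp
    qed
    also have "(\<integral>s. indicator {0<..} s * dens r (t - s) \<partial>lborel) = (\<integral>x. indicator {0<..} (t - x) * dens r x \<partial>lborel)"
      using lborel_integral_real_affine[of "-1" "\<lambda>s. indicator {0<..} s * dens r (t - s)" t] by simp
    finally show ?thesis using True by (simp add: integral_dens_atMost)
  qed (simp add: dens_def)
  have int: "integrable lborel (\<lambda>r. (indicator {0<..} r * cdfS r t) *\<^sub>R P' r g)"
    using lborel_pair.integrable_snd[OF integrable_U[OF admissible_const[of g], of t]] unfolding slice .
  have "U (\<lambda>s. indicator {0<..} s *\<^sub>R g) t \<bullet> \<psi> = (\<integral>r. (indicator {0<..} r * cdfS r t) *\<^sub>R P' r g \<partial>lborel) \<bullet> \<psi>"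
    unfolding U_eq_swap[OF admissible_const] slice ..
  also have "\<dots> = (\<integral>r. ((indicator {0<..} r * cdfS r t) *\<^sub>R P' r g) \<bullet> \<psi> \<partial>lborel)"
    by (rule integral_inner_left[OF int, symmetric])
  finally show ?thesis by simp
qed

lemma weak_form:
  assumes f: "admissible f" and x: "x \<in> D" and T: "0 < T"
  shows "integrable lborel (\<lambda>s. (indicator {0<..<T} s * w (T - s)) *\<^sub>R (Q s g + U f s - g))" (is ?int)
    and "(\<integral>s. (indicator {0<..<T} s * w (T - s)) *\<^sub>R (Q s g + U f s - g) \<partial>lborel) \<bullet> x =
      (\<integral>s. indicator {0<..T} s * (f s \<bullet> x) \<partial>lborel) +
      (\<integral>s. indicator {0<..T} s * ((Q s g + U f s) \<bullet> L x) \<partial>lborel)" (is ?eq)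
proof -
  obtain K where K: "0 \<le> K" "\<And>s. norm (f s) \<le> K * indicator {0<..} s"
    using admissible_bound[OF f] by blast
  note [measurable] = admissible_measurable[OF f]
  have [measurable]: "U f \<in> borel_measurable borel"
    by (rule borel_measurable_continuous_onI[OF continuous_U[OF f]])
  have Q_meas [measurable]: "(\<lambda>s. Q (max 0 s) g) \<in> borel_measurable borel"
    by (rule measurable_Q) auto
  note int_w = integrable_w_reflect[of T]
  have int_bounded: "integrable lborel (\<lambda>s. (indicator {0<..<T} s * w (T - s)) *\<^sub>R h s)"
    if [measurable]: "h \<in> borel_measurable borel" and h: "\<And>s. 0 < s \<Longrightarrow> s < T \<Longrightarrow> norm (h s) \<le> C" for h :: "real \<Rightarrow> 'b::{banach, second_countable_topology}" and C
  proof (rule Bochner_Integration.integrable_bound)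
    show "integrable lborel (\<lambda>s. C * (indicator {0<..<T} s * w (T - s)))"
      using int_w by simp
    show "AE s in lborel. norm ((indicator {0<..<T} s * w (T - s)) *\<^sub>R h s) \<le> norm (C * (indicator {0<..<T} s * w (T - s)))"
    proof (rule AE_I2)
      fix s
      show "norm ((indicator {0<..<T} s * w (T - s)) *\<^sub>R h s) \<le> norm (C * (indicator {0<..<T} s * w (T - s)))"
        using w_nonneg[of "T - s"] mult_right_mono[OF order_trans[OF h abs_ge_self], of s "w (T - s)"]
        by (auto simp: abs_mult mult.commute split: split_indicator)
    qed
  qed measurable
  have U_le: "norm (U f s) \<le> K * exp T / \<phi> 1" if "s < T" for s
  proof -
    have "norm (U f s) \<le> K * exp s / \<phi> 1" by (rule norm_U_le(2)[OF f K])
    also have "\<dots> \<le> K * exp T / \<phi> 1"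
      using that K(1) phi_pos[of 1] by (intro divide_right_mono mult_left_mono) auto
    finally show ?thesis .
  qed
  have "integrable lborel (\<lambda>s. (indicator {0<..<T} s * w (T - s)) *\<^sub>R (Q (max 0 s) g + U f s - g))"
  proof (rule int_bounded)
    fix s :: real assume s: "0 < s" "s < T"
    have "norm (Q (max 0 s) g + U f s - g) \<le> norm (Q (max 0 s) g) + norm (U f s) + norm g"
      by (meson norm_triangle_ineq4 norm_triangle_ineq add_right_mono order_trans)
    also have "\<dots> \<le> norm g + K * exp T / \<phi> 1 + norm g"
      using s by (intro add_mono U_le norm_Q_le) auto
    finally show "norm (Q (max 0 s) g + U f s - g) \<le> norm g + K * exp T / \<phi> 1 + norm g" .
  qed measurable
  also have "(\<lambda>s. (indicator {0<..<T} s * w (T - s)) *\<^sub>R (Q (max 0 s) g + U f s - g)) =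
      (\<lambda>s. (indicator {0<..<T} s * w (T - s)) *\<^sub>R (Q s g + U f s - g))"
    by (auto simp: max_def split: split_indicator)
  finally show int: ?int .
  let ?G = "\<lambda>s. indicator {0<..} s *\<^sub>R g"
  note G = admissible_const[of g]
  \<comment> \<open>Dynkin's formula moves \<open>L\<close> to the test vector in the term with
    \<open>g\<close>. Outside \<open>{0<..<T}\<close> both sides vanish, since \<open>w\<close> is 0
    from 0 downwards and so is \<open>U\<close>.\<close>
  have split: "((indicator {0<..<T} s * w (T - s)) *\<^sub>R (Q s g + U f s - g)) \<bullet> x =
      w (T - s) * (U ?G s \<bullet> L x) + w (T - s) * (U f s \<bullet> x)" for s
  proof (cases "0 < s \<and> s < T")
    case True
    then have "Q s g \<bullet> x - g \<bullet> x = U ?G s \<bullet> L x"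
      using inner_Q_dynkin[OF _ x, of s g] by (simp add: inner_U_const)
    then show ?thesis using True by (simp add: inner_add_left inner_diff_left algebra_simps)
  next
    case False
    then have "w (T - s) = 0 \<or> U ?G s = 0 \<and> U f s = 0"
      using w_nonpos[of "T - s"] U_nonpos[OF f, of s] U_nonpos[OF G, of s] by auto
    then show ?thesis using False by auto
  qed
  have reflect: "(\<integral>s. indicator {0<..<T} s * (Q (T - s) (?G s) \<bullet> L x) \<partial>lborel) =
      (\<integral>s. indicator {0<..<T} s * (Q s g \<bullet> L x) \<partial>lborel)"
  proof -
    have "(\<integral>s. indicator {0<..<T} s * (Q (T - s) (?G s) \<bullet> L x) \<partial>lborel) =
        (\<integral>s. indicator {0<..<T} (T - s) * (Q (T - s) g \<bullet> L x) \<partial>lborel)"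
      by (intro Bochner_Integration.integral_cong) (auto split: split_indicator)
    also have "\<dots> = (\<integral>s. indicator {0<..<T} s * (Q s g \<bullet> L x) \<partial>lborel)"
      using lborel_integral_real_affine[of "-1" "\<lambda>s. indicator {0<..<T} s * (Q s g \<bullet> L x)" T] by simp
    finally show ?thesis .
  qed
  have int_f: "integrable lborel (\<lambda>s. indicator {0<..<T} s * (f s \<bullet> x))"
  proof (rule Bochner_Integration.integrable_bound)
    show "integrable lborel (\<lambda>s. indicator {0<..<T} s * (K * norm x))" using T by simp
    show "AE s in lborel. norm (indicator {0<..<T} s * (f s \<bullet> x)) \<le> norm (indicator {0<..<T} s * (K * norm x))"
    proof (rule AE_I2)
      fix s
      show "norm (indicator {0<..<T} s * (f s \<bullet> x)) \<le> norm (indicator {0<..<T} s * (K * norm x))"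
        using Cauchy_Schwarz_ineq2[of "f s" x] mult_right_mono[OF K(2)[of s] norm_ge_zero[of x]] K(1)
        by (auto simp: abs_mult split: split_indicator)
    qed
  qed measurable
  note conv1 = convolution_1_U[OF f, where T=T and \<psi>="L x"]
  \<comment> \<open>Dynkin's formula again, now at the remaining time \<open>T - s\<close> and for
    the vector \<open>f s\<close>: the constant part yields the integral of the source, and the rest
    is the convolution of \<open>U f\<close> with the kernel 1.\<close>
  have f_part: "(\<integral>s. indicator {0<..<T} s * (Q (T - s) (f s) \<bullet> x) \<partial>lborel) =
      (\<integral>s. indicator {0<..<T} s * (f s \<bullet> x) \<partial>lborel) + (\<integral>t. indicator {..<T} t * (U f t \<bullet> L x) \<partial>lborel)"
  proof -
    have "indicator {0<..<T} s * (Q (T - s) (f s) \<bullet> x) = indicator {0<..<T} s * (f s \<bullet> x) +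
        (\<integral>r. indicator {0<..} r * cdfS r (T - s) * (P' r (f s) \<bullet> L x) \<partial>lborel)" for s
    proof (cases "0 < s \<and> s < T")
      case True
      then show ?thesis using inner_Q_dynkin[OF _ x, of "T - s" "f s"] by simp
    next
      case False
      have zero: "indicator {0<..} r * cdfS r (T - s) * (P' r (f s) \<bullet> L x) = 0" for r
      proof (cases "0 < s")
        case True
        then show ?thesis using False cdfS_nonpos[of r "T - s"] by (cases "0 < r") auto
      qed (use f in \<open>simp add: admissible_def P'_def\<close>)
      show ?thesis using False unfolding zero by (auto split: split_indicator)
    qed
    then show ?thesis
      using conv1 int_f by simp
  qed
  have Qx: "(\<lambda>s. indicator {0<..<T} s * (Q s g \<bullet> L x)) = (\<lambda>s. indicator {0<..<T} s * (Q (max 0 s) g \<bullet> L x))"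
    by (auto simp: max_def split: split_indicator)
  have int_Q: "integrable lborel (\<lambda>s. indicator {0<..<T} s * (Q s g \<bullet> L x))"
    unfolding Qx
  proof (rule Bochner_Integration.integrable_bound)
    show "integrable lborel (\<lambda>s. indicator {0<..<T} s * (norm g * norm (L x)))" using T by simp
    show "AE s in lborel. norm (indicator {0<..<T} s * (Q (max 0 s) g \<bullet> L x)) \<le> norm (indicator {0<..<T} s * (norm g * norm (L x)))"
    proof (rule AE_I2)
      fix s :: real
      show "norm (indicator {0<..<T} s * (Q (max 0 s) g \<bullet> L x)) \<le> norm (indicator {0<..<T} s * (norm g * norm (L x)))"
        using Cauchy_Schwarz_ineq2[of "Q (max 0 s) g" "L x"] mult_right_mono[OF norm_Q_le[of "max 0 s" g] norm_ge_zero[of "L x"]]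
        by (auto simp: abs_mult split: split_indicator)
    qed
  qed measurable
  have int_U: "integrable lborel (\<lambda>s. indicator {0<..<T} s * (U f s \<bullet> L x))"
  proof (rule Bochner_Integration.integrable_bound)
    show "integrable lborel (\<lambda>s. indicator {0<..<T} s * (K * exp T / \<phi> 1 * norm (L x)))" using T by simp
    show "AE s in lborel. norm (indicator {0<..<T} s * (U f s \<bullet> L x)) \<le> norm (indicator {0<..<T} s * (K * exp T / \<phi> 1 * norm (L x)))"
    proof (rule AE_I2)
      fix s :: real
      show "norm (indicator {0<..<T} s * (U f s \<bullet> L x)) \<le> norm (indicator {0<..<T} s * (K * exp T / \<phi> 1 * norm (L x)))"
      proof (cases "s \<in> {0<..<T}")
        case True
        have "\<bar>U f s \<bullet> L x\<bar> \<le> K * exp T / \<phi> 1 * norm (L x)"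
          using True by (intro order_trans[OF Cauchy_Schwarz_ineq2] mult_right_mono U_le) auto
        then show ?thesis using True by (simp only: indicator_simps real_norm_def mult_1_left)
      qed simp
    qed
  qed measurable
  \<comment> \<open>The endpoint is a null set, but measurability is given on the open interval
    only, so the value at \<open>T\<close> is added by hand.\<close>
  have closed: "(\<integral>s. indicator {0<..T} s * h s \<partial>lborel) = (\<integral>s. indicator {0<..<T} s * h s \<partial>lborel)"
    if "(\<lambda>s. indicator {0<..<T} s * h s) \<in> borel_measurable lborel" for h :: "real \<Rightarrow> real"
  proof (rule integral_cong_AE)
    have "(\<lambda>s. indicator {0<..<T} s * h s + indicator {T} s * h T) \<in> borel_measurable lborel"
      using that by measurable
    also have "(\<lambda>s. indicator {0<..<T} s * h s + indicator {T} s * h T) = (\<lambda>s. indicator {0<..T} s * h s)"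
      using T by (auto split: split_indicator)
    finally show "(\<lambda>s. indicator {0<..T} s * h s) \<in> borel_measurable lborel" .
    show "AE s in lborel. indicator {0<..T} s * h s = indicator {0<..<T} s * h s"
      using AE_lborel_singleton[of T] by eventually_elim (auto split: split_indicator)
  qed (use that in simp)
  have "(\<integral>s. (indicator {0<..<T} s * w (T - s)) *\<^sub>R (Q s g + U f s - g) \<partial>lborel) \<bullet> x =
      (\<integral>s. w (T - s) * (U ?G s \<bullet> L x) + w (T - s) * (U f s \<bullet> x) \<partial>lborel)"
    unfolding split[symmetric] by (rule integral_inner_left[OF int, symmetric])
  also have "\<dots> = (\<integral>s. w (T - s) * (U ?G s \<bullet> L x) \<partial>lborel) + (\<integral>s. w (T - s) * (U f s \<bullet> x) \<partial>lborel)"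
    by (intro Bochner_Integration.integral_add convolution_w_U(3) G f)
  also have "\<dots> = (\<integral>s. indicator {0<..<T} s * (Q s g \<bullet> L x) \<partial>lborel) +
      ((\<integral>s. indicator {0<..<T} s * (f s \<bullet> x) \<partial>lborel) + (\<integral>t. indicator {..<T} t * (U f t \<bullet> L x) \<partial>lborel))"
    unfolding convolution_w_U(2)[OF G] convolution_w_U(2)[OF f] reflect f_part ..
  also have "(\<integral>t. indicator {..<T} t * (U f t \<bullet> L x) \<partial>lborel) = (\<integral>t. indicator {0<..<T} t * (U f t \<bullet> L x) \<partial>lborel)"
    by (intro Bochner_Integration.integral_cong) (auto simp: U_nonpos[OF f] not_less split: split_indicator)
  finally have main: "(\<integral>s. (indicator {0<..<T} s * w (T - s)) *\<^sub>R (Q s g + U f s - g) \<partial>lborel) \<bullet> x =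
      (\<integral>s. indicator {0<..<T} s * (Q s g \<bullet> L x) \<partial>lborel) +
      ((\<integral>s. indicator {0<..<T} s * (f s \<bullet> x) \<partial>lborel) + (\<integral>t. indicator {0<..<T} t * (U f t \<bullet> L x) \<partial>lborel))" .
  have "(\<integral>s. indicator {0<..T} s * ((Q s g + U f s) \<bullet> L x) \<partial>lborel) =
      (\<integral>s. indicator {0<..<T} s * (Q s g \<bullet> L x) + indicator {0<..<T} s * (U f s \<bullet> L x) \<partial>lborel)"
    using borel_measurable_integrable[OF Bochner_Integration.integrable_add[OF int_Q int_U]]
    by (subst closed) (simp_all add: inner_add_left distrib_left)
  also have "\<dots> = (\<integral>s. indicator {0<..<T} s * (Q s g \<bullet> L x) \<partial>lborel) + (\<integral>s. indicator {0<..<T} s * (U f s \<bullet> L x) \<partial>lborel)"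
    by (rule Bochner_Integration.integral_add[OF int_Q int_U])
  finally have rhs: "(\<integral>s. indicator {0<..T} s * ((Q s g + U f s) \<bullet> L x) \<partial>lborel) =
      (\<integral>s. indicator {0<..<T} s * (Q s g \<bullet> L x) \<partial>lborel) + (\<integral>s. indicator {0<..<T} s * (U f s \<bullet> L x) \<partial>lborel)" .
  have "(\<integral>s. indicator {0<..T} s * (f s \<bullet> x) \<partial>lborel) = (\<integral>s. indicator {0<..<T} s * (f s \<bullet> x) \<partial>lborel)"
    by (rule closed[OF borel_measurable_integrable[OF int_f]])
  then show ?eq using main rhs by simp
qed

section \<open>Smoothing by \<open>Q\<close> and preservation of the domain by
  \<open>U\<close>\<close>

lemma zero_in_D: "0 \<in> D" "L 0 = 0"
proof -
  have "D \<noteq> {}" using D_dense by auto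
  then obtain x where "x \<in> D" by blast
  then show "0 \<in> D" "L 0 = 0" using L_linear[of x x "-1"] by simp_all
qed

lemma Q_in_D:
  assumes t: "0 \<le> t" and x: "x \<in> D"
  shows "Q t x \<in> D" "L (Q t x) = Q t (L x)"
proof -
  have "Q t x \<bullet> L y = Q t (L x) \<bullet> y" if y: "y \<in> D" for y
    using t x y by (simp add: inner_Q inner_L_P X_nonneg)
  note weak = this
  show "Q t x \<in> D" "L (Q t x) = Q t (L x)" using in_D_if_weak[OF weak] by auto
qed

lemma norm_Q_L_le:
  assumes a: "0 < a" "a \<le> t" and x: "x \<in> D"
  shows "norm (Q t (L x)) \<le> \<phi> (1 / a) / (1 - exp (- 1)) * norm x"
  unfolding Q_def
proof (rule norm_integral_P_L_le[OF finite_measure_axioms _ X_nonneg _ _ x])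
  show "emeasure M {\<omega>\<in>space M. X t \<omega> \<le> R} \<le> ennreal (\<phi> (1 / a) / (1 - exp (- 1))) * ennreal R" if "0 \<le> R" for R
    by (rule emeasure_X_le[OF a that])
qed (use a phi_pos[of "1 / a"] in auto)

text \<open>The point is that \<open>L \<circ> Q t\<close> is bounded on the dense set \<open>D\<close>.\<close>

lemma Q_smoothing:
  shows "0 < t \<Longrightarrow> Q t h \<in> D" and "continuous_on {0<..} (\<lambda>t. L (Q t h))"
proof -
  have "\<exists>x. (\<forall>n. x n \<in> D) \<and> x \<longlonglongrightarrow> h"
    using closure_sequential[of h D] D_dense by auto
  then obtain x where x: "\<And>n::nat. x n \<in> D" "x \<longlonglongrightarrow> h" by blast
  define C where "C a = \<phi> (1 / a) / (1 - exp (- 1))" for a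
  have C: "0 \<le> C a" if "0 < a" for a
    using phi_pos[of "1 / a"] that by (simp add: C_def)
  have diff: "norm (Q t (L (x n)) - Q t (L (x m))) \<le> C a * norm (x n - x m)" if "0 < a" "a \<le> t" for a t n m
  proof -
    have "x n - x m \<in> D" "L (x n - x m) = L (x n) - L (x m)"
      using L_linear[of "x m" "x n" "-1"] x(1) by simp_all
    then show ?thesis
      using norm_Q_L_le[OF that, of "x n - x m"] that by (simp add: C_def Q_diff)
  qed
  have conv: "convergent (\<lambda>n. Q t (L (x n)))" if t: "0 < t" for t
  proof (rule Cauchy_convergent, rule CauchyI)
    fix e :: real assume e: "0 < e"
    \<comment> \<open>Only \<open>0 \<le> C t\<close> has been recorded; the summand 1 avoids a
      division by zero.\<close>
    define e' where "e' = e / (C t + 1)"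
    have e': "0 < e'" using e C[OF t] by (simp add: e'_def)
    obtain N where N: "\<And>m n. N \<le> m \<Longrightarrow> N \<le> n \<Longrightarrow> norm (x m - x n) < e'"
      using CauchyD[OF LIMSEQ_imp_Cauchy[OF x(2)] e'] by blast
    have "norm (Q t (L (x m)) - Q t (L (x n))) < e" if "N \<le> m" "N \<le> n" for m n
    proof -
      have "norm (Q t (L (x m)) - Q t (L (x n))) \<le> C t * norm (x m - x n)"
        by (rule diff[OF t order_refl])
      also have "\<dots> \<le> (C t + 1) * norm (x m - x n)" by (intro mult_right_mono) auto
      also have "\<dots> < (C t + 1) * e'"
        using N[OF that] C[OF t] by (intro mult_strict_left_mono) auto
      also have "\<dots> = e" using C[OF t] by (simp add: e'_def)
      finally show ?thesis .
    qed
    then show "\<exists>N. \<forall>m\<ge>N. \<forall>n\<ge>N. norm (Q t (L (x m)) - Q t (L (x n))) < e" by blast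
  qed
  define l where "l t = lim (\<lambda>n. Q t (L (x n)))" for t
  have l: "(\<lambda>n. Q t (L (x n))) \<longlonglongrightarrow> l t" if "0 < t" for t
    using conv[OF that] by (simp add: l_def convergent_LIMSEQ_iff)
  have Q_lim: "(\<lambda>n. Q t (x n)) \<longlonglongrightarrow> Q t h" if "0 \<le> t" for t
  proof (rule LIM_zero_cancel, rule Lim_null_comparison)
    show "\<forall>\<^sub>F n in sequentially. norm (Q t (x n) - Q t h) \<le> norm (x n - h)"
      using norm_Q_le[OF that] that by (simp add: Q_diff[symmetric])
    show "(\<lambda>n. norm (x n - h)) \<longlonglongrightarrow> 0"
      by (intro tendsto_norm_zero LIM_zero x(2))
  qed
  \<comment> \<open>The approximants satisfy the weak identity by symmetry of \<open>L\<close>, and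
    it survives the limit because only inner products with fixed vectors occur.\<close>
  have Q_D: "Q t h \<in> D" "L (Q t h) = l t" if t: "0 < t" for t
  proof -
    have "Q t h \<bullet> L y = l t \<bullet> y" if y: "y \<in> D" for y
    proof (rule LIMSEQ_unique)
      show "(\<lambda>n. Q t (x n) \<bullet> L y) \<longlonglongrightarrow> Q t h \<bullet> L y"
        using t by (intro tendsto_intros Q_lim) simp
      have "Q t (x n) \<bullet> L y = Q t (L (x n)) \<bullet> y" for n
        using L_symmetric[OF Q_in_D(1)[OF less_imp_le[OF t] x(1)] y, of n] Q_in_D(2)[OF less_imp_le[OF t] x(1), of n] by simp
      then show "(\<lambda>n. Q t (x n) \<bullet> L y) \<longlonglongrightarrow> l t \<bullet> y"
        using l[OF t] by (simp add: tendsto_inner)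
    qed
    note weak = this
    show "Q t h \<in> D" "L (Q t h) = l t" using in_D_if_weak[OF weak] by auto
  qed
  then show "0 < t \<Longrightarrow> Q t h \<in> D" by blast
  have near: "norm (Q t (L (x n)) - l t) \<le> C a * norm (x n - h)" if "0 < a" "a \<le> t" for a t n
  proof (rule LIMSEQ_le)
    show "(\<lambda>m. norm (Q t (L (x n)) - Q t (L (x m)))) \<longlonglongrightarrow> norm (Q t (L (x n)) - l t)"
      using that by (intro tendsto_intros l) simp
    show "(\<lambda>m. C a * norm (x n - x m)) \<longlonglongrightarrow> C a * norm (x n - h)"
      by (intro tendsto_intros x(2))
    show "\<exists>N. \<forall>m\<ge>N. norm (Q t (L (x n)) - Q t (L (x m))) \<le> C a * norm (x n - x m)"
      using diff[OF that] by blast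
  qed
  \<comment> \<open>One constant \<open>C a\<close> serves all \<open>t \<ge> a\<close>, so the
    continuous approximants converge uniformly on \<open>{a<..}\<close>. Continuity on
    \<open>{0<..}\<close> is collected from these half-lines.\<close>
  have cont_a: "continuous_on {a<..} l" if a: "0 < a" for a
  proof (rule uniform_limit_theorem)
    show "\<forall>\<^sub>F n in sequentially. continuous_on {a<..} (\<lambda>t. Q t (L (x n)))"
      using a by (intro always_eventually allI continuous_on_subset[OF continuous_Q]) auto
    show "uniform_limit {a<..} (\<lambda>n t. Q t (L (x n))) l sequentially"
    proof (rule uniform_limitI)
      fix e :: real assume e: "0 < e"
      have "(\<lambda>n. C a * norm (x n - h)) \<longlonglongrightarrow> C a * 0"
        by (intro tendsto_intros tendsto_norm_zero LIM_zero x(2))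
      then have "\<forall>\<^sub>F n in sequentially. C a * norm (x n - h) < e"
        using e by (intro order_tendstoD(2)) auto
      then show "\<forall>\<^sub>F n in sequentially. \<forall>t\<in>{a<..}. dist (Q t (L (x n))) (l t) < e"
      proof eventually_elim
        case (elim n)
        show ?case
        proof
          fix t assume "t \<in> {a<..}"
          then show "dist (Q t (L (x n))) (l t) < e"
            using near[of a t n] a elim by (simp add: dist_norm)
        qed
      qed
    qed
  qed simp
  have "continuous_on {0<..} l"
    unfolding continuous_on_eq_continuous_at[OF open_greaterThan]
  proof
    fix t :: real assume "t \<in> {0<..}"
    then show "isCont l t"
      using cont_a[of "t / 2"] by (auto simp: continuous_on_eq_continuous_at)
  qed
  then show "continuous_on {0<..} (\<lambda>t. L (Q t h))"
    by (rule continuous_on_eq) (simp add: Q_D)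
qed

text \<open>Testing with \<open>y\<close> in \<open>D\<close> reduces the claim to
  \<open>inner_L_P'\<close> under the integral sign, at almost every \<open>s\<close>; the weak
  criterion does the rest.\<close>

lemma U_in_D:
  assumes f: "admissible f" and f': "admissible f'" and AE: "AE s in lborel. f s \<in> D \<and> L (f s) = f' s"
  shows "U f t \<in> D" "L (U f t) = U f' t"
proof -
  note [measurable] = admissible_measurable[OF f] admissible_measurable[OF f']
  have "U f t \<bullet> L y = U f' t \<bullet> y" if y: "y \<in> D" for y
    unfolding inner_U_iterated[OF f] inner_U_iterated[OF f']
  proof (rule integral_cong_AE)
    show "AE s in lborel. (\<integral>r. dens r (t - s) * (P' r (f s) \<bullet> L y) \<partial>lborel) =
        (\<integral>r. dens r (t - s) * (P' r (f' s) \<bullet> y) \<partial>lborel)"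
      using AE
    proof eventually_elim
      case (elim s)
      then have "P' r (f s) \<bullet> L y = P' r (f' s) \<bullet> y" for r
        using inner_L_P'[of "f s" y r] y by simp
      then show ?case by simp
    qed
  qed measurable
  note weak = this
  show "U f t \<in> D" "L (U f t) = U f' t" using in_D_if_weak[OF weak] by auto
qed

end

section \<open>Uniqueness\<close>

lemma integral_indicator_mono_gt:
  fixes e :: "real \<Rightarrow> 'h::{real_inner, banach, second_countable_topology}"
  assumes "integrable lborel e" "a \<le> b"
  shows "(\<integral>s. indicator {0<..b} s *\<^sub>R e s \<partial>lborel) - (\<integral>s. indicator {0<..a} s *\<^sub>R e s \<partial>lborel) =
    (\<integral>s. indicator {max 0 a<..b} s *\<^sub>R e s \<partial>lborel)"
proof -
  have int: "integrable lborel (\<lambda>s. indicator {c<..d} s *\<^sub>R e s)" for c d :: real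
    using assms(1) by (intro integrable_mult_indicator) auto
  have "(\<integral>s. indicator {0<..b} s *\<^sub>R e s \<partial>lborel) - (\<integral>s. indicator {0<..a} s *\<^sub>R e s \<partial>lborel) =
      (\<integral>s. indicator {0<..b} s *\<^sub>R e s - indicator {0<..a} s *\<^sub>R e s \<partial>lborel)"
    by (rule Bochner_Integration.integral_diff[symmetric]) (rule int)+
  also have "\<dots> = (\<integral>s. indicator {max 0 a<..b} s *\<^sub>R e s \<partial>lborel)"
    using assms(2) by (intro Bochner_Integration.integral_cong) (auto split: split_indicator)
  finally show ?thesis .
qed

context fractional_equation begin

text \<open>Write \<open>w (T - s)\<close> as the \<open>\<nu>\<close>-mass of
  \<open>z > T - s\<close> and integrate over \<open>s\<close> first: what remains is the increment
  of the primitive over the last \<open>z\<close> units of time. This Marchaud form replaces values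
  of \<open>e\<close> by increments of \<open>y\<close>, which is what a maximum principle can
  control.\<close>

lemma convolution_w_eq_nu_integral:
  fixes e :: "real \<Rightarrow> 'h"
  assumes e [measurable]: "e \<in> borel_measurable borel" and int: "integrable lborel e"
    and B: "\<And>s. norm (e s) \<le> B" and T: "0 < T"
  defines "y \<equiv> (\<lambda>t. \<integral>s. indicator {0<..t} s *\<^sub>R e s \<partial>lborel)"
  shows "integrable \<nu> (\<lambda>z. (y T - y (max 0 (T - z))) \<bullet> v)"
    and "(\<integral>s. (indicator {0<..<T} s * w (T - s)) *\<^sub>R e s \<partial>lborel) \<bullet> v =
      (\<integral>z. (y T - y (max 0 (T - z))) \<bullet> v \<partial>\<nu>)"
proof -
  interpret pair_sigma_finite lborel \<nu> ..
  define F where "F s z = indicator {0<..<T} s * indicator {T - s<..} z * (e s \<bullet> v)" for s z :: real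
  have ind: "(\<lambda>(s, z). indicator {T - s<..} z :: real) \<in> borel_measurable (lborel \<Otimes>\<^sub>M \<nu>)"
    unfolding indicator_def greaterThan_iff by measurable
  have F_meas: "(\<lambda>(s, z). F s z) \<in> borel_measurable (lborel \<Otimes>\<^sub>M \<nu>)"
    using ind unfolding F_def split_beta' by measurable
  have B0: "0 \<le> B" using B[of 0] norm_ge_zero order_trans by blast
  note int_w = integrable_w_reflect[of T]
  have nn_z: "(\<integral>\<^sup>+z. ennreal (norm (F s z)) \<partial>\<nu>) = ennreal (indicator {0<..<T} s * w (T - s) * \<bar>e s \<bullet> v\<bar>)" for s
  proof -
    have "(\<integral>\<^sup>+z. ennreal (norm (F s z)) \<partial>\<nu>) = (\<integral>\<^sup>+z. ennreal (indicator {0<..<T} s * \<bar>e s \<bullet> v\<bar>) * indicator {T - s<..} z \<partial>\<nu>)"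
      by (intro nn_integral_cong) (auto simp: F_def abs_mult split: split_indicator)
    also have "\<dots> = ennreal (indicator {0<..<T} s * \<bar>e s \<bullet> v\<bar>) * emeasure \<nu> {T - s<..}"
      by (subst nn_integral_cmult_indicator) auto
    also have "\<dots> = ennreal (indicator {0<..<T} s * w (T - s) * \<bar>e s \<bullet> v\<bar>)"
      using ennreal_w[of "T - s"] w_nonneg[of "T - s"]
      by (auto simp: ennreal_mult mult.commute split: split_indicator)
    finally show ?thesis .
  qed
  have F_int: "integrable (lborel \<Otimes>\<^sub>M \<nu>) (\<lambda>(s, z). F s z)"
  proof (rule integrableI_bounded[OF F_meas])
    have "(\<integral>\<^sup>+x. ennreal (norm (case x of (s, z) \<Rightarrow> F s z)) \<partial>(lborel \<Otimes>\<^sub>M \<nu>)) =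
        (\<integral>\<^sup>+s. \<integral>\<^sup>+z. ennreal (norm (F s z)) \<partial>\<nu> \<partial>lborel)"
      using F_meas by (subst nu.nn_integral_fst[symmetric]) (auto simp: split_beta')
    also have "\<dots> \<le> (\<integral>\<^sup>+s. ennreal (B * norm v) * ennreal (indicator {0<..<T} s * w (T - s)) \<partial>lborel)"
      unfolding nn_z
    proof (intro nn_integral_mono)
      fix s
      have "\<bar>e s \<bullet> v\<bar> \<le> B * norm v"
        by (rule order_trans[OF Cauchy_Schwarz_ineq2 mult_right_mono[OF B norm_ge_zero]])
      then have "indicator {0<..<T} s * w (T - s) * \<bar>e s \<bullet> v\<bar> \<le> indicator {0<..<T} s * w (T - s) * (B * norm v)"
        using w_nonneg by (intro mult_left_mono) auto
      then show "ennreal (indicator {0<..<T} s * w (T - s) * \<bar>e s \<bullet> v\<bar>) \<le>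
          ennreal (B * norm v) * ennreal (indicator {0<..<T} s * w (T - s))"
        using w_nonneg B0 by (subst ennreal_mult[symmetric]) (auto intro!: ennreal_leI simp: mult.commute)
    qed
    also have "\<dots> = ennreal (B * norm v) * (\<integral>\<^sup>+s. ennreal (indicator {0<..<T} s * w (T - s)) \<partial>lborel)"
      by (intro nn_integral_cmult) measurable
    also have "(\<integral>\<^sup>+s. ennreal (indicator {0<..<T} s * w (T - s)) \<partial>lborel) =
        ennreal (\<integral>s. indicator {0<..<T} s * w (T - s) \<partial>lborel)"
      using w_nonneg by (intro nn_integral_eq_integral int_w) auto
    also have "ennreal (B * norm v) * \<dots> < \<infinity>" by (simp add: ennreal_mult_less_top)
    finally show "(\<integral>\<^sup>+x. ennreal (norm (case x of (s, z) \<Rightarrow> F s z)) \<partial>(lborel \<Otimes>\<^sub>M \<nu>)) < \<infinity>" .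
  qed
  have Fs: "(\<integral>z. F s z \<partial>\<nu>) = ((indicator {0<..<T} s * w (T - s)) *\<^sub>R e s) \<bullet> v" for s
  proof -
    have "(\<integral>z. F s z \<partial>\<nu>) = (\<integral>z. indicator {0<..<T} s * (e s \<bullet> v) * indicator {T - s<..} z \<partial>\<nu>)"
      unfolding F_def by (simp add: mult_ac)
    also have "\<dots> = indicator {0<..<T} s * (e s \<bullet> v) * w (T - s)"
      by (simp add: levy_tail_def sets_eq_imp_space_eq[OF sets_nu])
    finally show ?thesis by simp
  qed
  have Fz: "(\<integral>s. F s z \<partial>lborel) = (y T - y (max 0 (T - z))) \<bullet> v" if z: "0 < z" for z
  proof -
    have "y T - y (max 0 (T - z)) = (\<integral>s. indicator {max 0 (max 0 (T - z))<..T} s *\<^sub>R e s \<partial>lborel)"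
      unfolding y_def using z T by (intro integral_indicator_mono_gt int) auto
    then have "(y T - y (max 0 (T - z))) \<bullet> v = (\<integral>s. indicator {max 0 (T - z)<..T} s *\<^sub>R e s \<partial>lborel) \<bullet> v"
      by simp
    also have "\<dots> = (\<integral>s. indicator {max 0 (T - z)<..T} s * (e s \<bullet> v) \<partial>lborel)"
      using integrable_mult_indicator[OF _ int, of "{max 0 (T - z)<..T}"]
      by (subst integral_inner_left[symmetric]) auto
    also have "\<dots> = (\<integral>s. F s z \<partial>lborel)"
    proof (rule integral_cong_AE)
      show "AE s in lborel. indicator {max 0 (T - z)<..T} s * (e s \<bullet> v) = F s z"
        using AE_lborel_singleton[of T] by eventually_elim (use z in \<open>auto simp: F_def split: split_indicator\<close>)
      show "(\<lambda>s. F s z) \<in> borel_measurable lborel"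
        unfolding F_def indicator_def greaterThan_iff by measurable
    qed measurable
    finally show ?thesis ..
  qed
  have int_Fz: "integrable \<nu> (\<lambda>z. \<integral>s. F s z \<partial>lborel)"
    by (rule integrable_snd[OF F_int])
  \<comment> \<open>Continuity serves only the measurability of the integrand in
    \<open>z\<close>.\<close>
  have y_cont: "continuous_on UNIV y"
  proof (rule continuous_on_sequentiallyI)
    fix t :: "nat \<Rightarrow> real" and a assume t: "t \<longlonglongrightarrow> a"
    show "(\<lambda>n. y (t n)) \<longlonglongrightarrow> y a"
      unfolding y_def
    proof (rule integral_dominated_convergence)
      show "integrable lborel (\<lambda>s. norm (e s))" using int by simp
      show "AE s in lborel. (\<lambda>n. indicator {0<..t n} s *\<^sub>R e s) \<longlonglongrightarrow> indicator {0<..a} s *\<^sub>R e s"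
        using AE_lborel_singleton[of a]
      proof eventually_elim
        case (elim s)
        have "eventually (\<lambda>n. (s \<le> t n) = (s \<le> a)) sequentially"
        proof (cases "s < a")
          case True
          then show ?thesis using order_tendstoD(1)[OF t True] by (auto elim!: eventually_mono)
        next
          case False
          then have "a < s" using elim by simp
          then show ?thesis using order_tendstoD(2)[OF t \<open>a < s\<close>] by (auto elim!: eventually_mono)
        qed
        then have "eventually (\<lambda>n. indicator {0<..t n} s *\<^sub>R e s = indicator {0<..a} s *\<^sub>R e s) sequentially"
          by eventually_elim (auto simp: indicator_def)
        then show ?case by (rule tendsto_eventually)
      qed
      show "AE s in lborel. norm (indicator {0<..t n} s *\<^sub>R e s) \<le> norm (e s)" for n
        by (auto split: split_indicator)
    qed measurable
  qed
  have y_meas [measurable]: "y \<in> borel_measurable borel"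
    by (rule borel_measurable_continuous_onI[OF y_cont])
  have AE: "AE z in \<nu>. (\<integral>s. F s z \<partial>lborel) = (y T - y (max 0 (T - z))) \<bullet> v"
    using AE_nu_pos by eventually_elim (rule Fz)
  show "integrable \<nu> (\<lambda>z. (y T - y (max 0 (T - z))) \<bullet> v)"
    by (rule integrable_cong_AE_imp[OF int_Fz _ AE]) measurable
  have "integrable lborel (\<lambda>s. (indicator {0<..<T} s * w (T - s)) *\<^sub>R e s)"
  proof (rule Bochner_Integration.integrable_bound)
    show "integrable lborel (\<lambda>s. B * (indicator {0<..<T} s * w (T - s)))"
      using int_w by simp
    show "AE s in lborel. norm ((indicator {0<..<T} s * w (T - s)) *\<^sub>R e s) \<le> norm (B * (indicator {0<..<T} s * w (T - s)))"
      using B B0 w_nonneg by (intro AE_I2) (auto simp: abs_mult mult.commute intro!: mult_right_mono split: split_indicator)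
  qed measurable
  then have "(\<integral>s. (indicator {0<..<T} s * w (T - s)) *\<^sub>R e s \<partial>lborel) \<bullet> v = (\<integral>s. (\<integral>z. F s z \<partial>\<nu>) \<partial>lborel)"
    unfolding Fs by (rule integral_inner_left[symmetric])
  also have "\<dots> = (\<integral>z. (\<integral>s. F s z \<partial>lborel) \<partial>\<nu>)"
    by (rule Fubini_integral[OF F_int, symmetric])
  also have "\<dots> = (\<integral>z. (y T - y (max 0 (T - z))) \<bullet> v \<partial>\<nu>)"
    using int_Fz by (intro integral_cong_AE AE) auto
  finally show "(\<integral>s. (indicator {0<..<T} s * w (T - s)) *\<^sub>R e s \<partial>lborel) \<bullet> v =
      (\<integral>z. (y T - y (max 0 (T - z))) \<bullet> v \<partial>\<nu>)" .
qed

text \<open>A maximum principle: at the first maximizer \<open>T\<close> of \<open>norm \<circ> y\<close>, the integrand of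
  \<open>convolution_w_eq_nu_integral\<close> (with \<open>v = y T\<close>) is positive, while the integral is \<open>L (y T) \<bullet> y T \<le> 0\<close>.\<close>

lemma weak_homogeneous_eq_0:
  fixes d :: "real \<Rightarrow> 'h"
  assumes T0: "0 < T\<^sub>0" and cont: "continuous_on {0<..T\<^sub>0} d"
    and B: "\<And>t. t \<in> {0<..T\<^sub>0} \<Longrightarrow> norm (d t) \<le> B"
    and weak: "\<And>T x. T \<in> {0<..T\<^sub>0} \<Longrightarrow> x \<in> D \<Longrightarrow>
      (\<integral>s. (indicator {0<..<T} s * w (T - s)) *\<^sub>R d s \<partial>lborel) \<bullet> x =
      (\<integral>s. indicator {0<..T} s *\<^sub>R d s \<partial>lborel) \<bullet> L x"
    and t: "t \<in> {0<..T\<^sub>0}"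
  shows "d t = 0"
proof -
  define e where "e s = indicator {0<..T\<^sub>0} s *\<^sub>R d s" for s
  have e [measurable]: "e \<in> borel_measurable borel"
    unfolding e_def using cont by (intro borel_measurable_continuous_on_indicator) auto
  have B0: "0 \<le> B" by (rule order_trans[OF norm_ge_zero B[of T\<^sub>0]]) (use T0 in auto)
  have eB: "norm (e s) \<le> B" for s
    using B[of s] B0 by (auto simp: e_def split: split_indicator)
  have e_int: "integrable lborel e"
  proof (rule Bochner_Integration.integrable_bound)
    show "integrable lborel (\<lambda>s. indicator {0<..T\<^sub>0} s * B)" using T0 by simp
    show "AE s in lborel. norm (e s) \<le> norm (indicator {0<..T\<^sub>0} s * B)"
      using B B0 by (auto simp: e_def split: split_indicator)
  qed simp
  define y where "y t = (\<integral>s. indicator {0<..t} s *\<^sub>R e s \<partial>lborel)" for t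
  have y0: "y 0 = 0" by (simp add: y_def)
  have y_lipschitz: "norm (y b - y a) \<le> B * (b - a)" if "0 \<le> a" "a \<le> b" for a b
  proof -
    have "norm (y b - y a) \<le> (\<integral>s. norm (indicator {max 0 a<..b} s *\<^sub>R e s) \<partial>lborel)"
      unfolding y_def integral_indicator_mono_gt[OF e_int that(2)] by (rule integral_norm_bound)
    also have "\<dots> \<le> (\<integral>s. B * indicator {a<..b} s \<partial>lborel)"
    proof (rule integral_mono)
      show "integrable lborel (\<lambda>s. norm (indicator {max 0 a<..b} s *\<^sub>R e s))"
        by (intro integrable_norm integrable_mult_indicator e_int) simp
    qed (use that eB in \<open>auto split: split_indicator\<close>)
    also have "\<dots> = B * (b - a)" using that by simp
    finally show ?thesis .
  qed
  have y_cont: "continuous_on {0..T\<^sub>0} (\<lambda>t. norm (y t))"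
  proof -
    have "lipschitz_on B {0..T\<^sub>0} y"
    proof (rule lipschitz_onI[OF _ B0])
      fix a b assume "a \<in> {0..T\<^sub>0}" "b \<in> {0..T\<^sub>0}"
      then show "dist (y a) (y b) \<le> B * dist a b"
        using y_lipschitz[of a b] y_lipschitz[of b a]
        by (cases "a \<le> b") (auto simp: dist_norm norm_minus_commute)
    qed
    then show ?thesis by (intro continuous_on_norm lipschitz_on_continuous_on)
  qed
  \<comment> \<open>Read with the time integral outside the inner product, the weak equation is
    exactly the premise of \<open>in_D_if_weak\<close> for the primitive.\<close>
  have y_D: "y T \<in> D" "L (y T) = (\<integral>s. (indicator {0<..<T} s * w (T - s)) *\<^sub>R e s \<partial>lborel)"
    if T: "T \<in> {0<..T\<^sub>0}" for T
  proof -
    have *: "y T \<bullet> L x = (\<integral>s. (indicator {0<..<T} s * w (T - s)) *\<^sub>R e s \<partial>lborel) \<bullet> x" if "x \<in> D" for x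
    proof -
      have "(\<integral>s. (indicator {0<..<T} s * w (T - s)) *\<^sub>R e s \<partial>lborel) =
          (\<integral>s. (indicator {0<..<T} s * w (T - s)) *\<^sub>R d s \<partial>lborel)"
        using T by (intro Bochner_Integration.integral_cong) (auto simp: e_def split: split_indicator)
      moreover have "y T = (\<integral>s. indicator {0<..T} s *\<^sub>R d s \<partial>lborel)"
        unfolding y_def using T by (intro Bochner_Integration.integral_cong) (auto simp: e_def split: split_indicator)
      ultimately show ?thesis using weak[OF T that] by simp
    qed
    show "y T \<in> D" "L (y T) = (\<integral>s. (indicator {0<..<T} s * w (T - s)) *\<^sub>R e s \<partial>lborel)"
      using in_D_if_weak[OF *] by auto
  qed
  obtain t\<^sub>1 where t1: "t\<^sub>1 \<in> {0..T\<^sub>0}" "\<And>t. t \<in> {0..T\<^sub>0} \<Longrightarrow> norm (y t) \<le> norm (y t\<^sub>1)"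
    using continuous_attains_sup[OF _ _ y_cont] T0 by auto
  define m where "m = norm (y t\<^sub>1)"
  have "compact {t\<in>{0..T\<^sub>0}. norm (y t) = m}"
  proof -
    have "closed {t\<in>{0..T\<^sub>0}. norm (y t) = m}"
      using continuous_closed_preimage_constant[OF y_cont, of m] by simp
    then have "compact ({0..T\<^sub>0} \<inter> {t\<in>{0..T\<^sub>0}. norm (y t) = m})"
      by (intro compact_Int_closed) simp_all
    also have "{0..T\<^sub>0} \<inter> {t\<in>{0..T\<^sub>0}. norm (y t) = m} = {t\<in>{0..T\<^sub>0}. norm (y t) = m}" by auto
    finally show ?thesis .
  qed
  moreover have "{t\<in>{0..T\<^sub>0}. norm (y t) = m} \<noteq> {}" using t1 m_def by auto
  \<comment> \<open>The least element of the compact set of maximizers. Minimality makes the norm of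
    \<open>y\<close> strictly smaller at all earlier times, so that the increments below are
    strictly positive.\<close>
  ultimately obtain T where T: "T \<in> {0..T\<^sub>0}" "norm (y T) = m"
      "\<And>t. t \<in> {0..T\<^sub>0} \<Longrightarrow> norm (y t) = m \<Longrightarrow> T \<le> t"
    using compact_attains_inf[of "{t\<in>{0..T\<^sub>0}. norm (y t) = m}"] by blast
  have "m = 0"
  proof (rule ccontr)
    assume "m \<noteq> 0"
    then have m: "0 < m" by (simp add: m_def)
    have T0': "T \<noteq> 0" using T(2) y0 m by auto
    then have Tpos: "0 < T" and T_in: "T \<in> {0<..T\<^sub>0}" using T(1) by auto
    \<comment> \<open>For \<open>z \<ge> T\<close> the comparison time is 0, which still precedes
      \<open>T\<close>; so the inequality is strict for every \<open>z > 0\<close>.\<close>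
    have pos: "0 < (y T - y (max 0 (T - z))) \<bullet> y T" if "0 < z" for z
    proof -
      let ?t = "max 0 (T - z)"
      have t: "?t \<in> {0..T\<^sub>0}" "?t < T" using that Tpos T(1) by auto
      then have "norm (y ?t) < m"
        using t1(2)[OF t(1)] T(3)[OF t(1)] by (fastforce simp: m_def)
      then have "y ?t \<bullet> y T < m * m"
        using norm_cauchy_schwarz[of "y ?t" "y T"] T(2) m
        by (intro le_less_trans[OF norm_cauchy_schwarz]) auto
      then show ?thesis
        using T(2) by (simp add: inner_diff_left dot_square_norm power2_eq_square)
    qed
    note conv = convolution_w_eq_nu_integral[OF e e_int eB Tpos, of "y T", folded y_def]
    have nonneg: "AE z in \<nu>. 0 \<le> (y T - y (max 0 (T - z))) \<bullet> y T"
      using AE_nu_pos by eventually_elim (rule less_imp_le[OF pos])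
    then have "0 \<le> (\<integral>z. (y T - y (max 0 (T - z))) \<bullet> y T \<partial>\<nu>)"
      by (rule Bochner_Integration.integral_nonneg_AE)
    moreover have "(\<integral>z. (y T - y (max 0 (T - z))) \<bullet> y T \<partial>\<nu>) \<le> 0"
      using L_dissipative[OF y_D(1)[OF T_in]] unfolding y_D(2)[OF T_in] conv(2) .
    ultimately have "(\<integral>z. (y T - y (max 0 (T - z))) \<bullet> y T \<partial>\<nu>) = 0" by simp
    then have "AE z in \<nu>. (y T - y (max 0 (T - z))) \<bullet> y T = 0"
      using integral_nonneg_eq_0_iff_AE[OF conv(1) nonneg] by simp
    \<comment> \<open>A positive integrand with zero integral would make \<open>{0<..}\<close> a
      null set, against the infinite mass of \<open>\<nu>\<close>.\<close>
    then have "AE z in \<nu>. False"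
      using AE_nu_pos
    proof eventually_elim
      case (elim z)
      then show ?case using pos[of z] by simp
    qed
    then obtain N where N: "{z\<in>space \<nu>. \<not> False} \<subseteq> N" "emeasure \<nu> N = 0" "N \<in> sets \<nu>"
      by (rule AE_E)
    have "emeasure \<nu> {0<..} \<le> emeasure \<nu> N"
      using N sets_eq_imp_space_eq[OF sets_nu] by (intro emeasure_mono) auto
    then show False using infinite N(2) by simp
  qed
  then have y_zero: "y s = 0" if "s \<in> {0..T\<^sub>0}" for s
    using t1(2)[OF that] by (simp add: m_def)
  show ?thesis
  proof (rule ccontr)
    assume nz: "d t \<noteq> 0"
    \<comment> \<open>Recovers the function from its vanishing primitive. By continuity
      \<open>d s \<bullet> d t\<close> exceeds \<open>c\<close> on a short interval ending at
      \<open>t\<close>, so the increment of \<open>y\<close> over it, tested with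
      \<open>d t\<close>, would be positive. Any value strictly between 0 and
      \<open>d t \<bullet> d t\<close> would do.\<close>
    define c where "c = (d t \<bullet> d t) / 2"
    have c: "0 < c" "c < d t \<bullet> d t" using nz by (auto simp: c_def)
    have "((\<lambda>s. d s \<bullet> d t) \<longlongrightarrow> d t \<bullet> d t) (at t within {0<..T\<^sub>0})"
      using cont t by (intro tendsto_inner tendsto_const) (auto simp: continuous_on_def)
    then have "eventually (\<lambda>s. c < d s \<bullet> d t) (at t within {0<..T\<^sub>0})"
      using c(2) by (rule order_tendstoD(1))
    then obtain \<delta> where \<delta>: "0 < \<delta>" "\<And>s. s \<in> {0<..T\<^sub>0} \<Longrightarrow> s \<noteq> t \<Longrightarrow> dist s t < \<delta> \<Longrightarrow> c < d s \<bullet> d t"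
      by (auto simp: eventually_at)
    define a where "a = max 0 (t - \<delta>)"
    have a: "0 \<le> a" "a < t" "a \<in> {0..T\<^sub>0}" using t \<delta>(1) by (auto simp: a_def)
    have ge: "c \<le> d s \<bullet> d t" if "a < s" "s \<le> t" for s
      using \<delta>(2)[of s] that t c a by (cases "s = t") (auto simp: a_def dist_real_def)
    have int: "integrable lborel (\<lambda>s. indicator {a<..t} s *\<^sub>R e s)"
      by (intro integrable_mult_indicator e_int) auto
    have "0 = (y t - y a) \<bullet> d t" using y_zero a(3) t by simp
    also have "\<dots> = (\<integral>s. (indicator {a<..t} s *\<^sub>R e s) \<bullet> d t \<partial>lborel)"
      unfolding y_def integral_indicator_mono_gt[OF e_int less_imp_le[OF a(2)]]
      using a(1) integral_inner_left[OF int, of "d t"] by (simp add: max_def)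
    finally have eq: "(\<integral>s. (indicator {a<..t} s *\<^sub>R e s) \<bullet> d t \<partial>lborel) = 0" ..
    have "(t - a) * c = (\<integral>s. indicator {a<..t} s * c \<partial>lborel)" using a by simp
    also have "\<dots> \<le> (\<integral>s. (indicator {a<..t} s *\<^sub>R e s) \<bullet> d t \<partial>lborel)"
    proof (rule integral_mono)
      fix s
      show "indicator {a<..t} s * c \<le> (indicator {a<..t} s *\<^sub>R e s) \<bullet> d t"
        using ge[of s] a t by (auto simp: e_def split: split_indicator)
      show "integrable lborel (\<lambda>s. indicator {a<..t} s * c)"
        using a by (intro integrable_mult_left integrable_real_indicator) auto
      show "integrable lborel (\<lambda>s. (indicator {a<..t} s *\<^sub>R e s) \<bullet> d t)"
        by (rule integrable_inner_left) (rule int)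
    qed
    finally have "(t - a) * c \<le> 0" unfolding eq .
    then show False using a(2) c(1) by (simp add: mult_le_0_iff)
  qed
qed

end

section \<open>Lebesgue measurable data and the solution formula\<close>

text \<open>Each of countably many approximating simple functions has a version measurable for
  \<open>M\<close>, so outside one null set the versions converge to \<open>f\<close>. Taking
  \<open>lim\<close> stays measurable even where they diverge.\<close>

lemma completion_ex_borel_measurable_banach:
  fixes f :: "'a \<Rightarrow> 'b::{banach, second_countable_topology}"
  assumes "f \<in> borel_measurable (completion M)"
  shows "\<exists>g\<in>borel_measurable M. AE x in M. f x = g x"
proof -
  obtain F where F: "\<forall>i. simple_function (completion M) (F i)" "\<forall>x\<in>space (completion M). (\<lambda>i. F i x) \<longlonglongrightarrow> f x"
    using borel_measurable_implies_sequence_metric[OF assms, of undefined] by blast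
  have "\<forall>i. \<exists>G. simple_function M G \<and> (AE x in M. F i x = G x)"
    using completion_ex_simple_function[OF F(1)[rule_format]] by blast
  then obtain G where G: "\<And>i. simple_function M (G i)" "\<And>i. AE x in M. F i x = G i x"
    by metis
  have "AE x in M. \<forall>i. F i x = G i x"
    using G(2) by (simp add: AE_all_countable)
  then have "AE x in M. f x = lim (\<lambda>i. G i x)"
    using AE_space
  proof eventually_elim
    case (elim x)
    then have "(\<lambda>i. F i x) \<longlonglongrightarrow> f x" using F(2) unfolding space_completion by blast
    then have "(\<lambda>i. F i x) \<longlonglongrightarrow> f x" using F(2) unfolding space_completion by blast
    then have "(\<lambda>i. G i x) \<longlonglongrightarrow> f x" using elim(1) by simp
    then show ?case by (rule limI[symmetric])
  qed
  moreover have "(\<lambda>x. lim (\<lambda>i. G i x)) \<in> borel_measurable M"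
    using G(1) by (intro borel_measurable_lim_metric borel_measurable_simple_function)
  ultimately show ?thesis by (rule bexI)
qed

lemma measurable_cong_AE_complete:
  assumes M: "complete_measure M" and f: "f \<in> M \<rightarrow>\<^sub>M N" and eq: "AE x in M. f x = g x" and g: "\<And>x. x \<in> space M \<Longrightarrow> g x \<in> space N"
  shows "g \<in> M \<rightarrow>\<^sub>M N"
proof (rule measurableI[OF g])
  fix A assume A: "A \<in> sets N"
  show "g -` A \<inter> space M \<in> sets M"
  proof (rule complete_measure.in_sets_AE[OF M])
    show "f -` A \<inter> space M \<in> sets M" using f A by (rule measurable_sets)
    show "AE x in M. x \<in> f -` A \<inter> space M \<longleftrightarrow> x \<in> g -` A \<inter> space M"
      using eq by eventually_elim auto
  qed simp
qed simp

text \<open>Passes from integrals over \<open>lebesgue\<close>, as in the solution formula, to those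
  over \<open>lborel\<close>; completeness yields the measurability of \<open>h\<close>.\<close>

lemma lebesgue_integral_cong_AE_lborel:
  fixes f h :: "real \<Rightarrow> 'b::{banach, second_countable_topology}"
  assumes f: "f \<in> borel_measurable lborel" and eq: "AE x in lborel. f x = h x"
  shows "h \<in> borel_measurable lebesgue"
    and "integrable lebesgue h \<longleftrightarrow> integrable lborel f"
    and "integral\<^sup>L lebesgue h = integral\<^sup>L lborel f"
proof -
  have f': "f \<in> borel_measurable lebesgue" using f by (rule measurable_completion)
  have eq': "AE x in lebesgue. f x = h x" using eq by (rule AE_completion)
  show h: "h \<in> borel_measurable lebesgue"
    by (rule measurable_cong_AE_complete[OF completion.complete_measure_axioms f' eq']) simp
  have "integrable lebesgue h \<longleftrightarrow> integrable lebesgue f"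
    using h f' eq' by (intro integrable_cong_AE) auto
  then show "integrable lebesgue h \<longleftrightarrow> integrable lborel f"
    using integrable_completion[OF f] by simp
  have "integral\<^sup>L lebesgue h = integral\<^sup>L lebesgue f"
    using h f' eq' by (intro integral_cong_AE) auto
  then show "integral\<^sup>L lebesgue h = integral\<^sup>L lborel f"
    using integral_completion[OF f] by simp
qed

context fractional_equation begin

lemma ex_admissible_version:
  assumes T0: "0 < T\<^sub>0" and meas: "f \<in> borel_measurable (lebesgue_on {0<..T\<^sub>0})"
    and bound: "AE t in lebesgue_on {0<..T\<^sub>0}. norm (f t) \<le> K"
  shows "\<exists>g. admissible g \<and> (\<forall>s. s \<notin> {0<..T\<^sub>0} \<longrightarrow> g s = 0) \<and> (AE s in lborel. s \<in> {0<..T\<^sub>0} \<longrightarrow> g s = f s)"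
proof -
  have "(\<lambda>s. if s \<in> {0<..T\<^sub>0} then f s else 0) \<in> borel_measurable lebesgue"
    using meas by (subst measurable_restrict_space_iff[symmetric]) auto
  then have "\<exists>h\<in>borel_measurable lborel. AE s in lborel. (if s \<in> {0<..T\<^sub>0} then f s else 0) = h s"
    by (rule completion_ex_borel_measurable_banach)
  then obtain h where "h \<in> borel_measurable lborel"
      and eq: "AE s in lborel. (if s \<in> {0<..T\<^sub>0} then f s else 0) = h s"
    by (rule bexE)
  then have h [measurable]: "h \<in> borel_measurable borel" by simp
  have bd: "AE s in lborel. s \<in> {0<..T\<^sub>0} \<longrightarrow> norm (f s) \<le> K"
    using bound by (simp add: AE_restrict_space_iff AE_completion_iff)
  \<comment> \<open>Cutting off where the norm exceeds \<open>K\<close> turns an almost everywhere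
    bound into one that holds everywhere, at the cost of a null set.\<close>
  define g where "g s = (if 0 < s \<and> s \<le> T\<^sub>0 \<and> norm (h s) \<le> K then h s else 0)" for s
  have "g \<in> borel_measurable borel" unfolding g_def by measurable
  moreover have "norm (g s) \<le> max 0 K" for s by (auto simp: g_def)
  ultimately have "admissible g"
    unfolding admissible_def by (auto simp: g_def intro!: exI[of _ "max 0 K"])
  moreover have "AE s in lborel. s \<in> {0<..T\<^sub>0} \<longrightarrow> g s = f s"
    using eq bd by eventually_elim (auto simp: g_def)
  ultimately show ?thesis by (intro exI[of _ g]) (auto simp: g_def)
qed

lemma inner_integral_eq:
  assumes s: "s \<le> t"
  shows "set_integrable lebesgue {0<..} (\<lambda>r. p r (t - s) *\<^sub>R P r h) \<longleftrightarrow>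
      integrable lborel (\<lambda>r. dens r (t - s) *\<^sub>R P' r h)"
    and "(LINT r:{0<..}|lebesgue. p r (t - s) *\<^sub>R P r h) = (\<integral>r. dens r (t - s) *\<^sub>R P' r h \<partial>lborel)"
proof -
  have eq: "(\<lambda>r. indicator {0<..} r *\<^sub>R (p r (t - s) *\<^sub>R P r h)) = (\<lambda>r. dens r (t - s) *\<^sub>R P' r h)"
    using s by (auto simp: dens_def P'_eq split: split_indicator)
  have meas: "(\<lambda>r. dens r (t - s) *\<^sub>R P' r h) \<in> borel_measurable lborel" by measurable
  show "set_integrable lebesgue {0<..} (\<lambda>r. p r (t - s) *\<^sub>R P r h) \<longleftrightarrow>
      integrable lborel (\<lambda>r. dens r (t - s) *\<^sub>R P' r h)"
    unfolding set_integrable_def eq by (rule integrable_completion[OF meas])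
  show "(LINT r:{0<..}|lebesgue. p r (t - s) *\<^sub>R P r h) = (\<integral>r. dens r (t - s) *\<^sub>R P' r h \<partial>lborel)"
    unfolding set_lebesgue_integral_def eq by (rule integral_completion[OF meas])
qed

lemma candidate_eq:
  assumes F: "admissible F" and eq: "AE s in lborel. s \<in> {0<..T\<^sub>0} \<longrightarrow> F s = f s" and t: "t \<in> {0<..T\<^sub>0}"
  shows "candidate_well_defined M S p P f g t"
    and "candidate_solution M S p P f g t = Q t g + U F t"
proof -
  have t0: "0 \<le> t" using t by simp
  have [measurable]: "X t \<in> borel_measurable M" using t0 by simp
  note [measurable] = admissible_measurable[OF F]
  \<comment> \<open>\<open>Inf {}\<close> may be negative, where nothing is known about
    \<open>P\<close>; but on that event the value is one fixed vector, so measurability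
    survives.\<close>
  have P_meas: "(\<lambda>\<omega>. P (inverse_subordinator S t \<omega>) g) \<in> borel_measurable M"
  proof -
    have "(\<lambda>\<omega>. if \<forall>n::nat. S (real n) \<omega> \<le> t then P (Inf {}) g else P' (X t \<omega>) g) \<in> borel_measurable M"
      by measurable
    then show ?thesis
      by (rule measurable_cong[THEN iffD1, rotated])
        (simp add: inverse_subordinator_cases[OF _ t0] P'_eq X_nonneg)
  qed
  have AE_P: "AE \<omega> in M. P (X t \<omega>) g = P (inverse_subordinator S t \<omega>) g"
    using AE_X_eq[OF t0] by eventually_elim simp
  have int_P: "integrable M (\<lambda>\<omega>. P (inverse_subordinator S t \<omega>) g)"
    by (rule integrable_cong_AE_imp[OF integrable_Q[OF t0] P_meas AE_P])
  have Q: "(\<integral>\<omega>. P (inverse_subordinator S t \<omega>) g \<partial>M) = Q t g"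
    unfolding Q_def using P_meas integrable_Q[OF t0] AE_P
    by (intro integral_cong_AE) (auto elim!: eventually_mono)
  define G where "G s = (\<integral>r. dens r (t - s) *\<^sub>R P' r (F s) \<partial>lborel)" for s
  have G_int: "integrable lborel G"
    unfolding G_def using lborel_pair.integrable_fst'[OF integrable_U[OF F]] by simp
  have G_eq: "AE s in lborel. G s = indicator {0<..t} s *\<^sub>R (LINT r:{0<..}|lebesgue. p r (t - s) *\<^sub>R P r (f s))"
    using eq
  proof eventually_elim
    case (elim s)
    consider "s \<le> 0" | "0 < s" "s \<le> t" | "t < s" by linarith
    then show ?case
    proof cases
      case 1
      then have "F s = 0" using F by (simp add: admissible_def)
      then show ?thesis using 1 by (simp add: G_def P'_def)
    next
      case 2
      then show ?thesis using elim t by (simp add: G_def inner_integral_eq(2))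
    next
      case 3
      then show ?thesis using t by (simp add: G_def dens_def)
    qed
  qed
  note G = lebesgue_integral_cong_AE_lborel[OF borel_measurable_integrable[OF G_int] G_eq]
  have AE_int: "AE s in lebesgue_on {0<..t}. set_integrable lebesgue {0<..} (\<lambda>r. p r (t - s) *\<^sub>R P r (f s))"
  proof -
    have "AE s in lborel. integrable lborel (\<lambda>r. dens r (t - s) *\<^sub>R P' r (F s))"
      using lborel_pair.AE_integrable_fst'[OF integrable_U[OF F]] by simp
    then have "AE s in lborel. s \<in> {0<..t} \<longrightarrow> set_integrable lebesgue {0<..} (\<lambda>r. p r (t - s) *\<^sub>R P r (f s))"
      using eq by eventually_elim (use t in \<open>auto simp: inner_integral_eq(1)\<close>)
    then show ?thesis by (simp add: AE_restrict_space_iff AE_completion_iff)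
  qed
  show "candidate_well_defined M S p P f g t"
    unfolding candidate_well_defined_def using int_P AE_int G(2) G_int by (simp add: set_integrable_def)
  show "candidate_solution M S p P f g t = Q t g + U F t"
    unfolding candidate_solution_def Q using G(3) by (simp add: set_lebesgue_integral_def G_def[abs_def] U_def)
qed

lemma weak_solution_unique:
  assumes T0: "0 < T\<^sub>0" and u: "weak_solution w D L f g T\<^sub>0 u" and v: "weak_solution w D L f g T\<^sub>0 v" and t: "t \<in> {0<..T\<^sub>0}"
  shows "v t = u t"
proof -
  have bound: "\<exists>B. \<forall>t\<in>{0<..T\<^sub>0}. norm (u t) \<le> B" if "weak_solution w D L f g T\<^sub>0 u" for u
    using that by (simp add: weak_solution_def bdd_above_def)
  \<comment> \<open>Both solutions are brought to Borel integrals, with the inner product with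
    \<open>L x\<close> outside. The source term is kept literally, so that it cancels in the
    difference whatever its value.\<close>
  have *: "integrable lborel (\<lambda>s. (indicator {0<..<T} s * w (T - s)) *\<^sub>R (u s - g)) \<and>
      integrable lborel (\<lambda>s. indicator {0<..T} s *\<^sub>R u s) \<and>
      (\<forall>x\<in>D. (\<integral>s. (indicator {0<..<T} s * w (T - s)) *\<^sub>R (u s - g) \<partial>lborel) \<bullet> x =
        (LINT s:{0<..T}|lebesgue. f s \<bullet> x) + (\<integral>s. indicator {0<..T} s *\<^sub>R u s \<partial>lborel) \<bullet> L x)"
    if u: "weak_solution w D L f g T\<^sub>0 u" and T: "T \<in> {0<..T\<^sub>0}" for u T
  proof -
    have cont: "continuous_on {0<..T\<^sub>0} u"
      using u by (simp add: weak_solution_def)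
    obtain B where B: "\<forall>t\<in>{0<..T\<^sub>0}. norm (u t) \<le> B"
      using bound[OF u] by blast
    have u_meas [measurable]: "(\<lambda>s. indicator {0<..T\<^sub>0} s *\<^sub>R u s) \<in> borel_measurable borel"
      using cont by (intro borel_measurable_continuous_on_indicator) auto
    have meas1: "(\<lambda>s. (indicator {0<..<T} s * w (T - s)) *\<^sub>R (u s - g)) \<in> borel_measurable lborel"
    proof -
      have "(\<lambda>s. (indicator {0<..<T} s * w (T - s)) *\<^sub>R (indicator {0<..T\<^sub>0} s *\<^sub>R u s - g)) \<in> borel_measurable lborel"
        by measurable
      also have "(\<lambda>s. (indicator {0<..<T} s * w (T - s)) *\<^sub>R (indicator {0<..T\<^sub>0} s *\<^sub>R u s - g)) =
          (\<lambda>s. (indicator {0<..<T} s * w (T - s)) *\<^sub>R (u s - g))"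
        using T by (auto split: split_indicator)
      finally show ?thesis .
    qed
    have meas2: "(\<lambda>s. indicator {0<..T} s *\<^sub>R u s) \<in> borel_measurable lborel"
    proof -
      have "(\<lambda>s. indicator {0<..T} s *\<^sub>R (indicator {0<..T\<^sub>0} s *\<^sub>R u s)) \<in> borel_measurable lborel"
        by measurable
      also have "(\<lambda>s. indicator {0<..T} s *\<^sub>R (indicator {0<..T\<^sub>0} s *\<^sub>R u s)) = (\<lambda>s. indicator {0<..T} s *\<^sub>R u s)"
        using T by (auto split: split_indicator)
      finally show ?thesis .
    qed
    have eq1: "(\<lambda>s. indicator {0<..<T} s *\<^sub>R (w (T - s) *\<^sub>R (u s - g))) =
        (\<lambda>s. (indicator {0<..<T} s * w (T - s)) *\<^sub>R (u s - g))" by auto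
    have int1: "integrable lborel (\<lambda>s. (indicator {0<..<T} s * w (T - s)) *\<^sub>R (u s - g))"
    proof -
      have "set_integrable lebesgue {0<..<T} (\<lambda>t. w (T - t) *\<^sub>R (u t - g))"
        using u T unfolding weak_solution_def by blast
      then show ?thesis
        unfolding set_integrable_def eq1 integrable_completion[OF meas1] .
    qed
    have int2: "integrable lborel (\<lambda>s. indicator {0<..T} s *\<^sub>R u s)"
    proof (rule Bochner_Integration.integrable_bound[OF _ meas2])
      show "integrable lborel (\<lambda>s. indicator {0<..T} s * B)" using T by simp
      show "AE s in lborel. norm (indicator {0<..T} s *\<^sub>R u s) \<le> norm (indicator {0<..T} s * B)"
      proof (rule AE_I2)
        fix s
        show "norm (indicator {0<..T} s *\<^sub>R u s) \<le> norm (indicator {0<..T} s * B)"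
          using bspec[OF B, of s] T by (cases "s \<in> {0<..T}") (auto intro: order_trans[OF _ abs_ge_self])
      qed
    qed
    have "(\<integral>s. (indicator {0<..<T} s * w (T - s)) *\<^sub>R (u s - g) \<partial>lborel) \<bullet> x =
        (LINT s:{0<..T}|lebesgue. f s \<bullet> x) + (\<integral>s. indicator {0<..T} s *\<^sub>R u s \<partial>lborel) \<bullet> L x" if x: "x \<in> D" for x
    proof -
      have "(LINT s:{0<..<T}|lebesgue. w (T - s) *\<^sub>R (u s - g)) =
          (\<integral>s. (indicator {0<..<T} s * w (T - s)) *\<^sub>R (u s - g) \<partial>lborel)"
        unfolding set_lebesgue_integral_def eq1 by (rule integral_completion[OF meas1])
      moreover have "(LINT s:{0<..T}|lebesgue. u s \<bullet> L x) = (\<integral>s. indicator {0<..T} s *\<^sub>R u s \<partial>lborel) \<bullet> L x"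
      proof -
        have "(LINT s:{0<..T}|lebesgue. u s \<bullet> L x) = (\<integral>s. (indicator {0<..T} s *\<^sub>R u s) \<bullet> L x \<partial>lebesgue)"
          by (simp add: set_lebesgue_integral_def)
        also have "\<dots> = (\<integral>s. (indicator {0<..T} s *\<^sub>R u s) \<bullet> L x \<partial>lborel)"
          using meas2 by (intro integral_completion borel_measurable_inner) auto
        also have "\<dots> = (\<integral>s. indicator {0<..T} s *\<^sub>R u s \<partial>lborel) \<bullet> L x"
          by (rule integral_inner_left[OF int2])
        finally show ?thesis .
      qed
      moreover have "(LINT s:{0<..<T}|lebesgue. w (T - s) *\<^sub>R (u s - g)) \<bullet> x =
          (LINT s:{0<..T}|lebesgue. f s \<bullet> x) + (LINT s:{0<..T}|lebesgue. u s \<bullet> L x)"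
        using u T x unfolding weak_solution_def by blast
      ultimately show ?thesis by simp
    qed
    then show ?thesis by (intro conjI ballI int1 int2)
  qed
  obtain B\<^sub>1 B\<^sub>2 where B: "\<forall>t\<in>{0<..T\<^sub>0}. norm (u t) \<le> B\<^sub>1" "\<forall>t\<in>{0<..T\<^sub>0}. norm (v t) \<le> B\<^sub>2"
    using bound[OF u] bound[OF v] by blast
  have "v t - u t = 0"
  proof (rule weak_homogeneous_eq_0[OF T0 _ _ _ t, of "\<lambda>t. v t - u t"])
    show "continuous_on {0<..T\<^sub>0} (\<lambda>t. v t - u t)"
      using u v by (intro continuous_on_diff) (auto simp: weak_solution_def)
    show "norm (v t - u t) \<le> B\<^sub>2 + B\<^sub>1" if "t \<in> {0<..T\<^sub>0}" for t
      using bspec[OF B(1) that] bspec[OF B(2) that] norm_triangle_ineq4[of "v t" "u t"] by simp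
    fix T x assume T: "T \<in> {0<..T\<^sub>0}" and x: "x \<in> D"
    note U = *[OF u T, THEN conjunct1] *[OF u T, THEN conjunct2, THEN conjunct1]
        *[OF u T, THEN conjunct2, THEN conjunct2, THEN bspec, OF x]
      and V = *[OF v T, THEN conjunct1] *[OF v T, THEN conjunct2, THEN conjunct1]
        *[OF v T, THEN conjunct2, THEN conjunct2, THEN bspec, OF x]
    have "(\<integral>s. (indicator {0<..<T} s * w (T - s)) *\<^sub>R (v s - u s) \<partial>lborel) =
        (\<integral>s. (indicator {0<..<T} s * w (T - s)) *\<^sub>R (v s - g) - (indicator {0<..<T} s * w (T - s)) *\<^sub>R (u s - g) \<partial>lborel)"
      by (intro Bochner_Integration.integral_cong) (auto simp: scaleR_diff_right[symmetric])
    also have "\<dots> = (\<integral>s. (indicator {0<..<T} s * w (T - s)) *\<^sub>R (v s - g) \<partial>lborel) -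
        (\<integral>s. (indicator {0<..<T} s * w (T - s)) *\<^sub>R (u s - g) \<partial>lborel)"
      by (rule Bochner_Integration.integral_diff[OF V(1) U(1)])
    finally have 1: "(\<integral>s. (indicator {0<..<T} s * w (T - s)) *\<^sub>R (v s - u s) \<partial>lborel) =
        (\<integral>s. (indicator {0<..<T} s * w (T - s)) *\<^sub>R (v s - g) \<partial>lborel) -
        (\<integral>s. (indicator {0<..<T} s * w (T - s)) *\<^sub>R (u s - g) \<partial>lborel)" .
    have 2: "(\<integral>s. indicator {0<..T} s *\<^sub>R (v s - u s) \<partial>lborel) =
        (\<integral>s. indicator {0<..T} s *\<^sub>R v s \<partial>lborel) - (\<integral>s. indicator {0<..T} s *\<^sub>R u s \<partial>lborel)"
      unfolding scaleR_diff_right by (rule Bochner_Integration.integral_diff[OF V(2) U(2)])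
    show "(\<integral>s. (indicator {0<..<T} s * w (T - s)) *\<^sub>R (v s - u s) \<partial>lborel) \<bullet> x =
        (\<integral>s. indicator {0<..T} s *\<^sub>R (v s - u s) \<partial>lborel) \<bullet> L x"
      unfolding 1 2 inner_diff_left U(3) V(3) by simp
  qed
  then show ?thesis by simp
qed

lemma weak_solution_candidate:
  assumes T0: "0 < T\<^sub>0" and F: "admissible F" and eq: "AE s in lborel. s \<in> {0<..T\<^sub>0} \<longrightarrow> F s = f s"
  shows "weak_solution w D L f g T\<^sub>0 (candidate_solution M S p P f g)"
proof -
  let ?u = "candidate_solution M S p P f g" and ?v = "\<lambda>t. Q t g + U F t"
  have u_eq: "?u t = ?v t" if "t \<in> {0<..T\<^sub>0}" for t
    by (rule candidate_eq(2)[OF F eq that])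
  note [measurable] = admissible_measurable[OF F]
  have [measurable]: "U F \<in> borel_measurable borel"
    by (rule borel_measurable_continuous_onI[OF continuous_U[OF F]])
  have cont: "continuous_on {0..} ?v"
    by (intro continuous_on_add continuous_Q continuous_on_subset[OF continuous_U[OF F]]) simp
  obtain K where K: "0 \<le> K" "\<And>s. norm (F s) \<le> K * indicator {0<..} s"
    using admissible_bound[OF F] by blast
  have bound: "norm (?v t) \<le> norm g + K * exp T\<^sub>0 / \<phi> 1" if "t \<in> {0<..T\<^sub>0}" for t
  proof -
    have "norm (?v t) \<le> norm (Q t g) + norm (U F t)" by (rule norm_triangle_ineq)
    also have "\<dots> \<le> norm g + K * exp t / \<phi> 1"
      using that by (intro add_mono norm_Q_le norm_U_le(2)[OF F K]) auto
    also have "\<dots> \<le> norm g + K * exp T\<^sub>0 / \<phi> 1"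
      using that K(1) phi_pos[of 1] by (intro add_left_mono divide_right_mono mult_left_mono) auto
    finally show ?thesis .
  qed
  have "continuous_on {0<..T\<^sub>0} ?u"
  proof (rule continuous_on_eq)
    show "continuous_on {0<..T\<^sub>0} ?v" by (rule continuous_on_subset[OF cont]) auto
  qed (simp add: u_eq)
  moreover have "bdd_above ((\<lambda>t. norm (?u t)) ` {0<..T\<^sub>0})"
    using bound u_eq by (intro bdd_aboveI2) auto
  moreover have "(?u \<longlongrightarrow> g) (at_right 0)"
  proof -
    \<comment> \<open>The initial value is read off \<open>?v\<close>, which is continuous up to 0
      with \<open>?v 0 = g\<close>; the candidate is compared with \<open>?v\<close> at positive
      times only.\<close>
    have "(?v \<longlongrightarrow> ?v 0) (at 0 within {0..})"
      using cont by (auto simp: continuous_on_def)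
    then have "(?v \<longlongrightarrow> g) (at_right 0)"
      by (simp add: at_within_Ici_at_right Q_0 U_nonpos[OF F])
    then show ?thesis
    proof (rule Lim_transform_eventually)
      show "eventually (\<lambda>t. ?v t = ?u t) (at_right 0)"
        using u_eq T0 by (auto simp: eventually_at_right_field intro!: exI[of _ "T\<^sub>0"])
    qed
  qed
  moreover have "set_integrable lebesgue {0<..<T} (\<lambda>t. w (T - t) *\<^sub>R (?u t - g)) \<and>
      (\<forall>x\<in>D. (LINT s:{0<..<T}|lebesgue. w (T - s) *\<^sub>R (?u s - g)) \<bullet> x =
         (LINT s:{0<..T}|lebesgue. f s \<bullet> x) + (LINT s:{0<..T}|lebesgue. ?u s \<bullet> L x))"
    if T: "T \<in> {0<..T\<^sub>0}" for T
  proof -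
    have T': "0 < T" using T by simp
    have int: "integrable lborel (\<lambda>s. (indicator {0<..<T} s * w (T - s)) *\<^sub>R (?v s - g))"
      by (rule weak_form(1)[OF F zero_in_D(1) T'])
    have eq1: "(\<lambda>s. indicator {0<..<T} s *\<^sub>R (w (T - s) *\<^sub>R (?u s - g))) =
        (\<lambda>s. (indicator {0<..<T} s * w (T - s)) *\<^sub>R (?v s - g))"
      using T u_eq by (auto split: split_indicator)
    have 1: "set_integrable lebesgue {0<..<T} (\<lambda>t. w (T - t) *\<^sub>R (?u t - g))"
      unfolding set_integrable_def eq1 using integrable_completion[OF borel_measurable_integrable[OF int]] int by simp
    have lhs: "(LINT s:{0<..<T}|lebesgue. w (T - s) *\<^sub>R (?u s - g)) =
        (\<integral>s. (indicator {0<..<T} s * w (T - s)) *\<^sub>R (?v s - g) \<partial>lborel)"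
      unfolding set_lebesgue_integral_def eq1 by (rule integral_completion[OF borel_measurable_integrable[OF int]])
    have f_int: "(LINT s:{0<..T}|lebesgue. f s \<bullet> x) = (\<integral>s. indicator {0<..T} s * (F s \<bullet> x) \<partial>lborel)" for x
      unfolding set_lebesgue_integral_def
    proof (rule lebesgue_integral_cong_AE_lborel(3))
      show "AE s in lborel. indicator {0<..T} s * (F s \<bullet> x) = indicator {0<..T} s *\<^sub>R (f s \<bullet> x)"
        using eq by eventually_elim (use T in \<open>auto split: split_indicator\<close>)
    qed measurable
    have u_int: "(LINT s:{0<..T}|lebesgue. ?u s \<bullet> L x) = (\<integral>s. indicator {0<..T} s * (?v s \<bullet> L x) \<partial>lborel)" for x
    proof -
      have meas: "(\<lambda>s. indicator {0<..T} s * ((Q (max 0 s) g + U F s) \<bullet> L x)) \<in> borel_measurable lborel"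
        using measurable_Q[of "\<lambda>s. s" lborel "\<lambda>_. g"] by measurable
      have "(\<lambda>s. indicator {0<..T} s *\<^sub>R (?u s \<bullet> L x)) = (\<lambda>s. indicator {0<..T} s * ((Q (max 0 s) g + U F s) \<bullet> L x))"
        using u_eq T by (auto simp: max_def split: split_indicator)
      moreover have "(\<lambda>s. indicator {0<..T} s * (?v s \<bullet> L x)) = (\<lambda>s. indicator {0<..T} s * ((Q (max 0 s) g + U F s) \<bullet> L x))"
        by (auto simp: max_def split: split_indicator)
      ultimately show ?thesis
        unfolding set_lebesgue_integral_def using integral_completion[OF meas] by simp
    qed
    show ?thesis
      using 1 unfolding lhs f_int u_int using weak_form(2)[OF F _ T'] by auto
  qed
  ultimately show ?thesis unfolding weak_solution_def by blast
qed

end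

theorem theorem1p3:
  fixes M :: "'w measure" and S :: "real \<Rightarrow> 'w \<Rightarrow> real" and \<nu> :: "real measure"
    and p :: "real \<Rightarrow> real \<Rightarrow> real"
    and \<mu> :: "'e::metric_space measure"
    and cls :: "('e \<Rightarrow> real) \<Rightarrow> 'h::{real_inner, banach, second_countable_topology}"
    and F :: "'h set" and \<E> :: "'h \<Rightarrow> 'h \<Rightarrow> real" and P :: "real \<Rightarrow> 'h \<Rightarrow> 'h"
    and T\<^sub>0 K :: real and g :: 'h and f :: "real \<Rightarrow> 'e \<Rightarrow> real"
  defines "D \<equiv> form_generator_dom F \<E>" and "L \<equiv> form_generator F \<E>"
    and "u \<equiv> candidate_solution M S p P (\<lambda>t. cls (f t)) g"
  assumes "driftless_subordinator M S \<nu>"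
    and "bounded_densities M S p"
    and "emeasure \<nu> {0<..} = \<infinity>"
    and "locally_compact_space (euclidean :: 'e topology)"
    and "separable_space (euclidean :: 'e topology)"
    and "radon_measure \<mu>" and "sigma_finite_measure \<mu>" and "full_support \<mu>"
    and "l2_space \<mu> cls"
    and "dirichlet_form \<mu> cls F \<E>"
    and "associated_semigroup F \<E> P"
    and "0 < T\<^sub>0"
    and "(\<lambda>t. cls (f t)) \<in> borel_measurable (lebesgue_on {0<..T\<^sub>0})"
    and "AE t in lebesgue_on {0<..T\<^sub>0}. square_integrable \<mu> (f t) \<and> norm (cls (f t)) \<le> K"
  shows "(\<forall>t\<in>{0<..T\<^sub>0}. candidate_well_defined M S p P (\<lambda>t. cls (f t)) g t) \<and>
    weak_solution (levy_tail \<nu>) D L (\<lambda>t. cls (f t)) g T\<^sub>0 u \<and>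
    (\<forall>v. weak_solution (levy_tail \<nu>) D L (\<lambda>t. cls (f t)) g T\<^sub>0 v \<longrightarrow>
       (\<forall>t\<in>{0<..T\<^sub>0}. v t = u t)) \<and>
    ((\<forall>t\<in>{0<..T\<^sub>0}. square_integrable \<mu> (f t) \<and> cls (f t) \<in> D) \<and>
       bdd_above ((\<lambda>t. norm (L (cls (f t)))) ` {0<..T\<^sub>0}) \<longrightarrow>
     (\<forall>t\<in>{0<..T\<^sub>0}. u t \<in> D) \<and> continuous_on {0<..T\<^sub>0} (\<lambda>t. L (u t)))"
proof -
  interpret fractional_equation M S \<nu> p P D L
    unfolding D_def L_def fractional_equation_def
    using assms(4-6) symmetric_contraction_semigroup_of_form[OF assms(13,14)]
    by (simp add: subordinator_with_density_def)
  note T0 = \<open>0 < T\<^sub>0\<close>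
  define h where "h t = cls (f t)" for t
  have h_meas: "h \<in> borel_measurable (lebesgue_on {0<..T\<^sub>0})"
    using assms(16) by (simp add: h_def[abs_def])
  have h_bound: "AE t in lebesgue_on {0<..T\<^sub>0}. norm (h t) \<le> K"
    using assms(17) by eventually_elim (simp add: h_def)
  obtain G where G: "admissible G" "\<And>s. s \<notin> {0<..T\<^sub>0} \<Longrightarrow> G s = 0" "AE s in lborel. s \<in> {0<..T\<^sub>0} \<longrightarrow> G s = h s"
    using ex_admissible_version[OF T0 h_meas h_bound] by blast
  have u: "u = candidate_solution M S p P h g" by (simp add: u_def h_def[abs_def])
  have u_eq: "u t = Q t g + U G t" if "t \<in> {0<..T\<^sub>0}" for t
    unfolding u by (rule candidate_eq(2)[OF G(1,3) that])
  have well_defined: "\<forall>t\<in>{0<..T\<^sub>0}. candidate_well_defined M S p P h g t"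
    using candidate_eq(1)[OF G(1,3)] by blast
  have weak: "weak_solution w D L h g T\<^sub>0 u"
    unfolding u by (rule weak_solution_candidate[OF T0 G(1,3)])
  have unique: "\<forall>v. weak_solution w D L h g T\<^sub>0 v \<longrightarrow> (\<forall>t\<in>{0<..T\<^sub>0}. v t = u t)"
    using weak_solution_unique[OF T0 weak] by blast
  have regular: "(\<forall>t\<in>{0<..T\<^sub>0}. u t \<in> D) \<and> continuous_on {0<..T\<^sub>0} (\<lambda>t. L (u t))"
    if h_D: "\<forall>t\<in>{0<..T\<^sub>0}. h t \<in> D" and bdd: "bdd_above ((\<lambda>t. norm (L (h t))) ` {0<..T\<^sub>0})"
  proof -
    have "\<exists>K'. \<forall>t\<in>{0<..T\<^sub>0}. norm (L (h t)) \<le> K'"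
      using bdd by (simp add: bdd_above_def)
    then obtain K' where K': "\<forall>t\<in>{0<..T\<^sub>0}. norm (L (h t)) \<le> K'" by blast
    \<comment> \<open>\<open>L\<close> is unbounded, so measurability does not follow by
      composition; it is inherited from the difference quotients at times
      \<open>inverse (real (Suc n))\<close>, which are continuous in the vector.\<close>
    have "(\<lambda>t. L (h t)) \<in> borel_measurable (lebesgue_on {0<..T\<^sub>0})"
    proof (rule borel_measurable_LIMSEQ_metric)
      show "(\<lambda>t. (P (inverse (real (Suc n))) (h t) - h t) /\<^sub>R inverse (real (Suc n))) \<in> borel_measurable (lebesgue_on {0<..T\<^sub>0})" for n
        using h_meas by (intro borel_measurable_scaleR borel_measurable_diff measurable_P) auto
      fix t assume "t \<in> space (lebesgue_on {0<..T\<^sub>0})"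
      then have "((\<lambda>r. (P r (h t) - h t) /\<^sub>R r) \<longlongrightarrow> L (h t)) (at_right 0)"
        using h_D by (simp add: generator_iff space_restrict_space)
      moreover have "filterlim (\<lambda>n. inverse (real (Suc n))) (at_right 0) sequentially"
        using LIMSEQ_inverse_real_of_nat by (auto simp: filterlim_at intro!: always_eventually)
      ultimately show "(\<lambda>n. (P (inverse (real (Suc n))) (h t) - h t) /\<^sub>R inverse (real (Suc n))) \<longlonglongrightarrow> L (h t)"
        by (rule filterlim_compose)
    qed
    moreover have "AE t in lebesgue_on {0<..T\<^sub>0}. norm (L (h t)) \<le> K'"
      using K' by (intro AE_I2) (simp add: space_restrict_space)
    ultimately obtain G' where G': "admissible G'" "\<And>s. s \<notin> {0<..T\<^sub>0} \<Longrightarrow> G' s = 0"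
        "AE s in lborel. s \<in> {0<..T\<^sub>0} \<longrightarrow> G' s = L (h s)"
      using ex_admissible_version[OF T0] by blast
    \<comment> \<open>Outside \<open>{0<..T\<^sub>0}\<close> both versions are 0, and the identity
      holds there because \<open>L 0 = 0\<close>.\<close>
    have AE: "AE s in lborel. G s \<in> D \<and> L (G s) = G' s"
      using G(3) G'(3)
    proof eventually_elim
      case (elim s)
      then show ?case using h_D zero_in_D G(2)[of s] G'(2)[of s] by (cases "s \<in> {0<..T\<^sub>0}") auto
    qed
    note U_D = U_in_D[OF G(1) G'(1) AE]
    \<comment> \<open>The two terms enter the domain for different reasons: \<open>Q t g\<close> by
      smoothing, for arbitrary \<open>g\<close>, and the source term because \<open>f\<close> takes
      values in \<open>D\<close>.\<close>
    have u_D: "u t \<in> D" "L (u t) = L (Q t g) + U G' t" if t: "t \<in> {0<..T\<^sub>0}" for t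
      using L_linear[OF Q_smoothing(1)[of t g] U_D(1)[of t], of 1] t U_D(2)[of t] by (simp_all add: u_eq)
    have "continuous_on {0<..T\<^sub>0} (\<lambda>t. L (Q t g) + U G' t)"
      by (intro continuous_on_add continuous_on_subset[OF Q_smoothing(2)] continuous_on_subset[OF continuous_U[OF G'(1)]]) auto
    then have "continuous_on {0<..T\<^sub>0} (\<lambda>t. L (u t))"
      by (rule continuous_on_eq) (simp add: u_D)
    then show ?thesis using u_D by blast
  qed
  show ?thesis
    using well_defined weak unique regular unfolding h_def by blast
qed

end
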